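(* Let $q\in[-1,1]$ and let $\varrho(N)$, $N\in\mathbb{N}$, be probability measures on $\hat U(N)$. Assume there are functions $\Psi,\Phi$ analytic in a neighborhood of $1$ such that for every fixed $k\in\mathbb{N}$ \[ \lim_{N\to\infty}N\Big(\frac1N\log S_{\varrho(N)}(u_1,\dots,u_k,1^{N-k})-\sum_{i=1}^k\Psi(u_i)\Big)=\sum_{i=1}^k\Phi(u_i) \] uniformly in a neighborhood of $1^k$. Then for every $k\in\mathbb{N}$ \[ \lim_{N\to\infty}N\Big(\mathbb{E}_{\lambda\sim\varrho(N)}\Big[\int_{\mathbb{R}}t^k\,m_{N,PP(q)}[\lambda](dt)\Big]-\sum_{m=0}^k\binom km\frac1{(m+1)!}\frac{d^m}{du^m}\big(u^{k-q}(\Psi'(u))^{k-m}\big)\Big|_{u=1}\Big) \] \[ =\sum_{m=0}^{k-1}\binom k{m+1}\frac1{m!}\frac{d^m}{du^m}\Big(u^{k-q}\Big(\Phi'(u)-\frac{1-q}{2u}\Big)(\Psi'(u))^{k-m-1}\Big)\Big|_{u=1}. \]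
   Context: A signature of length $N$ is a tuple $\lambda=(\lambda_1\ge\dots\ge\lambda_N)\in\mathbb{Z}^N$; $\hat U(N)$ denotes the set of signatures of length $N$. For $\lambda\in\hat U(N)$, $\chi^{\lambda}(u_1,\dots,u_N)=\det(u_i^{\lambda_j+N-j})_{i,j}/\prod_{i<j}(u_i-u_j)$ is the rational Schur function. For a probability measure $\varrho(N)$ on $\hat U(N)$, the Schur generating function is $S_{\varrho(N)}(u_1,\dots,u_N)=\sum_{\lambda\in\hat U(N)}\varrho(N)[\lambda]\,\chi^\lambda(u_1,\dots,u_N)/\chi^\lambda(1^N)$, where $1^N=(1,\dots,1)$; it is assumed that this series converges uniformly in a neighborhood of $1^N$. For $q\in[-1,1]$ and $\lambda\in\hat U(N)$ the $q$-deformed Perelomov–Popov measure is \[ m_{N,PP(q)}[\lambda]=\frac1N\sum_{i=1}^N\Big(\prod_{j\ne i}\frac{(\lambda_i-i)-(\lambda_j-j)-q}{(\lambda_i-i)-(\lambda_j-j)}\Big)\delta\Big(\frac{\lambda_i+N-i}{N}\Big). \] *)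

theory Defs
  imports "HOL-Complex_Analysis.Complex_Analysis" "HOL-Probability.Probability_Mass_Function"
begin

text \<open>Signatures of length N, as integer lists (0-based: entry i is lambda_(i+1)),
  weakly decreasing.\<close>
definition signatures :: "nat \<Rightarrow> int list set" where
  "signatures N = {l. length l = N \<and> sorted_wrt (\<lambda>a b. a \<ge> b) l}"

text \<open>Points u = (u_1,...,u_N) are represented as functions nat => complex,
  coordinate j+1 being u j; only the first N coordinates are used.\<close>

text \<open>Numerator det(u_i^(lambda_j+N-j)) via the Leibniz formula (0-based indices).\<close>
definition schur_num :: "nat \<Rightarrow> int list \<Rightarrow> (nat \<Rightarrow> complex) \<Rightarrow> complex" where
  "schur_num N l u = (\<Sum>p | p permutes {..<N}. of_int (sign p) *
      (\<Prod>i<N. u i powi (l ! (p i) + int N - 1 - int (p i))))"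

definition vandermonde :: "nat \<Rightarrow> (nat \<Rightarrow> complex) \<Rightarrow> complex" where
  "vandermonde N u = (\<Prod>i<N. \<Prod>j\<in>{i<..<N}. (u i - u j))"

definition distinct_pts :: "nat \<Rightarrow> (nat \<Rightarrow> complex) set" where
  "distinct_pts N = {u. \<forall>i<N. \<forall>j<N. i \<noteq> j \<longrightarrow> u i \<noteq> u j}"

text \<open>Rational Schur function: the determinant ratio, extended by continuity
  (limit over points with pairwise distinct coordinates) to all points.\<close>
definition schur :: "nat \<Rightarrow> int list \<Rightarrow> (nat \<Rightarrow> complex) \<Rightarrow> complex" where
  "schur N l u = Lim (at u within distinct_pts N) (\<lambda>v. schur_num N l v / vandermonde N v)"

definition ones :: "nat \<Rightarrow> complex" where
  "ones = (\<lambda>_. 1)"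

definition sgf_term :: "int list pmf \<Rightarrow> nat \<Rightarrow> int list \<Rightarrow> (nat \<Rightarrow> complex) \<Rightarrow> complex" where
  "sgf_term \<rho> N l u = complex_of_real (pmf \<rho> l) * schur N l u / schur N l ones"

definition sgf :: "int list pmf \<Rightarrow> nat \<Rightarrow> (nat \<Rightarrow> complex) \<Rightarrow> complex" where
  "sgf \<rho> N u = infsum (\<lambda>l. sgf_term \<rho> N l u) (signatures N)"

definition polydisc :: "nat \<Rightarrow> real \<Rightarrow> (nat \<Rightarrow> complex) set" where
  "polydisc k \<epsilon> = {u. \<forall>i<k. cmod (u i - 1) < \<epsilon>}"

definition pad_ones :: "nat \<Rightarrow> (nat \<Rightarrow> complex) \<Rightarrow> (nat \<Rightarrow> complex)" where
  "pad_ones k u = (\<lambda>i. if i < k then u i else 1)"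

text \<open>Weight of the atom at (lambda_i+N-i)/N in the q-deformed Perelomov--Popov measure
  (0-based i; lambda_i - i shifted by a constant, which does not change differences).\<close>
definition pp_weight :: "real \<Rightarrow> nat \<Rightarrow> int list \<Rightarrow> nat \<Rightarrow> real" where
  "pp_weight q N l i = (\<Prod>j\<in>{..<N} - {i}.
     ((real_of_int (l ! i) - real i) - (real_of_int (l ! j) - real j) - q) /
     ((real_of_int (l ! i) - real i) - (real_of_int (l ! j) - real j)))"

definition pp_atom :: "nat \<Rightarrow> int list \<Rightarrow> nat \<Rightarrow> real" where
  "pp_atom N l i = (real_of_int (l ! i) + real N - real (i + 1)) / real N"

text \<open>k-th moment: integral of t^k against m_{N,PP(q)}[lambda] (a finite combination of
  Dirac masses).\<close>
definition pp_moment :: "real \<Rightarrow> nat \<Rightarrow> int list \<Rightarrow> nat \<Rightarrow> real" where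
  "pp_moment q N l k = (1 / real N) * (\<Sum>i<N. pp_weight q N l i * (pp_atom N l i) ^ k)"

end

theory Submission
  imports Defs "Jordan_Normal_Form.Determinant" "HOL-Combinatorics.Stirling"
begin

text \<open>
  Write \<open>l\<^sub>j = \<lambda>\<^sub>j + N - j\<close>. The operator \<open>V\<^sup>-\<^sup>1 (\<Sum>\<^sub>i u\<^sub>i\<^bsup>m-q\<^esup> \<partial>\<^sub>i\<^sup>m) V\<close>, with \<open>V\<close> the Vandermonde product, sends the
  normalised Schur function of \<open>\<lambda>\<close> to a function whose value at \<open>1\<^sup>N\<close> is the \<open>m\<close>-th factorial moment of
  the numbers \<open>l\<^sub>j\<close> weighted by the \<open>q\<close>-deformed Perelomov--Popov weights, because these weights are the ratios
  \<open>V(l - q e\<^sub>j) / V(l)\<close>. On a product \<open>\<Prod>\<^sub>i g(u\<^sub>i)\<close> this value is the trace of the operator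
  \<open>g\<^sup>-\<^sup>1 u\<^bsup>m-q\<^esup> \<partial>\<^sup>m g\<close> compressed to polynomials of degree less than \<open>N\<close> in \<open>u - 1\<close>, and Lagrange interpolation
  writes every Schur function as a combination of such products. For a general symmetric \<open>S\<close> one obtains
  \<open>\<Sum>\<^sub>j m!/(m-j)! binom(N,j+1) T\<^sub>j(S)\<close>, where \<open>T\<^sub>j(S)\<close> is the coefficient of \<open>e\<^sup>j\<close> in
  \<open>(1+e)\<^bsup>m-q\<^esup> (\<partial>\<^sub>1\<^bsup>m-j\<^esup> S)\<close> taken at the points \<open>1 + e \<omega>\<^sup>i\<close> (\<open>i \<le> j\<close>, \<open>\<omega>\<close> a primitive root of unity of order \<open>j + 1\<close>)
  and \<open>1\<close> elsewhere. Thus only \<open>m + 1\<close> variables matter, and the expectation is expressed through the Schur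
  generating function.

  The Schur functions have nonnegative coefficients (branching rule), hence the series of the generating
  function converges uniformly on a polydisc independent of \<open>N\<close> and the limits in the hypothesis may be
  differentiated. Since \<open>S\<close> restricted to the above points is invariant under \<open>e \<mapsto> \<omega> e\<close>, it can be divided out,
  and \<open>S\<^sup>-\<^sup>1 \<partial>\<^sub>1\<^sup>r S = N\<^sup>r \<Psi>'\<^sup>r + N\<^bsup>r-1\<^esup> (r \<Phi>' \<Psi>'\<^bsup>r-1\<^esup> + binom(r,2) \<Psi>'' \<Psi>'\<^bsup>r-2\<^esup>) + o(N\<^bsup>r-1\<^esup>)\<close> gives the expansion.
\<close>

section \<open>Determinants\<close>

text \<open>The trace contains the inverse of \<open>g\<close>, so it is not linear in the product
  of the \<open>g(u_i)\<close>, whereas the expectation is linear in the generating function. The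
  roots of unity remove this division: the product of \<open>g\<close> over the \<open>j + 1\<close>
  points \<open>1 + e w^i\<close> is invariant under \<open>e -> w e\<close>, hence constant up to
  order \<open>j\<close>, and \<open>1 / g(1 + e)\<close> can be traded for the factors at the other
  \<open>j\<close> points. At \<open>1^N\<close> the Vandermonde product vanishes. Instead of a
  confluent limit the proof uses truncated power series in \<open>u - 1\<close>: column
  \<open>j\<close> of a determinant holds the first \<open>N\<close> Taylor coefficients of
  \<open>u\<close> to the power \<open>l_j\<close>. The trace formula asks for columns
  \<open>G h_j\<close> with \<open>deg h_j < N\<close>, which these powers do not have in general;
  multilinear expansion over common interpolation nodes produces them. The term
  \<open>(1 - q) / (2 u)\<close> in the limit is what remains of the lower-order parts of the
  binomial coefficients and of the passage from factorial to ordinary moments.\<close>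

definition ldet :: "nat \<Rightarrow> (nat \<Rightarrow> nat \<Rightarrow> 'a::comm_ring_1) \<Rightarrow> 'a" where
  "ldet N A = (\<Sum>p | p permutes {..<N}. of_int (sign p) * (\<Prod>i<N. A i (p i)))"

lemma ldet_eq_det: "ldet N A = Determinant.det (Matrix.mat N N (\<lambda>(i,j). A i j))"
  unfolding ldet_def Determinant.det_def
  by (auto simp: atLeast0LessThan dest: permutes_in_image intro!: sum.cong prod.cong)

lemma ldet_cong: "(\<And>i j. i < N \<Longrightarrow> j < N \<Longrightarrow> A i j = B i j) \<Longrightarrow> ldet N A = ldet N B"
  unfolding ldet_eq_det by (intro arg_cong[of _ _ Determinant.det] cong_mat) auto

lemma ldet_transpose: "ldet N (\<lambda>i j. A j i) = ldet N A"
proof -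
  have "Matrix.mat N N (\<lambda>(i,j). A j i) = transpose_mat (Matrix.mat N N (\<lambda>(i,j). A i j))"
    by (rule eq_matI) auto
  then show ?thesis
    unfolding ldet_eq_det by (metis det_transpose mat_carrier)
qed

lemma ldet_mult: "ldet N (\<lambda>i j. \<Sum>s<N. A i s * B s j) = ldet N A * ldet N B"
proof -
  have "Matrix.mat N N (\<lambda>(i,j). \<Sum>s<N. A i s * B s j) =
      Matrix.mat N N (\<lambda>(i,j). A i j) * Matrix.mat N N (\<lambda>(i,j). B i j)"
    by (rule eq_matI) (auto simp: scalar_prod_def atLeast0LessThan)
  then show ?thesis
    unfolding ldet_eq_det by (simp add: Determinant.det_mult[of _ N])
qed

lemma ldet_scale_rows: "ldet N (\<lambda>i j. c i * A i j) = (\<Prod>i<N. c i) * ldet N A"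
  unfolding ldet_def by (simp add: prod.distrib sum_distrib_left mult_ac)

lemma ldet_scale_cols: "ldet N (\<lambda>i j. c j * A i j) = (\<Prod>i<N. c i) * ldet N A"
  using ldet_scale_rows[of N c "\<lambda>i j. A j i"] ldet_transpose[of N A]
    ldet_transpose[of N "\<lambda>i j. c j * A i j"] by simp

lemma ldet_lower_triangular:
  assumes "\<And>i j. i < j \<Longrightarrow> j < N \<Longrightarrow> A i j = 0"
  shows "ldet N A = (\<Prod>i<N. A i i)"
proof -
  have "ldet N A = prod_list (diag_mat (Matrix.mat N N (\<lambda>(i,j). A i j)))"
    unfolding ldet_eq_det by (rule det_lower_triangular[of N]) (use assms in auto)
  also have "diag_mat (Matrix.mat N N (\<lambda>(i,j). A i j)) = map (\<lambda>i. A i i) [0..<N]"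
    unfolding diag_mat_def by auto
  also have "prod_list \<dots> = (\<Prod>i<N. A i i)"
    by (simp add: prod.distinct_set_conv_list[symmetric] atLeast0LessThan)
  finally show ?thesis .
qed

lemma ldet_sum_rows:
  assumes "\<And>i. i < N \<Longrightarrow> finite (B i)"
  shows "ldet N (\<lambda>i j. \<Sum>b\<in>B i. A i j b) = (\<Sum>\<beta>\<in>Pi\<^sub>E {..<N} B. ldet N (\<lambda>i j. A i j (\<beta> i)))"
  unfolding ldet_def using assms
  by (subst prod_sum_PiE) (auto simp: sum_distrib_left intro: sum.swap)

lemma ldet_sum_cols:
  assumes "\<And>j. j < N \<Longrightarrow> finite (B j)"
  shows "ldet N (\<lambda>i j. \<Sum>b\<in>B j. A i j b) = (\<Sum>\<beta>\<in>Pi\<^sub>E {..<N} B. ldet N (\<lambda>i j. A i j (\<beta> j)))"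
proof -
  have "ldet N (\<lambda>i j. \<Sum>b\<in>B j. A i j b) = ldet N (\<lambda>j i. \<Sum>b\<in>B j. A i j b)"
    by (rule ldet_transpose)
  also have "\<dots> = (\<Sum>\<beta>\<in>Pi\<^sub>E {..<N} B. ldet N (\<lambda>j i. A i j (\<beta> j)))"
    using assms by (rule ldet_sum_rows)
  also have "\<dots> = (\<Sum>\<beta>\<in>Pi\<^sub>E {..<N} B. ldet N (\<lambda>i j. A i j (\<beta> j)))"
    by (intro sum.cong refl ldet_transpose[symmetric])
  finally show ?thesis .
qed

lemma ldet_Suc_last_row:
  assumes "\<And>j. j < N \<Longrightarrow> A N j = 0" "A N N = 1"
  shows "ldet (Suc N) A = ldet N A"
proof -
  let ?M = "Matrix.mat (Suc N) (Suc N) (\<lambda>(i,j). A i j)"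
  have "Determinant.det ?M = (\<Sum>j<Suc N. ?M $$ (N,j) * cofactor ?M N j)"
    by (rule laplace_expansion_row) auto
  also have "\<dots> = cofactor ?M N N"
    using assms by simp
  also have "\<dots> = Determinant.det (Matrix.mat N N (\<lambda>(i,j). A i j))"
  proof -
    have "mat_delete ?M N N = Matrix.mat N N (\<lambda>(i,j). A i j)"
      unfolding mat_delete_def by (rule eq_matI) auto
    then show ?thesis
      unfolding cofactor_def by (simp add: power_add[symmetric] flip: mult_2)
  qed
  finally show ?thesis unfolding ldet_eq_det .
qed

text \<open>The directional derivative of the determinant at \<open>C\<close> in direction \<open>M C\<close>.\<close>
lemma ldet_replace_cols_trace:
  "(\<Sum>c<N. ldet N (\<lambda>i j. if j = c then (\<Sum>s<N. M i s * C s c) else C i j)) =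
   (\<Sum>i<N. M i i) * ldet N C"
proof -
  let ?C = "Matrix.mat N N (\<lambda>(i,j). C i j)"
  have *: "ldet N (\<lambda>i j. if j = c then v i else C i j) = (\<Sum>i<N. v i * cofactor ?C i c)"
    if c: "c < N" for c v
  proof -
    let ?M = "Matrix.mat N N (\<lambda>(i,j). if j = c then v i else C i j)"
    have "Determinant.det ?M = (\<Sum>i<N. ?M $$ (i,c) * cofactor ?M i c)"
      using c by (intro laplace_expansion_column) auto
    also have "\<dots> = (\<Sum>i<N. v i * cofactor ?C i c)"
    proof (intro sum.cong refl arg_cong2[of _ _ _ _ "(*)"])
      fix i assume "i \<in> {..<N}"
      then show "?M $$ (i,c) = v i" using c by auto
      have "mat_delete ?M i c = mat_delete ?C i c"
        unfolding mat_delete_def using c by (intro eq_matI) auto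
      then show "cofactor ?M i c = cofactor ?C i c" by (simp add: cofactor_def)
    qed
    finally show ?thesis unfolding ldet_eq_det by simp
  qed
  \<comment> \<open>This is \<open>C * adj C = det C * 1\<close>; it collapses the sum over the
    replaced columns to the diagonal of \<open>M\<close>.\<close>
  have adj: "(\<Sum>c<N. C s c * cofactor ?C i c) = (if s = i then ldet N C else 0)"
    if "s < N" "i < N" for s i
  proof -
    have "(?C * adj_mat ?C) $$ (s,i) = (Determinant.det ?C \<cdot>\<^sub>m 1\<^sub>m N) $$ (s,i)"
      by (subst adj_mat(2)[of _ N]) auto
    then show ?thesis using that
      unfolding ldet_eq_det adj_mat_def
      by (simp add: scalar_prod_def atLeast0LessThan)
  qed
  have "(\<Sum>c<N. ldet N (\<lambda>i j. if j = c then (\<Sum>s<N. M i s * C s c) else C i j)) =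
        (\<Sum>c<N. \<Sum>i<N. (\<Sum>s<N. M i s * C s c) * cofactor ?C i c)"
    by (intro sum.cong refl) (simp add: *)
  also have "\<dots> = (\<Sum>i<N. \<Sum>s<N. M i s * (\<Sum>c<N. C s c * cofactor ?C i c))"
    unfolding sum_distrib_left sum_distrib_right
    by (subst sum.swap, rule sum.cong[OF refl], subst sum.swap) (simp only: mult.assoc)
  also have "\<dots> = (\<Sum>i<N. M i i * ldet N C)"
    by (intro sum.cong refl) (simp add: adj if_distrib[of "\<lambda>x. _ * x"] sum.delta cong: if_cong)
  finally show ?thesis by (simp add: sum_distrib_right)
qed

section \<open>Alternants and the branching rule\<close>

lemma ldet_poly:
  fixes p :: "nat \<Rightarrow> 'a::comm_ring_1 poly"
  assumes "\<And>j. j < N \<Longrightarrow> degree (p j) < N"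
  shows "ldet N (\<lambda>i j. poly (p j) (u i)) = ldet N (\<lambda>i s. u i ^ s) * ldet N (\<lambda>s j. coeff (p j) s)"
proof -
  have "poly (p j) x = (\<Sum>s<N. x ^ s * coeff (p j) s)" if "j < N" for j x
  proof -
    have "poly (p j) x = (\<Sum>s\<le>degree (p j). coeff (p j) s * x ^ s)" by (rule poly_altdef)
    also have "\<dots> = (\<Sum>s<N. coeff (p j) s * x ^ s)"
      using assms[OF that] by (intro sum.mono_neutral_left) (auto simp: coeff_eq_0)
    finally show ?thesis by (simp add: mult.commute)
  qed
  then have "ldet N (\<lambda>i j. poly (p j) (u i)) = ldet N (\<lambda>i j. \<Sum>s<N. u i ^ s * coeff (p j) s)"
    by (intro ldet_cong) auto
  then show ?thesis by (simp add: ldet_mult)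
qed

text \<open>The exponents of the power matrix increase along the columns, while
  \<open>vandermonde\<close> multiplies \<open>u i - u j\<close> for \<open>i < j\<close>;
  determinant and product differ by this sign.\<close>

definition vandermonde_sign :: "nat \<Rightarrow> complex" where
  "vandermonde_sign N = (\<Prod>i<N. (-1) ^ i)"

lemma vandermonde_sign_nz: "vandermonde_sign N \<noteq> 0"
  by (simp add: vandermonde_sign_def)

lemma vandermonde_Suc: "vandermonde (Suc N) u = vandermonde N u * (\<Prod>i<N. u i - u N)"
proof -
  have "{i<..<Suc N} = insert N {i<..<N}" if "i < N" for i using that by auto
  then have "(\<Prod>i<N. \<Prod>j\<in>{i<..<Suc N}. (u i - u j)) = (\<Prod>i<N. (u i - u N) * (\<Prod>j\<in>{i<..<N}. (u i - u j)))"
    by (intro prod.cong) auto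
  moreover have "{N<..<Suc N} = {}" by auto
  ultimately show ?thesis by (simp add: vandermonde_def prod.distrib)
qed

lemma vandermonde_0 [simp]: "vandermonde 0 u = 1"
  by (simp add: vandermonde_def)

lemma ldet_vandermonde: "ldet N (\<lambda>i s. u i ^ s) = vandermonde_sign N * vandermonde N u"
proof -
  \<comment> \<open>Newton basis at the points \<open>u\<close>: the change of basis is
    unitriangular, and \<open>p j\<close> vanishes at \<open>u i\<close> for \<open>i < j\<close>,
    so the matrix of values is lower triangular.\<close>
  define p :: "nat \<Rightarrow> complex poly" where "p = (\<lambda>j. \<Prod>s<j. [:- u s, 1:])"
  have deg: "degree (p j) = j" for j
    unfolding p_def by (subst degree_prod_sum_eq) auto
  have monic: "coeff (p j) j = 1" for j
    using lead_coeff_prod[of "\<lambda>s. [:- u s, 1:]" "{..<j}"] deg[of j] unfolding p_def by simp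
  have "ldet N (\<lambda>s j. coeff (p j) s) = ldet N (\<lambda>j s. coeff (p j) s)"
    by (rule ldet_transpose[symmetric])
  also have "\<dots> = (\<Prod>i<N. coeff (p i) i)"
    by (rule ldet_lower_triangular) (simp add: coeff_eq_0 deg)
  finally have "ldet N (\<lambda>s j. coeff (p j) s) = 1" by (simp add: monic)
  then have "ldet N (\<lambda>i s. u i ^ s) = ldet N (\<lambda>i j. poly (p j) (u i))"
    by (subst ldet_poly) (auto simp: deg)
  also have "\<dots> = (\<Prod>i<N. poly (p i) (u i))"
    by (rule ldet_lower_triangular) (auto simp: p_def poly_prod)
  also have "\<dots> = vandermonde_sign N * vandermonde N u"
  proof (induction N)
    case (Suc N)
    have "poly (p N) (u N) = (\<Prod>i<N. (-1) * (u i - u N))" by (simp add: p_def poly_prod)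
    also have "\<dots> = (-1) ^ N * (\<Prod>i<N. u i - u N)" unfolding prod.distrib by simp
    finally show ?case using Suc by (simp add: vandermonde_sign_def vandermonde_Suc mult_ac)
  qed (simp add: vandermonde_sign_def)
  finally show ?thesis .
qed

lemma vandermonde_scale: "vandermonde N (\<lambda>i. u i * t) = t ^ (\<Sum>i<N. card {i<..<N}) * vandermonde N u"
  unfolding vandermonde_def
  by (simp add: left_diff_distrib[symmetric] prod.distrib power_sum)

lemma vandermonde_shift: "vandermonde N (\<lambda>i. u i - c) = vandermonde N u"
  unfolding vandermonde_def by simp

lemma vandermonde_cong: "(\<And>i. i < N \<Longrightarrow> u i = v i) \<Longrightarrow> vandermonde N u = vandermonde N v"
  unfolding vandermonde_def by (intro prod.cong) auto

lemma vandermonde_nonzero_iff: "vandermonde N u \<noteq> 0 \<longleftrightarrow> u \<in> distinct_pts N"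
proof
  assume "vandermonde N u \<noteq> 0"
  then have *: "i < N \<Longrightarrow> j < N \<Longrightarrow> i < j \<Longrightarrow> u i \<noteq> u j" for i j
    unfolding vandermonde_def by auto
  have "u i \<noteq> u j" if "i < N" "j < N" "i \<noteq> j" for i j
    using *[of i j] *[of j i] that by (cases i j rule: linorder_cases) auto
  then show "u \<in> distinct_pts N"
    unfolding distinct_pts_def by blast
qed (auto simp: vandermonde_def distinct_pts_def)

lemma powi_geometric_sum:
  fixes u :: complex and m n :: int
  assumes "u \<noteq> 0" "m \<le> n"
  shows "u powi n - u powi m = (u - 1) * (\<Sum>b\<in>{m..<n}. u powi b)"
  using assms(2)
proof (induction n rule: int_ge_induct)
  case (step n)
  have "{m..<n + 1} = insert n {m..<n}" using step by auto
  then have "(u - 1) * (\<Sum>b\<in>{m..<n + 1}. u powi b) = (u - 1) * u powi n + (u powi n - u powi m)"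
    using step by (simp add: distrib_left)
  also have "\<dots> = u powi (n + 1) - u powi m"
    using assms(1) by (simp add: power_int_add left_diff_distrib mult.commute)
  finally show ?case ..
qed auto

text \<open>Subtracting from each column its right neighbour turns the last row into 0, ..., 0, 1,
  because \<open>u N = 1\<close>; the other entries become geometric sums with the factor
  \<open>u i - 1\<close>. The half-open intervals express interlacing for shifted, strictly
  decreasing exponents.\<close>

lemma alternant_branching:
  fixes u :: "nat \<Rightarrow> complex" and a :: "nat \<Rightarrow> int"
  assumes u: "\<And>i. i < N \<Longrightarrow> u i \<noteq> 0" "u N = 1" and a: "\<And>j. j < N \<Longrightarrow> a (Suc j) \<le> a j"
  shows "ldet (Suc N) (\<lambda>i j. u i powi a j) =
    (\<Prod>i<N. u i - 1) *
    (\<Sum>b\<in>Pi\<^sub>E {..<N} (\<lambda>j. {a (Suc j)..<a j}). ldet N (\<lambda>i j. u i powi b j))"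
proof -
  define U :: "nat \<Rightarrow> nat \<Rightarrow> complex" where "U = (\<lambda>s j. if s = j then 1 else if s = Suc j then -1 else 0)"
  have "ldet (Suc N) U = 1"
    by (subst ldet_lower_triangular) (auto simp: U_def)
  then have "ldet (Suc N) (\<lambda>i j. u i powi a j) = ldet (Suc N) (\<lambda>i j. \<Sum>s<Suc N. u i powi a s * U s j)"
    by (simp only: ldet_mult mult_1_right)
  also have "\<dots> = ldet (Suc N) (\<lambda>i j. u i powi a j - (if j < N then u i powi a (Suc j) else 0))"
  proof (rule ldet_cong)
    fix i j assume "i < Suc N" "j < Suc N"
    have "(\<Sum>s<Suc N. u i powi a s * U s j) =
      (\<Sum>s<Suc N. (if s = j then u i powi a s else 0) - (if s = Suc j then u i powi a s else 0))"
      by (intro sum.cong) (auto simp: U_def)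
    also have "\<dots> = u i powi a j - (if j < N then u i powi a (Suc j) else 0)"
      unfolding sum_subtractf using \<open>j < Suc N\<close> by (subst (1 2) sum.delta) auto
    finally show "(\<Sum>s<Suc N. u i powi a s * U s j) = \<dots>" .
  qed
  also have "\<dots> = ldet N (\<lambda>i j. u i powi a j - (if j < N then u i powi a (Suc j) else 0))"
    by (rule ldet_Suc_last_row) (use u in auto)
  also have "\<dots> = ldet N (\<lambda>i j. (u i - 1) * (\<Sum>b\<in>{a (Suc j)..<a j}. u i powi b))"
    by (rule ldet_cong) (use u a powi_geometric_sum in auto)
  also have "\<dots> = (\<Prod>i<N. u i - 1) * ldet N (\<lambda>i j. (\<Sum>b\<in>{a (Suc j)..<a j}. u i powi b))"
    by (rule ldet_scale_rows)
  finally show ?thesis by (subst (asm) ldet_sum_cols) auto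
qed

text \<open>A monomial is an exponent function and its coefficient is its multiplicity in the list,
  so nonnegativity of the coefficients is built into the encoding.\<close>

definition pos_laurent :: "nat \<Rightarrow> ((nat \<Rightarrow> complex) \<Rightarrow> complex) \<Rightarrow> bool" where
  "pos_laurent N f \<longleftrightarrow> (\<exists>es. \<forall>u. (\<forall>i<N. u i \<noteq> 0) \<longrightarrow>
     f u = (\<Sum>e\<leftarrow>es. \<Prod>i<N. u i powi (e i :: int)))"

lemma pos_laurent_sum:
  assumes "finite B" "\<And>b. b \<in> B \<Longrightarrow> pos_laurent N (f b)"
  shows "pos_laurent N (\<lambda>u. \<Sum>b\<in>B. f b u)"
  using assms
proof (induction B rule: finite_induct)
  case empty
  show ?case unfolding pos_laurent_def by (intro exI[of _ "[]"]) auto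
next
  case (insert b B)
  obtain es es' where
    "\<forall>u. (\<forall>i<N. u i \<noteq> 0) \<longrightarrow> (\<Sum>b\<in>B. f b u) = (\<Sum>e\<leftarrow>es. \<Prod>i<N. u i powi (e i :: int))"
    "\<forall>u. (\<forall>i<N. u i \<noteq> 0) \<longrightarrow> f b u = (\<Sum>e\<leftarrow>es'. \<Prod>i<N. u i powi (e i :: int))"
    using insert unfolding pos_laurent_def by fastforce
  then show ?case unfolding pos_laurent_def using insert
    by (intro exI[of _ "es' @ es"]) auto
qed

lemma powi_sum: "t \<noteq> 0 \<Longrightarrow> (\<Prod>i<n. t powi e i) = t powi (\<Sum>i<n. e i)"
  for t :: complex and n :: nat
  by (induction n) (auto simp: power_int_add)

text \<open>Restores the last variable: a homogeneous function of degree \<open>c\<close> is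
  recovered from its values at points whose last coordinate is 1.\<close>

lemma pos_laurent_homogenize:
  assumes "pos_laurent N f"
  shows "pos_laurent (Suc N) (\<lambda>u. u N powi c * f (\<lambda>i. u i * inverse (u N)))"
proof -
  obtain es where es: "\<And>u. (\<forall>i<N. u i \<noteq> 0) \<Longrightarrow> f u = (\<Sum>e\<leftarrow>es. \<Prod>i<N. u i powi (e i :: int))"
    using assms unfolding pos_laurent_def by auto
  let ?es = "map (\<lambda>e i. if i < N then e i else c - (\<Sum>i<N. e i)) es"
  have "u N powi c * f (\<lambda>i. u i * inverse (u N)) = (\<Sum>e\<leftarrow>?es. \<Prod>i<Suc N. u i powi (e i :: int))"
    if u: "\<forall>i<Suc N. u i \<noteq> 0" for u
  proof -
    have *: "(\<Prod>i<N. inverse (u N powi e i)) = inverse (u N powi (\<Sum>i<N. e i))" for e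
      using u by (simp add: prod_inversef[unfolded o_def] powi_sum)
    have "u N powi c * (\<Prod>i<N. (u i * inverse (u N)) powi e i) =
      (\<Prod>i<N. u i powi e i) * u N powi (c - (\<Sum>i<N. e i))" for e
      using u by (simp add: power_int_mult_distrib prod.distrib power_int_inverse powi_sum
         power_int_diff divide_inverse *)
    then show ?thesis using u
      by (simp add: es sum_list_const_mult[symmetric] o_def)
  qed
  then show ?thesis unfolding pos_laurent_def by blast
qed

text \<open>Induction by the branching rule: scaling by \<open>1 / u N\<close> moves the last
  coordinate to 1, and the interlacing exponents \<open>b\<close> are again strictly
  decreasing.\<close>

lemma alternant_pos_laurent:
  assumes "\<And>i j. i < j \<Longrightarrow> j < N \<Longrightarrow> a j < a i"
  shows "\<exists>f. pos_laurent N f \<and>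
    (\<forall>u. (\<forall>i<N. u i \<noteq> 0) \<longrightarrow> ldet N (\<lambda>i j. u i powi a j) = vandermonde N u * f u)"
  using assms
proof (induction N arbitrary: a)
  case 0
  show ?case
    by (intro exI[of _ "\<lambda>_. 1"])
      (auto simp: pos_laurent_def ldet_def intro!: exI[of _ "[\<lambda>_. 0]"])
next
  case (Suc N)
  let ?B = "Pi\<^sub>E {..<N} (\<lambda>j. {a (Suc j)..<a j})"
  have "\<exists>f. pos_laurent N f \<and>
    (\<forall>u. (\<forall>i<N. u i \<noteq> 0) \<longrightarrow> ldet N (\<lambda>i j. u i powi b j) = vandermonde N u * f u)" if b: "b \<in> ?B" for b
  proof (rule Suc.IH)
    fix i j assume ij: "i < j" "j < N"
    have "b j < a j" "a (Suc i) \<le> b i" using b ij by (auto simp: PiE_iff)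
    moreover have "a j \<le> a (Suc i)"
      using Suc.prems[of "Suc i" j] ij by (cases "Suc i = j") auto
    ultimately show "b j < b i" by linarith
  qed
  then have "\<forall>b\<in>?B. \<exists>f. pos_laurent N f \<and>
    (\<forall>u. (\<forall>i<N. u i \<noteq> 0) \<longrightarrow> ldet N (\<lambda>i j. u i powi b j) = vandermonde N u * f u)"
    by blast
  from bchoice[OF this] obtain f where f: "\<And>b. b \<in> ?B \<Longrightarrow> pos_laurent N (f b)"
    "\<And>b u. b \<in> ?B \<Longrightarrow> (\<forall>i<N. u i \<noteq> 0) \<Longrightarrow> ldet N (\<lambda>i j. u i powi b j) = vandermonde N u * f b u"
    by blast
  \<comment> \<open>\<open>d\<close> is the degree of the Vandermonde product in
    \<open>Suc N\<close> variables, so \<open>c\<close> is the degree of homogeneity of the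
    quotient.\<close>
  define d where "d = (\<Sum>i<Suc N. card {i<..<Suc N})"
  define c where "c = (\<Sum>i<Suc N. a i) - int d"
  define F where "F = (\<lambda>u. u N powi c * (\<Sum>b\<in>?B. f b (\<lambda>i. u i * inverse (u N))))"
  have "pos_laurent N (\<lambda>u. \<Sum>b\<in>?B. f b u)"
    by (rule pos_laurent_sum) (auto intro!: finite_PiE f)
  then have "pos_laurent (Suc N) F"
    unfolding F_def by (rule pos_laurent_homogenize)
  moreover have "ldet (Suc N) (\<lambda>i j. u i powi a j) = vandermonde (Suc N) u * F u"
    if u: "\<forall>i<Suc N. u i \<noteq> 0" for u
  proof -
    define t where "t = u N"
    have t: "t \<noteq> 0" using u by (simp add: t_def)
    define v where "v = (\<lambda>i. u i * inverse t)"
    have "t * v i = u i" for i using t by (simp add: v_def)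
    then have "ldet (Suc N) (\<lambda>i j. u i powi a j) = ldet (Suc N) (\<lambda>i j. t powi a j * v i powi a j)"
      by (simp add: power_int_mult_distrib[symmetric])
    also have "\<dots> = (\<Prod>j<Suc N. t powi a j) * ldet (Suc N) (\<lambda>i j. v i powi a j)"
      by (rule ldet_scale_cols)
    also have "ldet (Suc N) (\<lambda>i j. v i powi a j) = (\<Prod>i<N. v i - 1) * (\<Sum>b\<in>?B. ldet N (\<lambda>i j. v i powi b j))"
      using u t Suc.prems by (intro alternant_branching) (auto simp: v_def t_def less_imp_le)
    also have "(\<Sum>b\<in>?B. ldet N (\<lambda>i j. v i powi b j)) = vandermonde N v * (\<Sum>b\<in>?B. f b v)"
      unfolding sum_distrib_left using u t by (intro sum.cong refl f) (auto simp: v_def)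
    also have "(\<Prod>j<Suc N. t powi a j) * ((\<Prod>i<N. v i - 1) * (vandermonde N v * (\<Sum>b\<in>?B. f b v))) =
        t powi (\<Sum>i<Suc N. a i) * (vandermonde (Suc N) v * (\<Sum>b\<in>?B. f b v))"
      using t by (simp only: powi_sum[OF t] vandermonde_Suc) (simp add: v_def t_def mult_ac)
    also have "vandermonde (Suc N) v = inverse t ^ d * vandermonde (Suc N) u"
      unfolding v_def d_def by (rule vandermonde_scale)
    also have "t powi (\<Sum>i<Suc N. a i) * (inverse t ^ d * vandermonde (Suc N) u * (\<Sum>b\<in>?B. f b v)) =
       vandermonde (Suc N) u * F u"
      using t unfolding F_def c_def v_def t_def[symmetric]
      by (simp add: power_int_diff power_inverse divide_inverse mult_ac)
    finally show ?thesis .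
  qed
  ultimately show ?case by blast
qed

section \<open>Evaluating the continuous extension of the determinant ratio\<close>

lemma tendsto_coordinate:
  fixes u :: "nat \<Rightarrow> complex"
  shows "((\<lambda>v. v i) \<longlongrightarrow> u i) (at u within S)"
proof -
  have "continuous_on UNIV (\<lambda>v :: nat \<Rightarrow> complex. v i)" by simp
  then have "((\<lambda>v. v i) \<longlongrightarrow> u i) (at u)" by (simp add: continuous_on)
  then show ?thesis by (rule tendsto_within_subset) simp
qed

text \<open>Along \<open>u i + t (i + 1)\<close> no two of the first \<open>N\<close> coordinates
  agree for small nonzero \<open>t\<close>. A nontrivial filter makes the \<open>Lim\<close> in
  \<open>schur\<close> unique.\<close>

lemma at_within_distinct_pts_nontrivial: "at u within distinct_pts N \<noteq> bot"
proof -
  define w where "w = (\<lambda>t::real. (\<lambda>i. u i + complex_of_real t * of_nat (Suc i)))"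
  have lim: "(w \<longlongrightarrow> u) (at 0)"
  proof -
    have "continuous_on UNIV w"
      unfolding w_def by (intro continuous_on_coordinatewise_then_product continuous_intros)
    moreover have "w 0 = u" by (simp add: w_def)
    ultimately show ?thesis by (metis UNIV_I continuous_on_def)
  qed
  have dist: "\<forall>\<^sub>F t in at 0. w t i \<noteq> w t j" if "i \<noteq> j" for i j
  proof (cases "u i = u j")
    case True
    have "\<forall>\<^sub>F t in at (0::real). t \<noteq> 0" by (simp add: eventually_at_filter)
    then show ?thesis
    proof eventually_elim
      case (elim t)
      then show ?case using True that unfolding w_def by simp
    qed
  next
    case False
    have "((\<lambda>t. w t i - w t j) \<longlongrightarrow> u i - u j) (at 0)"
      unfolding w_def by (auto intro!: tendsto_eq_intros)
    then have "\<forall>\<^sub>F t in at 0. w t i - w t j \<noteq> 0"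
      by (rule tendsto_imp_eventually_ne) (use False in auto)
    then show ?thesis by eventually_elim auto
  qed
  have "\<forall>\<^sub>F t in at 0. \<forall>i\<in>{..<N}. \<forall>j\<in>{..<N}. i \<noteq> j \<longrightarrow> w t i \<noteq> w t j"
  proof (intro eventually_ball_finite finite_lessThan ballI)
    fix i j show "\<forall>\<^sub>F t in at 0. i \<noteq> j \<longrightarrow> w t i \<noteq> w t j"
      using dist[of i j] by (cases "i = j") auto
  qed
  then have D: "\<forall>\<^sub>F t in at 0. w t \<in> distinct_pts N"
    by eventually_elim (auto simp: distinct_pts_def)
  have "\<forall>\<^sub>F t in at (0::real). t \<noteq> 0" by (simp add: eventually_at_filter)
  then have "\<forall>\<^sub>F t in at 0. w t \<noteq> u"
  proof eventually_elim
    case (elim t)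
    then have "w t 0 \<noteq> u 0" by (simp add: w_def)
    then show ?case by auto
  qed
  then have "filterlim w (at u within distinct_pts N) (at 0)"
    using lim D by (auto simp: filterlim_at elim: eventually_elim2)
  then show ?thesis
    by (auto simp: filterlim_def bot_unique filtermap_bot_iff)
qed

lemma schur_num_ldet: "schur_num N l u = ldet N (\<lambda>i j. u i powi (l ! j + int N - 1 - int j))"
  unfolding schur_num_def ldet_def ..

text \<open>On points with distinct coordinates the ratio is \<open>f\<close>, so continuity of
  \<open>f\<close> identifies the limit even where the Vandermonde product vanishes.\<close>

lemma schur_eqI:
  assumes f: "\<And>v. (\<forall>i<N. v i \<noteq> 0) \<Longrightarrow> schur_num N l v = vandermonde N v * f v"
    and cont: "(f \<longlongrightarrow> f u) (at u within distinct_pts N)" and u: "\<And>i. i < N \<Longrightarrow> u i \<noteq> 0"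
  shows "schur N l u = f u"
  unfolding schur_def
proof (rule tendsto_Lim[OF at_within_distinct_pts_nontrivial])
  have "\<forall>\<^sub>F v in at u within distinct_pts N. \<forall>i\<in>{..<N}. v i \<noteq> 0"
    using u by (intro eventually_ball_finite finite_lessThan ballI
        tendsto_imp_eventually_ne[OF tendsto_coordinate]) auto
  moreover have "\<forall>\<^sub>F v in at u within distinct_pts N. v \<in> distinct_pts N"
    by (simp add: eventually_at_filter)
  ultimately have "\<forall>\<^sub>F v in at u within distinct_pts N. schur_num N l v / vandermonde N v = f v"
    by eventually_elim (auto simp: f vandermonde_nonzero_iff)
  then show "((\<lambda>v. schur_num N l v / vandermonde N v) \<longlongrightarrow> f u) (at u within distinct_pts N)"
    by (rule iffD2[OF tendsto_cong cont])
qed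

lemma signature_exponents_decreasing:
  assumes "l \<in> signatures N" "i < j" "j < N"
  shows "l ! j + int N - 1 - int j < l ! i + int N - 1 - int i"
  using assms sorted_wrt_nth_less[of "(\<ge>)" l i j] unfolding signatures_def by auto

lemma schur_pos_laurent:
  assumes "l \<in> signatures N"
  shows "pos_laurent N (schur N l)"
proof -
  obtain f where f: "pos_laurent N f"
    "\<And>v. (\<forall>i<N. v i \<noteq> 0) \<Longrightarrow> schur_num N l v = vandermonde N v * f v"
    using alternant_pos_laurent[of N "\<lambda>j. l ! j + int N - 1 - int j"]
      signature_exponents_decreasing[OF assms] unfolding schur_num_ldet by blast
  obtain es where es: "\<And>u. (\<forall>i<N. u i \<noteq> 0) \<Longrightarrow> f u = (\<Sum>e\<leftarrow>es. \<Prod>i<N. u i powi (e i :: int))"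
    using f(1) unfolding pos_laurent_def by auto
  have "schur N l u = (\<Sum>e\<leftarrow>es. \<Prod>i<N. u i powi (e i :: int))" if u: "\<forall>i<N. u i \<noteq> 0" for u
  proof (rule schur_eqI)
    have "((\<lambda>v. \<Prod>i<N. v i powi e i) \<longlongrightarrow> (\<Prod>i<N. u i powi e i)) (at u within distinct_pts N)" for e :: "nat \<Rightarrow> int"
      using u by (intro tendsto_prod tendsto_power_int tendsto_coordinate) auto
    then show "((\<lambda>v. \<Sum>e\<leftarrow>es. \<Prod>i<N. v i powi e i) \<longlongrightarrow> (\<Sum>e\<leftarrow>es. \<Prod>i<N. u i powi e i)) (at u within distinct_pts N)"
      by (induction es) (auto intro!: tendsto_add)
  qed (use u f es in auto)
  then show ?thesis unfolding pos_laurent_def by blast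
qed

section \<open>Domination by finitely many positive points\<close>

lemma prod_add_corners:
  fixes f g :: "nat \<Rightarrow> real"
  shows "(\<Prod>i<n. f i + g i) = (\<Sum>X\<in>Pow {..<n}. \<Prod>i<n. if i \<in> X then f i else g i)"
proof -
  have "(\<Prod>i<n. f i + g i) = (\<Sum>X\<in>Pow {..<n}. (\<Prod>i\<in>X. f i) * (\<Prod>i\<in>{..<n}-X. g i))"
    by (rule prod_add) simp
  also have "\<dots> = (\<Sum>X\<in>Pow {..<n}. \<Prod>i<n. if i \<in> X then f i else g i)"
  proof (intro sum.cong refl)
    fix X assume "X \<in> Pow {..<n}"
    then have "{..<n} \<inter> {i. i \<in> X} = X" "{..<n} \<inter> - {i. i \<in> X} = {..<n} - X" by auto
    then show "(\<Prod>i\<in>X. f i) * (\<Prod>i\<in>{..<n}-X. g i) = (\<Prod>i<n. if i \<in> X then f i else g i)"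
      by (subst prod.If_cases) auto
  qed
  finally show ?thesis .
qed

text \<open>For \<open>0 < d < 1\<close> these points have positive real coordinates, so a Laurent
  polynomial with nonnegative coefficients takes there the sum of the absolute values of its terms.
  The trailing coordinates are 1, so subsets \<open>X\<close> of \<open>{..<k}\<close> give
  \<open>2^k\<close> points whatever \<open>N\<close> is.\<close>

definition corner :: "real \<Rightarrow> nat \<Rightarrow> nat set \<Rightarrow> nat \<Rightarrow> complex" where
  "corner d k X i = (if i < k then (if i \<in> X then of_real (1 + d) else of_real (1 - d)) else 1)"

text \<open>In the annulus between the radii \<open>1 - d\<close> and \<open>1 + d\<close> the sign
  of \<open>e\<close> decides which radius gives the bound; the sum covers both cases.\<close>

lemma norm_powi_le_corners:
  fixes z :: complex and e :: int
  assumes "0 < d" "d < 1" "cmod (z - 1) \<le> d"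
  shows "cmod (z powi e) \<le> (1 + d) powi e + (1 - d) powi e"
proof -
  have z: "1 - d \<le> cmod z" "cmod z \<le> 1 + d"
    using assms norm_triangle_ineq2[of 1 z] norm_triangle_ineq2[of z 1] by (auto simp: norm_minus_commute)
  have "cmod z powi e \<le> (1 + d) powi e + (1 - d) powi e"
  proof (cases "e \<ge> 0")
    case True
    then have "cmod z powi e \<le> (1 + d) powi e" using z assms by (intro power_int_mono) auto
    moreover have "(1 - d) powi e \<ge> 0" using assms by (intro zero_le_power_int) auto
    ultimately show ?thesis by linarith
  next
    case False
    then have "cmod z powi e \<le> (1 - d) powi e" using z assms by (intro power_int_antimono) auto
    moreover have "(1 + d) powi e \<ge> 0" using assms by (intro zero_le_power_int) auto
    ultimately show ?thesis by linarith
  qed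
  then show ?thesis by (simp add: norm_power_int)
qed

text \<open>Each monomial is bounded by a product of two-term sums. Multiplying out gives a sum over
  corners, and at each corner the monomials, being positive, add up to the value of \<open>f\<close>
  again.\<close>

lemma norm_pos_laurent_le_corners:
  assumes "pos_laurent N f" and d: "0 < d" "d < 1" and k: "k \<le> N"
    and u: "\<And>i. i < k \<Longrightarrow> cmod (u i - 1) \<le> d" "\<And>i. k \<le> i \<Longrightarrow> u i = 1"
  shows "cmod (f u) \<le> (\<Sum>X\<in>Pow {..<k}. cmod (f (corner d k X)))"
proof -
  obtain es where es: "\<And>u. (\<forall>i<N. u i \<noteq> 0) \<Longrightarrow> f u = (\<Sum>e\<leftarrow>es. \<Prod>i<N. u i powi (e i :: int))"
    using assms(1) unfolding pos_laurent_def by auto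
  have split: "(\<Prod>i<N. v i powi e i) = (\<Prod>i<k. v i powi e i)" if "\<And>i. k \<le> i \<Longrightarrow> v i = 1" for v :: "nat \<Rightarrow> complex"
        and e :: "nat \<Rightarrow> int"
    using k that by (intro prod.mono_neutral_right) auto
  have u0: "u i \<noteq> 0" for i
    using u[of i] d by (cases "i < k") auto
  define m where "m = (\<lambda>X e. \<Prod>i<k. if i \<in> X then (1 + d) powi (e i :: int) else (1 - d) powi e i)"
  have m0: "m X e \<ge> 0" for X e
    unfolding m_def using d by (intro prod_nonneg) auto
  have corner: "f (corner d k X) = complex_of_real (\<Sum>e\<leftarrow>es. m X e)" for X
  proof -
    have "corner d k X i \<noteq> 0" for i
      using d unfolding corner_def of_real_eq_0_iff by (auto simp del: of_real_add of_real_diff)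
    then have "f (corner d k X) = (\<Sum>e\<leftarrow>es. \<Prod>i<N. corner d k X i powi e i)" by (intro es) auto
    also have "\<dots> = (\<Sum>e\<leftarrow>es. complex_of_real (m X e))"
    proof (intro arg_cong[of _ _ sum_list] map_cong refl)
      fix e assume "e \<in> set es"
      show "(\<Prod>i<N. corner d k X i powi e i) = complex_of_real (m X e)"
        by (subst split) (auto simp: corner_def m_def of_real_power_int intro!: prod.cong)
    qed
    also have "\<dots> = complex_of_real (\<Sum>e\<leftarrow>es. m X e)" by (induction es) auto
    finally show ?thesis .
  qed
  have "f u = (\<Sum>e\<leftarrow>es. \<Prod>i<N. u i powi e i)" using u0 by (intro es) auto
  also have "cmod \<dots> \<le> (\<Sum>e\<leftarrow>es. cmod (\<Prod>i<N. u i powi e i))"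
  proof (induction es)
    case (Cons e es)
    then show ?case by (auto intro: order_trans[OF norm_triangle_ineq])
  qed auto
  also have "\<dots> \<le> (\<Sum>e\<leftarrow>es. \<Sum>X\<in>Pow {..<k}. m X e)"
  proof (rule sum_list_mono)
    fix e assume "e \<in> set es"
    have "cmod (\<Prod>i<N. u i powi e i) = (\<Prod>i<k. cmod (u i powi e i))"
      by (subst split) (auto simp: u prod_norm)
    also have "\<dots> \<le> (\<Prod>i<k. (1 + d) powi e i + (1 - d) powi e i)"
      using norm_powi_le_corners[OF d] u by (intro prod_mono) auto
    also have "\<dots> = (\<Sum>X\<in>Pow {..<k}. m X e)"
      unfolding prod_add_corners m_def ..
    finally show "cmod (\<Prod>i<N. u i powi e i) \<le> (\<Sum>X\<in>Pow {..<k}. m X e)" .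
  qed
  also have "\<dots> = (\<Sum>X\<in>Pow {..<k}. \<Sum>e\<leftarrow>es. m X e)"
    by (induction es) (auto simp: sum.distrib)
  also have "\<dots> = (\<Sum>X\<in>Pow {..<k}. cmod (f (corner d k X)))"
    unfolding corner norm_of_real using m0 by (intro sum.cong refl abs_of_nonneg[symmetric] sum_list_nonneg) auto
  finally show ?thesis .
qed

section \<open>The Perelomov--Popov operator on power series\<close>

lemma gbinomial_mult_shift: "of_nat (Suc n) * (a gchoose Suc n) = a * ((a - 1) gchoose n)"
  for a :: complex
  using gbinomial_absorption[of n a] by simp

lemma fps_deriv_binomial: "fps_deriv (fps_binomial a) = fps_const a * fps_binomial (a - 1)"
  for a :: complex
  by (rule fps_ext) (use gbinomial_mult_shift[of _ a] in simp)

lemma fps_deriv_funpow_binomial: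
  "(fps_deriv ^^ m) (fps_binomial a) = fps_const (fact m * (a gchoose m)) * fps_binomial (a - of_nat m)"
  for a :: complex
proof (induction m)
  case (Suc m)
  have "fact (Suc m) * (a gchoose Suc m) = fact m * (a gchoose m) * (a - of_nat m)"
    unfolding gbinomial_mult_fact by simp
  then show ?case
    by (simp only: funpow.simps o_def Suc fps_deriv_mult_const_left fps_deriv_binomial)
      (simp add: fps_const_mult[symmetric] algebra_simps del: fps_const_mult)
qed simp

lemma fps_deriv_funpow_mult:
  fixes f g :: "complex fps"
  shows "(fps_deriv ^^ m) (f * g) =
    (\<Sum>r\<le>m. of_nat (m choose r) * (fps_deriv ^^ (m - r)) f * (fps_deriv ^^ r) g)"
proof (induction m arbitrary: f g)
  case (Suc m)
  let ?t = "\<lambda>n r. of_nat (n choose r) * (fps_deriv ^^ (Suc m - r)) f * (fps_deriv ^^ r) g"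
  have 1: "(\<Sum>r\<le>m. of_nat (m choose r) * (fps_deriv ^^ (m - r)) (fps_deriv f) * (fps_deriv ^^ r) g) =
      (\<Sum>r\<le>m. ?t m r)"
    by (intro sum.cong refl) (simp add: Suc_diff_le funpow_Suc_right del: funpow.simps)
  have 2: "(\<Sum>r\<le>m. of_nat (m choose r) * (fps_deriv ^^ (m - r)) f * (fps_deriv ^^ r) (fps_deriv g)) =
      (\<Sum>r\<le>m. of_nat (m choose r) * (fps_deriv ^^ (m - r)) f * (fps_deriv ^^ Suc r) g)"
    by (intro sum.cong refl) (simp add: funpow_Suc_right del: funpow.simps)
  have "(fps_deriv ^^ Suc m) (f * g) = (fps_deriv ^^ m) (fps_deriv f * g + f * fps_deriv g)"
    by (simp add: funpow_Suc_right add.commute del: funpow.simps)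
  also have "\<dots> = (fps_deriv ^^ m) (fps_deriv f * g) + (fps_deriv ^^ m) (f * fps_deriv g)"
    by (induction m arbitrary: f g) auto
  also have "\<dots> = (\<Sum>r\<le>m. ?t m r) +
     (\<Sum>r\<le>m. of_nat (m choose r) * (fps_deriv ^^ (m - r)) f * (fps_deriv ^^ Suc r) g)"
    unfolding Suc 1 2 ..
  also have "\<dots> = (\<Sum>r\<le>Suc m. ?t (Suc m) r)"
  proof -
    have "(\<Sum>r\<le>Suc m. ?t (Suc m) r) = ?t m 0 + (\<Sum>r\<le>m. ?t (Suc m) (Suc r))"
      by (subst sum.atMost_Suc_shift) simp
    also have "(\<Sum>r\<le>m. ?t (Suc m) (Suc r)) = (\<Sum>r\<le>m. ?t m (Suc r)) +
       (\<Sum>r\<le>m. of_nat (m choose r) * (fps_deriv ^^ (m - r)) f * (fps_deriv ^^ Suc r) g)"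
      by (simp add: sum.distrib[symmetric] distrib_right add.commute del: funpow.simps)
    also have "?t m 0 + ((\<Sum>r\<le>m. ?t m (Suc r)) + x) = (\<Sum>r\<le>Suc m. ?t m r) + x" for x
      by (simp only: sum.atMost_Suc_shift add.assoc)
    also have "(\<Sum>r\<le>Suc m. ?t m r) = (\<Sum>r\<le>m. ?t m r)" by simp
    finally show ?thesis by simp
  qed
  finally show ?case .
qed simp

lemma fps_deriv_funpow_X_power:
  "(fps_deriv ^^ r) (fps_X ^ s) = of_nat (fact r * (s choose r)) * (fps_X ^ (s - r) :: complex fps)"
proof (induction r)
  case (Suc r)
  have "fps_deriv (fps_X ^ (s - r) :: complex fps) = of_nat (s - r) * fps_X ^ (s - Suc r)"
    by (simp add: fps_deriv_power' fps_of_nat)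
  moreover have "fact (Suc r) * (s choose Suc r) = fact r * (s choose r) * (s - r)"
    using binomial_absorb_comp[of s r] binomial_absorption[of r s]
    by (simp only: fact_Suc of_nat_id mult_ac)
  ultimately show ?case using Suc by (simp add: mult_ac flip: of_nat_mult)
qed simp

definition newton_poly :: "nat \<Rightarrow> complex poly" where
  "newton_poly i = Polynomial.smult (1 / fact i) (\<Prod>t<i. [:- of_nat t, 1:])"

lemma poly_newton: "poly (newton_poly i) x = x gchoose i"
  by (simp add: newton_poly_def poly_prod gbinomial_prod_rev atLeast0LessThan)

lemma degree_newton: "degree (newton_poly i) = i"
  unfolding newton_poly_def by (simp add: degree_prod_sum_eq)

definition binomial_det_const :: "nat \<Rightarrow> complex" where
  "binomial_det_const N = vandermonde_sign N * ldet N (\<lambda>s j. coeff (newton_poly j) s)"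

lemma binomial_det_const_nz: "binomial_det_const N \<noteq> 0"
proof -
  have "ldet N (\<lambda>s j. coeff (newton_poly j) s) = ldet N (\<lambda>j s. coeff (newton_poly j) s)"
    by (rule ldet_transpose[symmetric])
  also have "\<dots> = (\<Prod>i<N. coeff (newton_poly i) i)"
    by (rule ldet_lower_triangular) (simp add: coeff_eq_0 degree_newton)
  also have "\<dots> \<noteq> 0"
  proof -
    have "newton_poly i \<noteq> 0" for i by (simp add: newton_poly_def)
    then have "coeff (newton_poly i) i \<noteq> 0" for i
      using leading_coeff_0_iff[of "newton_poly i"] by (simp add: degree_newton)
    then show ?thesis by simp
  qed
  finally show ?thesis by (simp add: binomial_det_const_def vandermonde_sign_nz)
qed

text \<open>Column \<open>j\<close> consists of the first \<open>N\<close> Taylor coefficients at 1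
  of \<open>u\<close> to the power \<open>a j\<close>. Up to a constant depending on
  \<open>N\<close> alone, this determinant stands for the alternant divided by the Vandermonde
  product at \<open>1^N\<close>; its evaluation is the dimension formula.\<close>

lemma ldet_gbinomial: "ldet N (\<lambda>i j. a j gchoose i) = binomial_det_const N * vandermonde N a"
proof -
  have "ldet N (\<lambda>i j. a j gchoose i) = ldet N (\<lambda>i j. poly (newton_poly j) (a i))"
    by (subst ldet_transpose[symmetric]) (simp add: poly_newton)
  also have "\<dots> = binomial_det_const N * vandermonde N a"
    by (subst ldet_poly) (simp_all add: degree_newton ldet_vandermonde binomial_det_const_def)
  finally show ?thesis .
qed

text \<open>Only the factors containing the index \<open>j\<close> change, and their signs agree on
  both sides. Multiplied out, this is a polynomial identity suited to induction on
  \<open>N\<close>.\<close>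

lemma vandermonde_update:
  assumes "j < N"
  shows "vandermonde N (a(j := x)) * (\<Prod>i\<in>{..<N} - {j}. a j - a i) =
         vandermonde N a * (\<Prod>i\<in>{..<N} - {j}. x - a i)"
  using assms
proof (induction N)
  case (Suc N)
  show ?case
  proof (cases "j = N")
    case True
    have eq: "{..<Suc N} - {N} = {..<N}" by auto
    have V: "vandermonde N (a(N := x)) = vandermonde N a" by (rule vandermonde_cong) auto
    have neg: "(\<Prod>i<N. x - a i) = (-1) ^ N * (\<Prod>i<N. a i - x)" for x
    proof -
      have "(\<Prod>i<N. x - a i) = (\<Prod>i<N. (-1) * (a i - x))" by simp
      then show ?thesis unfolding prod.distrib by simp
    qed
    show ?thesis unfolding True eq vandermonde_Suc V
      by (simp add: neg[of x] neg[of "a N"] mult_ac)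
  next
    case False
    then have j: "j < N" using Suc by auto
    have eq: "{..<Suc N} - {j} = insert N ({..<N} - {j})" using j by auto
    have sp: "(\<Prod>i<N. f i) = f j * (\<Prod>i\<in>{..<N} - {j}. f i)" for f :: "nat \<Rightarrow> complex"
      using j by (subst prod.remove[of _ j]) auto
    have "(\<Prod>i\<in>{..<N} - {j}. (a(j := x)) i - a N) = (\<Prod>i\<in>{..<N} - {j}. a i - a N)"
      by (intro prod.cong) auto
    then have V1: "vandermonde (Suc N) (a(j := x)) =
        vandermonde N (a(j := x)) * ((x - a N) * (\<Prod>i\<in>{..<N} - {j}. a i - a N))"
      unfolding vandermonde_Suc sp[of "\<lambda>i. (a(j := x)) i - (a(j := x)) N"]
      using False by (simp only: fun_upd_same fun_upd_other not_False_eq_True)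
    have V2: "vandermonde (Suc N) a =
        vandermonde N a * ((a j - a N) * (\<Prod>i\<in>{..<N} - {j}. a i - a N))"
      unfolding vandermonde_Suc sp[of "\<lambda>i. a i - a N"] ..
    have P: "(\<Prod>i\<in>{..<Suc N} - {j}. y - a i) = (y - a N) * (\<Prod>i\<in>{..<N} - {j}. y - a i)" for y
      unfolding eq by simp
    have "A * (X * R) * (Y * B) = C * (Y * R) * (X * D)" if "A * B = C * D" for A B C D X Y R :: complex
    proof -
      have "A * (X * R) * (Y * B) = (A * B) * (X * Y * R)" "C * (Y * R) * (X * D) = (C * D) * (X * Y * R)"
        by (simp_all only: mult_ac)
      then show ?thesis using that by simp
    qed
    then show ?thesis unfolding P V1 V2 using Suc.IH[OF j] .
  qed
qed simp

text \<open>The one-variable operator, to be applied to one column at a time. In an alternant,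
  summing over the columns is the same as summing over the variables, and the division by the
  Vandermonde product is encoded in taking Taylor coefficients.\<close>

definition pp_op :: "complex \<Rightarrow> nat \<Rightarrow> complex fps \<Rightarrow> complex fps" where
  "pp_op q m F = fps_binomial (of_nat m - q) * (fps_deriv ^^ m) F"

lemma pp_op_binomial: "pp_op q m (fps_binomial a) = fps_const (fact m * (a gchoose m)) * fps_binomial (a - q)"
proof -
  have "pp_op q m (fps_binomial a) =
     fps_const (fact m * (a gchoose m)) * (fps_binomial (of_nat m - q) * fps_binomial (a - of_nat m))"
    unfolding pp_op_def fps_deriv_funpow_binomial by (simp only: mult_ac)
  then show ?thesis by (simp add: fps_binomial_add_mult[symmetric])
qed

lemma pp_op_sum: "pp_op q m (\<Sum>b\<in>B. fps_const (c b) * F b) = (\<Sum>b\<in>B. fps_const (c b) * pp_op q m (F b))"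
proof -
  have "(fps_deriv ^^ m) (\<Sum>b\<in>B. fps_const (c b) * F b) = (\<Sum>b\<in>B. fps_const (c b) * (fps_deriv ^^ m) (F b))"
    by (induction m) (simp_all add: fps_deriv_sum)
  then show ?thesis by (simp add: pp_op_def sum_distrib_left mult_ac)
qed

lemma ldet_pp_op_binomials:
  assumes "a \<in> distinct_pts N"
  shows "(\<Sum>c<N. ldet N (\<lambda>i j. if j = c then fps_nth (pp_op q m (fps_binomial (a c))) i
             else fps_nth (fps_binomial (a j)) i)) =
    binomial_det_const N * vandermonde N a *
    (\<Sum>c<N. fact m * (a c gchoose m) * (\<Prod>j\<in>{..<N} - {c}. (a c - a j - q) / (a c - a j)))"
  unfolding sum_distrib_left
proof (intro sum.cong refl)
  fix c assume "c \<in> {..<N}"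
  then have c: "c < N" by auto
  let ?f = "fact m * (a c gchoose m)"
  have "ldet N (\<lambda>i j. if j = c then fps_nth (pp_op q m (fps_binomial (a c))) i
             else fps_nth (fps_binomial (a j)) i) =
        ldet N (\<lambda>i j. (if j = c then ?f else 1) * ((a(c := a c - q)) j gchoose i))"
    by (intro ldet_cong) (simp add: pp_op_binomial)
  also have "\<dots> = (\<Prod>j<N. if j = c then ?f else 1) * ldet N (\<lambda>i j. (a(c := a c - q)) j gchoose i)"
    by (rule ldet_scale_cols)
  also have "(\<Prod>j<N. if j = c then ?f else 1) = ?f"
    using c by (simp add: prod.delta)
  also have "ldet N (\<lambda>i j. (a(c := a c - q)) j gchoose i) = binomial_det_const N * vandermonde N (a(c := a c - q))"
    by (rule ldet_gbinomial)
  also have "vandermonde N (a(c := a c - q)) = vandermonde N a * (\<Prod>j\<in>{..<N} - {c}. (a c - a j - q) / (a c - a j))"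
  proof -
    have nz: "(\<Prod>i\<in>{..<N} - {c}. a c - a i) \<noteq> 0"
      using assms c by (auto simp: distinct_pts_def)
    show ?thesis
      using vandermonde_update[OF c, of a "a c - q"] nz
      by (simp add: prod_dividef field_simps diff_right_commute)
  qed
  finally show "ldet N (\<lambda>i j. if j = c then fps_nth (pp_op q m (fps_binomial (a c))) i
             else fps_nth (fps_binomial (a j)) i) =
      binomial_det_const N * vandermonde N a *
      (?f * (\<Prod>j\<in>{..<N} - {c}. (a c - a j - q) / (a c - a j)))"
    by (simp only: mult_ac)
qed

section \<open>Determinants whose columns share a factor\<close>

lemma fps_mult_nth_lessThan:
  fixes G Y :: "'a::comm_ring_1 fps"
  assumes "i < N"
  shows "fps_nth (G * Y) i = (\<Sum>s<N. (if s \<le> i then fps_nth G (i - s) else 0) * fps_nth Y s)"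
proof -
  have "fps_nth (G * Y) i = (\<Sum>s=0..i. fps_nth Y s * fps_nth G (i - s))"
    by (simp only: mult.commute[of G] fps_mult_nth)
  also have "\<dots> = (\<Sum>s<N. (if s \<le> i then fps_nth G (i - s) else 0) * fps_nth Y s)"
    using assms by (intro sum.mono_neutral_cong_left) auto
  finally show ?thesis .
qed

text \<open>Multiplication by \<open>G\<close> acts on the first \<open>N\<close> coefficients as a
  lower triangular Toeplitz matrix with constant diagonal \<open>fps_nth G 0\<close>.\<close>

lemma ldet_fps_mult:
  fixes G :: "'a::comm_ring_1 fps"
  shows "ldet N (\<lambda>i j. fps_nth (G * Y j) i) = fps_nth G 0 ^ N * ldet N (\<lambda>i j. fps_nth (Y j) i)"
proof -
  have "ldet N (\<lambda>i j. fps_nth (G * Y j) i) =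
     ldet N (\<lambda>i j. \<Sum>s<N. (if s \<le> i then fps_nth G (i - s) else 0) * fps_nth (Y j) s)"
    by (intro ldet_cong fps_mult_nth_lessThan)
  also have "\<dots> = ldet N (\<lambda>i s. if s \<le> i then fps_nth G (i - s) else 0) * ldet N (\<lambda>i j. fps_nth (Y j) i)"
    by (rule ldet_mult)
  also have "ldet N (\<lambda>i s. if s \<le> i then fps_nth G (i - s) else 0) = fps_nth G 0 ^ N"
    by (subst ldet_lower_triangular) auto
  finally show ?thesis .
qed

text \<open>Closed form of the trace, given by the Leibniz rule for \<open>G * fps_X ^ s\<close>.
  For fixed \<open>G\<close> the dependence on \<open>N\<close> is confined to
  \<open>N choose Suc r\<close>, which makes large \<open>N\<close> accessible.\<close>

definition pp_trace :: "complex \<Rightarrow> nat \<Rightarrow> nat \<Rightarrow> complex fps \<Rightarrow> complex" where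
  "pp_trace q m N G = (\<Sum>r\<le>m. of_nat ((m choose r) * fact r * (N choose Suc r)) *
     fps_nth (fps_binomial (of_nat m - q) * (fps_deriv ^^ (m - r)) G * inverse G) r)"

lemma pp_trace_altdef:
  "pp_trace q m N G = (\<Sum>s<N. fps_nth (inverse G * pp_op q m (G * fps_X ^ s)) s)"
proof -
  let ?Y = "\<lambda>r. fps_binomial (of_nat m - q) * (fps_deriv ^^ (m - r)) G * inverse G"
  have "fps_nth (inverse G * pp_op q m (G * fps_X ^ s)) s =
      (\<Sum>r\<le>m. of_nat ((m choose r) * (fact r * (s choose r))) * fps_nth (?Y r) r)" for s
  proof -
    have "inverse G * pp_op q m (G * fps_X ^ s) =
      (\<Sum>r\<le>m. of_nat ((m choose r) * (fact r * (s choose r))) * (fps_X ^ (s - r) * ?Y r))"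
      unfolding pp_op_def fps_deriv_funpow_mult fps_deriv_funpow_X_power sum_distrib_left
      by (intro sum.cong refl) (simp only: of_nat_mult mult_ac)
    moreover have "fps_nth (of_nat ((m choose r) * (fact r * (s choose r))) * (fps_X ^ (s - r) * ?Y r)) s =
       of_nat ((m choose r) * (fact r * (s choose r))) * fps_nth (?Y r) r" for r
    proof (cases "r \<le> s")
      case True
      then show ?thesis
        unfolding fps_of_nat[symmetric] fps_mult_left_const_nth fps_X_power_mult_nth by auto
    next
      case False
      then show ?thesis by (simp add: binomial_eq_0)
    qed
    ultimately show ?thesis by (simp only: fps_sum_nth)
  qed
  then have "(\<Sum>s<N. fps_nth (inverse G * pp_op q m (G * fps_X ^ s)) s) =
     (\<Sum>r\<le>m. \<Sum>s<N. of_nat ((m choose r) * (fact r * (s choose r))) * fps_nth (?Y r) r)"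
    by (simp only: sum.swap[of _ "{..m}"])
  also have "\<dots> = pp_trace q m N G"
    unfolding pp_trace_def
  proof (intro sum.cong refl)
    fix r
    \<comment> \<open>Hockey-stick summation over the diagonal entries: here the dimension turns
      into a binomial coefficient.\<close>
    have "(\<Sum>s<N. s choose r) = N choose Suc r"
      by (induction N) auto
    then have "(\<Sum>s<N. (m choose r) * (fact r * (s choose r))) = (m choose r) * fact r * (N choose Suc r)"
      by (simp add: sum_distrib_left[symmetric] mult.assoc)
    then show "(\<Sum>s<N. of_nat ((m choose r) * (fact r * (s choose r))) * fps_nth (?Y r) r) =
       of_nat ((m choose r) * fact r * (N choose Suc r)) * fps_nth (?Y r) r"
      by (simp only: sum_distrib_right[symmetric] of_nat_sum[symmetric])
  qed
  finally show ?thesis ..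
qed

text \<open>Dividing every column by \<open>G\<close> costs \<open>fps_nth G 0 ^ N\<close> and
  conjugates the operator to \<open>A\<close>. Since \<open>deg h_j < N\<close>, the coefficient
  vectors are complete, so the modified column is \<open>A\<close> times the old one and replacing
  one column at a time yields the trace.\<close>

lemma ldet_pp_op_common_factor:
  assumes G: "fps_nth G 0 \<noteq> 0" and deg: "\<And>j. j < N \<Longrightarrow> degree (h j) < N"
  shows "(\<Sum>c<N. ldet N (\<lambda>i j. if j = c then fps_nth (pp_op q m (G * fps_of_poly (h c))) i
             else fps_nth (G * fps_of_poly (h j)) i)) =
    ldet N (\<lambda>s j. coeff (h j) s) * fps_nth G 0 ^ N * pp_trace q m N G"
proof -
  define A where "A = (\<lambda>i s. fps_nth (inverse G * pp_op q m (G * fps_X ^ s)) i)"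
  define C where "C = (\<lambda>s j. coeff (h j) s)"
  have GG: "G * inverse G = 1" using G by (rule inverse_mult_eq_1')
  have col: "fps_nth (inverse G * pp_op q m (G * fps_of_poly (h c))) i = (\<Sum>s<N. A i s * C s c)"
    if "c < N" for c i
  proof -
    have "fps_of_poly (h c) = (\<Sum>s<N. fps_const (coeff (h c) s) * fps_X ^ s)"
    proof (rule fps_ext)
      fix n
      have "fps_nth (\<Sum>s<N. fps_const (coeff (h c) s) * fps_X ^ s) n =
         (\<Sum>s<N. coeff (h c) s * (if n = s then 1 else 0))"
        by (simp add: fps_sum_nth)
      also have "\<dots> = coeff (h c) n"
        using deg[OF that] by (cases "n < N") (auto simp: coeff_eq_0 if_distrib cong: if_cong)
      finally show "fps_nth (fps_of_poly (h c)) n = fps_nth (\<Sum>s<N. fps_const (coeff (h c) s) * fps_X ^ s) n"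
        by (simp only: fps_of_poly_nth)
    qed
    then have "G * fps_of_poly (h c) = (\<Sum>s<N. fps_const (C s c) * (G * fps_X ^ s))"
      by (simp add: sum_distrib_left C_def mult.left_commute)
    then have "inverse G * pp_op q m (G * fps_of_poly (h c)) =
        (\<Sum>s<N. fps_const (C s c) * (inverse G * pp_op q m (G * fps_X ^ s)))"
      by (simp only: pp_op_sum sum_distrib_left mult.left_commute[of "inverse G"])
    then show ?thesis by (simp add: fps_sum_nth A_def mult.commute)
  qed
  have "ldet N (\<lambda>i j. if j = c then fps_nth (pp_op q m (G * fps_of_poly (h c))) i
             else fps_nth (G * fps_of_poly (h j)) i) =
        fps_nth G 0 ^ N * ldet N (\<lambda>i j. if j = c then (\<Sum>s<N. A i s * C s c) else C i j)"
    if c: "c < N" for c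
  proof -
    have "ldet N (\<lambda>i j. if j = c then fps_nth (pp_op q m (G * fps_of_poly (h c))) i
             else fps_nth (G * fps_of_poly (h j)) i) =
      ldet N (\<lambda>i j. fps_nth (G * (if j = c then inverse G * pp_op q m (G * fps_of_poly (h c))
         else fps_of_poly (h j))) i)"
      by (intro ldet_cong) (simp add: mult.assoc[symmetric] GG)
    also have "\<dots> = fps_nth G 0 ^ N * ldet N (\<lambda>i j. fps_nth (if j = c then inverse G * pp_op q m (G * fps_of_poly (h c))
         else fps_of_poly (h j)) i)"
      by (rule ldet_fps_mult)
    also have "ldet N (\<lambda>i j. fps_nth (if j = c then inverse G * pp_op q m (G * fps_of_poly (h c))
         else fps_of_poly (h j)) i) = ldet N (\<lambda>i j. if j = c then (\<Sum>s<N. A i s * C s c) else C i j)"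
      using col[OF c] by (intro ldet_cong) (simp add: C_def)
    finally show ?thesis .
  qed
  then have "(\<Sum>c<N. ldet N (\<lambda>i j. if j = c then fps_nth (pp_op q m (G * fps_of_poly (h c))) i
             else fps_nth (G * fps_of_poly (h j)) i)) =
     fps_nth G 0 ^ N * (\<Sum>c<N. ldet N (\<lambda>i j. if j = c then (\<Sum>s<N. A i s * C s c) else C i j))"
    by (simp add: sum_distrib_left)
  also have "\<dots> = fps_nth G 0 ^ N * (pp_trace q m N G * ldet N C)"
    unfolding ldet_replace_cols_trace pp_trace_altdef A_def ..
  finally show ?thesis by (simp add: C_def mult_ac)
qed

text \<open>\<open>L b\<close> vanishes at every node except \<open>b\<close>. If column
  \<open>j\<close> picks the node \<open>v j\<close>, all the \<open>L (v j)\<close> share the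
  linear factors of the nodes outside the range of \<open>v\<close>; these form \<open>g v\<close>,
  and fewer than \<open>N\<close> factors remain for \<open>h v j\<close>. The nodes
  \<open>1, ..., D\<close> outnumber every degree of the \<open>p j\<close>, and they avoid 0 so
  that \<open>g v\<close> is invertible as a power series.\<close>

lemma lagrange_common_factor:
  fixes p :: "nat \<Rightarrow> complex poly"
  obtains B c L and g :: "(nat \<Rightarrow> complex) \<Rightarrow> complex poly" and h where
    "finite (B :: complex set)" "\<And>j. j < N \<Longrightarrow> p j = (\<Sum>b\<in>B. Polynomial.smult (c j b) (L b))"
    "\<And>v. v \<in> {..<N} \<rightarrow>\<^sub>E B \<Longrightarrow> poly (g v) 0 \<noteq> 0"
    "\<And>v j. v \<in> {..<N} \<rightarrow>\<^sub>E B \<Longrightarrow> j < N \<Longrightarrow> L (v j) = g v * h v j"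
    "\<And>v j. v \<in> {..<N} \<rightarrow>\<^sub>E B \<Longrightarrow> j < N \<Longrightarrow> degree (h v j) < N"
proof -
  define D where "D = Suc (\<Sum>j<N. degree (p j))"
  define B :: "complex set" where "B = of_nat ` {1..D}"
  have B: "finite B" "card B = D" "0 \<notin> B"
    unfolding B_def by (auto simp: card_image inj_on_def)
  define lin :: "complex set \<Rightarrow> complex poly" where "lin = (\<lambda>X. \<Prod>b\<in>X. [:- b, 1:])"
  have deg_lin: "degree (lin X) = card X" if "finite X" for X
    using that unfolding lin_def by (subst degree_prod_sum_eq) auto
  have poly_lin: "poly (lin X) x = 0 \<longleftrightarrow> x \<in> X" if "finite X" for X x
    using that by (auto simp: lin_def poly_prod)
  define L where "L = (\<lambda>b. lin (B - {b}))"
  define c where "c = (\<lambda>j b. poly (p j) b / poly (L b) b)"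
  define g where "g = (\<lambda>v. lin (B - v ` {..<N}))"
  define h where "h = (\<lambda>v j. lin (v ` {..<N} - {v j}))"
  show ?thesis
  proof (rule that)
    show "finite B" by (rule B)
  next
    fix j assume j: "j < N"
    show "p j = (\<Sum>b\<in>B. Polynomial.smult (c j b) (L b))"
    proof (rule poly_eqI_degree)
      fix x assume x: "x \<in> B"
      have "poly (\<Sum>b\<in>B. Polynomial.smult (c j b) (L b)) x = (\<Sum>b\<in>B. c j b * poly (L b) x)"
        by (simp add: poly_sum)
      also have "\<dots> = (\<Sum>b\<in>B. if b = x then poly (p j) x else 0)"
        using B x by (intro sum.cong refl) (auto simp: c_def L_def poly_lin)
      also have "\<dots> = poly (p j) x" using x B by simp
      finally show "poly (p j) x = poly (\<Sum>b\<in>B. Polynomial.smult (c j b) (L b)) x" ..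
    next
      show "degree (p j) < card B"
        using j member_le_sum[of j "{..<N}" "\<lambda>j. degree (p j)"] by (simp add: B D_def)
      have "degree (\<Sum>b\<in>B. Polynomial.smult (c j b) (L b)) \<le> D - 1"
        using B by (intro degree_sum_le order.trans[OF degree_smult_le]) (auto simp: L_def deg_lin)
      then show "degree (\<Sum>b\<in>B. Polynomial.smult (c j b) (L b)) < card B"
        by (simp add: B D_def)
    qed
  next
    fix v :: "nat \<Rightarrow> complex"
    assume v: "v \<in> {..<N} \<rightarrow>\<^sub>E B"
    show "poly (g v) 0 \<noteq> 0" using B by (simp add: g_def poly_lin)
    fix j assume j: "j < N"
    have "B - {v j} = (B - v ` {..<N}) \<union> (v ` {..<N} - {v j})"
      using v j by (auto simp: PiE_iff)
    then show "L (v j) = g v * h v j"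
      unfolding L_def g_def h_def lin_def using B by (simp, subst prod.union_disjoint) auto
    have "card (v ` {..<N} - {v j}) < card (v ` {..<N})"
      using j by (intro psubset_card_mono) auto
    also have "\<dots> \<le> N" using card_image_le[of "{..<N}" v] by simp
    finally show "degree (h v j) < N" by (simp add: h_def deg_lin)
  qed
qed

definition sig_exp :: "nat \<Rightarrow> int list \<Rightarrow> nat \<Rightarrow> int" where
  "sig_exp N l j = l ! j + int N - 1 - int j"

text \<open>The nodes are left unscaled and the sum is not averaged; all powers of
  \<open>1 / N\<close> enter in \<open>pp_moment_eq\<close>.\<close>

definition pp_factorial_moment :: "complex \<Rightarrow> nat \<Rightarrow> nat \<Rightarrow> int list \<Rightarrow> complex" where
  "pp_factorial_moment q m N l = (\<Sum>c<N. fact m * (of_int (sig_exp N l c) gchoose m) *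
         (\<Prod>j\<in>{..<N} - {c}. (of_int (sig_exp N l c) - of_int (sig_exp N l j) - q) /
             (of_int (sig_exp N l c) - of_int (sig_exp N l j))))"

lemma sig_exp_distinct:
  assumes "l \<in> signatures N"
  shows "(\<lambda>j. of_int (sig_exp N l j)) \<in> distinct_pts N"
proof -
  have "sig_exp N l i \<noteq> sig_exp N l j" if "i < N" "j < N" "i \<noteq> j" for i j
    using signature_exponents_decreasing[OF assms, of i j] signature_exponents_decreasing[OF assms, of j i] that
    unfolding sig_exp_def by (cases i j rule: linorder_cases) auto
  then show ?thesis unfolding distinct_pts_def by simp
qed

text \<open>The function near \<open>1^N\<close> and its factorial moments arise from the same
  multilinear expansion over interpolation nodes, so a single family \<open>C\<close> serves both
  identities. A linear functional that reproduces the trace on products therefore yields the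
  factorial moment on Schur functions.\<close>

lemma schur_decomposition:
  assumes l: "l \<in> signatures N"
  obtains I :: "(nat \<Rightarrow> complex) set" and C s g where
    "finite I" "\<And>v. v \<in> I \<Longrightarrow> poly (g v) 0 \<noteq> (0::complex)"
    "\<And>u. (\<forall>i<N. u i \<noteq> 0) \<Longrightarrow> schur N l u =
       (\<Sum>v\<in>I. C v * (\<Prod>i<N. u i powi (- int s) * poly (g v) (u i - 1)))"
    "\<And>q m. (\<Sum>v\<in>I. C v * (poly (g v) 0 ^ N * pp_trace q m N (fps_binomial (- of_nat s) * fps_of_poly (g v)))) =
       schur N l ones * pp_factorial_moment q m N l"
    "schur N l ones \<noteq> 0"
proof -
  define a where "a = sig_exp N l"
  \<comment> \<open>A shift making all exponents nonnegative, so that interpolation applies to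
    polynomials. The factor \<open>u^(-s)\<close> is common to all columns and joins
    \<open>g v\<close> in \<open>G v\<close>.\<close>
  define s where "s = nat (\<Sum>j<N. \<bar>a j\<bar>)"
  have s: "a j + int s \<ge> 0" if "j < N" for j
  proof -
    have "\<bar>a j\<bar> \<le> (\<Sum>j<N. \<bar>a j\<bar>)" using that by (intro member_le_sum) auto
    then show ?thesis unfolding s_def by linarith
  qed
  define e where "e = (\<lambda>j. nat (a j + int s))"
  define p :: "nat \<Rightarrow> complex poly" where "p = (\<lambda>j. [:1, 1:] ^ e j)"
  obtain B c L g h where dec: "finite (B :: complex set)"
    "\<And>j. j < N \<Longrightarrow> p j = (\<Sum>b\<in>B. Polynomial.smult (c j b) (L b))"
    "\<And>v. v \<in> {..<N} \<rightarrow>\<^sub>E B \<Longrightarrow> poly (g v) 0 \<noteq> 0"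
    "\<And>v j. v \<in> {..<N} \<rightarrow>\<^sub>E B \<Longrightarrow> j < N \<Longrightarrow> L (v j) = g v * h v j"
    "\<And>v j. v \<in> {..<N} \<rightarrow>\<^sub>E B \<Longrightarrow> j < N \<Longrightarrow> degree (h v j) < N"
    by (rule lagrange_common_factor[of N p]) blast
  define I where "I = {..<N} \<rightarrow>\<^sub>E B"
  define \<kappa> where "\<kappa> = (\<lambda>v. ldet N (\<lambda>s j. coeff (h v j) s))"
  define c' where "c' = (\<lambda>v. \<Prod>j<N. c j (v j))"
  define C where "C = (\<lambda>v. vandermonde_sign N * (c' v * \<kappa> v))"
  define X :: "complex fps" where "X = fps_binomial (- of_nat s)"
  define G where "G = (\<lambda>v. X * fps_of_poly (g v))"
  have X0: "fps_nth X 0 = 1" by (simp add: X_def)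
  have G0: "fps_nth (G v) 0 = poly (g v) 0" for v
    by (simp add: G_def X0 poly_0_coeff_0)
  have finI: "finite I" unfolding I_def using dec(1) by (intro finite_PiE) auto

  have num: "schur_num N l u = vandermonde N u *
      (\<Sum>v\<in>I. C v * (\<Prod>i<N. u i powi (- int s) * poly (g v) (u i - 1)))"
    if u: "\<forall>i<N. u i \<noteq> 0" for u
  proof -
    have "schur_num N l u = ldet N (\<lambda>i j. u i powi (- int s) * poly (p j) (u i - 1))"
      unfolding schur_num_ldet
    proof (rule ldet_cong)
      fix i j assume ij: "i < N" "j < N"
      have "u i powi (- int s) * poly (p j) (u i - 1) = u i powi (- int s) * u i powi int (e j)"
        by (simp add: p_def)
      also have "\<dots> = u i powi (- int s + int (e j))" using u ij by (subst power_int_add) auto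
      also have "- int s + int (e j) = a j" using s ij by (simp add: e_def)
      finally show "u i powi (l ! j + int N - 1 - int j) = u i powi (- int s) * poly (p j) (u i - 1)"
        by (simp add: a_def sig_exp_def)
    qed
    also have "\<dots> = (\<Prod>i<N. u i powi (- int s)) * ldet N (\<lambda>i j. poly (p j) (u i - 1))"
      by (rule ldet_scale_rows)
    also have "ldet N (\<lambda>i j. poly (p j) (u i - 1)) =
        ldet N (\<lambda>i j. \<Sum>b\<in>B. c j b * poly (L b) (u i - 1))"
      by (intro ldet_cong) (simp add: dec(2) poly_sum)
    also have "\<dots> = (\<Sum>v\<in>I. ldet N (\<lambda>i j. c j (v j) * poly (L (v j)) (u i - 1)))"
      unfolding I_def using dec(1) by (intro ldet_sum_cols)
    also have "\<dots> = (\<Sum>v\<in>I. vandermonde N u * (C v * (\<Prod>i<N. poly (g v) (u i - 1))))"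
    proof (intro sum.cong refl)
      fix v assume v: "v \<in> I"
      have "ldet N (\<lambda>i j. c j (v j) * poly (L (v j)) (u i - 1)) =
          c' v * ldet N (\<lambda>i j. poly (L (v j)) (u i - 1))"
        unfolding c'_def by (rule ldet_scale_cols)
      also have "ldet N (\<lambda>i j. poly (L (v j)) (u i - 1)) =
          ldet N (\<lambda>i j. poly (g v) (u i - 1) * poly (h v j) (u i - 1))"
        using v by (intro ldet_cong) (simp add: dec(4) I_def)
      also have "\<dots> = (\<Prod>i<N. poly (g v) (u i - 1)) * ldet N (\<lambda>i j. poly (h v j) (u i - 1))"
        by (rule ldet_scale_rows)
      also have "ldet N (\<lambda>i j. poly (h v j) (u i - 1)) = vandermonde_sign N * vandermonde N u * \<kappa> v"
        using v dec(5) unfolding I_def \<kappa>_def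
        by (subst ldet_poly) (auto simp: ldet_vandermonde vandermonde_shift)
      finally show "ldet N (\<lambda>i j. c j (v j) * poly (L (v j)) (u i - 1)) =
          vandermonde N u * (C v * (\<Prod>i<N. poly (g v) (u i - 1)))"
        by (simp add: C_def mult_ac)
    qed
    finally show ?thesis
      by (simp add: sum_distrib_left prod.distrib mult_ac)
  qed

  have schur: "schur N l u = (\<Sum>v\<in>I. C v * (\<Prod>i<N. u i powi (- int s) * poly (g v) (u i - 1)))"
    if u: "\<forall>i<N. u i \<noteq> 0" for u
  proof (rule schur_eqI[OF num])
    show "((\<lambda>u. \<Sum>v\<in>I. C v * (\<Prod>i<N. u i powi (- int s) * poly (g v) (u i - 1))) \<longlongrightarrow>
       (\<Sum>v\<in>I. C v * (\<Prod>i<N. u i powi (- int s) * poly (g v) (u i - 1)))) (at u within distinct_pts N)"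
      using u by (intro tendsto_sum tendsto_mult tendsto_const tendsto_prod tendsto_power_int
          tendsto_poly tendsto_diff tendsto_coordinate) auto
  qed (use u in auto)

  have F: "fps_binomial (of_int (a j)) = (\<Sum>b\<in>B. fps_const (c j b) * (X * fps_of_poly (L b)))" if "j < N" for j
  proof -
    have "of_int (a j) = (- of_nat s + of_nat (e j) :: complex)"
      using s[OF that] unfolding e_def by simp
    then have "fps_binomial (of_int (a j)) = X * fps_binomial (of_nat (e j))"
      unfolding X_def by (simp add: fps_binomial_add_mult[symmetric])
    also have "fps_binomial (of_nat (e j)) = fps_of_poly (p j)"
      by (simp add: p_def fps_binomial_of_nat fps_of_poly_power fps_of_poly_linear' add.commute)
    also have "\<dots> = (\<Sum>b\<in>B. fps_const (c j b) * fps_of_poly (L b))"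
      using that by (simp add: dec(2) fps_of_poly_sum fps_of_poly_smult)
    finally show ?thesis by (simp add: sum_distrib_left mult.left_commute)
  qed
  have XL: "X * fps_of_poly (L (v j)) = G v * fps_of_poly (h v j)" if "v \<in> I" "j < N" for v j
    using that by (simp add: dec(4) I_def G_def fps_of_poly_mult mult.assoc)

  \<comment> \<open>Expanding the determinant of Taylor coefficients over the same nodes evaluates
    the combination at \<open>1^N\<close>, in a form that is visibly nonzero for distinct
    exponents.\<close>
  have W1: "(\<Sum>v\<in>I. c' v * \<kappa> v * poly (g v) 0 ^ N) = binomial_det_const N * vandermonde N (\<lambda>j. of_int (a j))"
  proof -
    have "binomial_det_const N * vandermonde N (\<lambda>j. of_int (a j)) = ldet N (\<lambda>i j. fps_nth (fps_binomial (of_int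
          (a j))) i)"
      by (simp add: ldet_gbinomial)
    also have "\<dots> = ldet N (\<lambda>i j. \<Sum>b\<in>B. c j b * fps_nth (X * fps_of_poly (L b)) i)"
      by (intro ldet_cong) (simp add: F fps_sum_nth del: fps_binomial_nth)
    also have "\<dots> = (\<Sum>v\<in>I. ldet N (\<lambda>i j. c j (v j) * fps_nth (X * fps_of_poly (L (v j))) i))"
      unfolding I_def using dec(1) by (intro ldet_sum_cols)
    also have "\<dots> = (\<Sum>v\<in>I. c' v * \<kappa> v * poly (g v) 0 ^ N)"
    proof (intro sum.cong refl)
      fix v assume v: "v \<in> I"
      have "ldet N (\<lambda>i j. c j (v j) * fps_nth (X * fps_of_poly (L (v j))) i) =
          c' v * ldet N (\<lambda>i j. fps_nth (X * fps_of_poly (L (v j))) i)"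
        unfolding c'_def by (rule ldet_scale_cols)
      also have "ldet N (\<lambda>i j. fps_nth (X * fps_of_poly (L (v j))) i) =
          ldet N (\<lambda>i j. fps_nth (G v * fps_of_poly (h v j)) i)"
        by (intro ldet_cong) (simp add: XL[OF v])
      also have "\<dots> = poly (g v) 0 ^ N * \<kappa> v"
        unfolding ldet_fps_mult G0 \<kappa>_def fps_of_poly_nth ..
      finally show "ldet N (\<lambda>i j. c j (v j) * fps_nth (X * fps_of_poly (L (v j))) i) =
          c' v * \<kappa> v * poly (g v) 0 ^ N" by (simp add: mult_ac)
    qed
    finally show ?thesis ..
  qed

  have "schur N l ones = (\<Sum>v\<in>I. C v * poly (g v) 0 ^ N)"
    by (subst schur) (auto simp: ones_def)
  also have "\<dots> = vandermonde_sign N * (\<Sum>v\<in>I. c' v * \<kappa> v * poly (g v) 0 ^ N)"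
    unfolding sum_distrib_left C_def by (simp only: mult_ac)
  finally have ones: "schur N l ones = vandermonde_sign N * (binomial_det_const N * vandermonde N (\<lambda>j. of_int (a j)))"
    unfolding W1 .

  have W2: "(\<Sum>v\<in>I. c' v * (\<kappa> v * poly (g v) 0 ^ N * pp_trace q m N (G v))) =
     binomial_det_const N * vandermonde N (\<lambda>j. of_int (a j)) *
     pp_factorial_moment q m N l" for q m
  proof -
    let ?W = "\<lambda>F. \<Sum>k<N. ldet N (\<lambda>i j. if j = k then fps_nth (pp_op q m (F k)) i else fps_nth (F j) i)"
    have "binomial_det_const N * vandermonde N (\<lambda>j. of_int (a j)) *
     pp_factorial_moment q m N l =
       ?W (\<lambda>j. fps_binomial (of_int (a j)))"
      using ldet_pp_op_binomials[OF sig_exp_distinct[OF l], of q m] unfolding a_def pp_factorial_moment_def by simp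
    also have "\<dots> = (\<Sum>k<N. ldet N (\<lambda>i j. \<Sum>b\<in>B. c j b * (if j = k then fps_nth (pp_op q m (X * fps_of_poly (L b))) i
        else fps_nth (X * fps_of_poly (L b)) i)))"
      by (intro sum.cong refl ldet_cong) (simp add: F pp_op_sum fps_sum_nth del: fps_binomial_nth)
    also have "\<dots> = (\<Sum>k<N. \<Sum>v\<in>I. ldet N (\<lambda>i j. c j (v j) * (if j = k then fps_nth (pp_op q m (X * fps_of_poly (L (v j)))) i
        else fps_nth (X * fps_of_poly (L (v j))) i)))"
      unfolding I_def using dec(1) by (intro sum.cong refl ldet_sum_cols)
    also have "\<dots> = (\<Sum>v\<in>I. \<Sum>k<N. ldet N (\<lambda>i j. c j (v j) * (if j = k then fps_nth (pp_op q m (X * fps_of_poly (L (v j)))) i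
        else fps_nth (X * fps_of_poly (L (v j))) i)))"
      by (rule sum.swap)
    also have "\<dots> = (\<Sum>v\<in>I. c' v * ?W (\<lambda>j. G v * fps_of_poly (h v j)))"
      unfolding ldet_scale_cols c'_def sum_distrib_left
      by (intro sum.cong refl arg_cong2[of _ _ _ _ "(*)"] ldet_cong) (auto simp: XL)
    also have "\<dots> = (\<Sum>v\<in>I. c' v * (\<kappa> v * poly (g v) 0 ^ N * pp_trace q m N (G v)))"
    proof (intro sum.cong refl arg_cong2[of _ _ _ _ "(*)"])
      fix v assume "v \<in> I"
      then show "?W (\<lambda>j. G v * fps_of_poly (h v j)) = \<kappa> v * poly (g v) 0 ^ N * pp_trace q m N (G v)"
        using dec(3,5) unfolding \<kappa>_def G0[symmetric] I_def
        by (intro ldet_pp_op_common_factor) (auto simp: G0)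
    qed
    finally show ?thesis ..
  qed

  show ?thesis
  proof (rule that[of I g C s])
    show "finite I" by (rule finI)
    show "schur N l ones \<noteq> 0"
      unfolding ones using vandermonde_nonzero_iff[of N "\<lambda>j. of_int (a j)"] sig_exp_distinct[OF l]
      by (simp add: vandermonde_sign_nz binomial_det_const_nz a_def)
    fix q m
    have "(\<Sum>v\<in>I. C v * (poly (g v) 0 ^ N * pp_trace q m N (fps_binomial (- of_nat s) * fps_of_poly (g v)))) =
       vandermonde_sign N * (\<Sum>v\<in>I. c' v * (\<kappa> v * poly (g v) 0 ^ N * pp_trace q m N (G v)))"
      unfolding sum_distrib_left C_def G_def X_def by (simp only: mult_ac)
    then show "(\<Sum>v\<in>I. C v * (poly (g v) 0 ^ N * pp_trace q m N (fps_binomial (- of_nat s) * fps_of_poly (g v)))) =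
       schur N l ones * pp_factorial_moment q m N l"
      unfolding W2 ones a_def[symmetric] by (simp only: mult.assoc)
  qed (use dec(3) schur in \<open>auto simp: I_def\<close>)
qed

section \<open>Taylor coefficients along roots of unity\<close>

definition unity_root :: "nat \<Rightarrow> complex" where
  "unity_root j = cis (2 * pi / real (Suc j))"

lemma norm_unity_root [simp]: "cmod (unity_root j) = 1"
  by (simp add: unity_root_def)

lemma unity_root_power_Suc: "unity_root j ^ Suc j = 1"
proof -
  have "real (Suc j) * (2 * pi / real (Suc j)) = 2 * pi" by simp
  then show ?thesis
    using Complex.DeMoivre[of "2 * pi / real (Suc j)" "Suc j"] unfolding unity_root_def by (simp only: cis_2pi)
qed

lemma unity_root_power_neq_1:
  assumes "0 < i" "i \<le> j"
  shows "unity_root j ^ i \<noteq> 1"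
proof
  assume *: "unity_root j ^ i = 1"
  define t where "t = real i * (2 * pi / real (Suc j))"
  have "t = 2 * pi * (real i / real (Suc j))" by (simp add: t_def)
  moreover have "0 < real i / real (Suc j)" "real i / real (Suc j) < 1" using assms by auto
  ultimately have t: "0 < t" "t < 2 * pi"
    using mult_strict_left_mono[of "real i / real (Suc j)" 1 "2 * pi"]
      mult_strict_left_mono[of 0 "real i / real (Suc j)" "2 * pi"] pi_gt_zero by linarith+
  have "cis t = 1" using * by (simp only: unity_root_def Complex.DeMoivre t_def)
  then have "cos t = 1" by (metis cis.sel(1) one_complex.sel(1))
  then obtain n :: int where n: "t = of_int n * 2 * pi" using cos_one_2pi_int by blast
  have "0 < n" "n < 1" using t n by (auto simp: zero_less_mult_iff)
  then show False by simp
qed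

text \<open>The chain rule applied to \<open>f (w e) = f e\<close> gives
  \<open>w^i f^(i)(0) = f^(i)(0)\<close>.\<close>

lemma higher_deriv_rotation_invariant:
  assumes f: "f holomorphic_on ball 0 d" and d: "d > 0"
    and inv: "\<And>e. e \<in> ball 0 d \<Longrightarrow> f (w * e) = f e" and w: "cmod w = 1" "w ^ i \<noteq> 1"
  shows "(deriv ^^ i) f 0 = 0"
proof -
  have sub: "w * e \<in> ball 0 d" if "e \<in> ball 0 d" for e
    using that w by (simp add: norm_mult)
  have "(deriv ^^ i) f 0 = (deriv ^^ i) (\<lambda>e. f (w * e)) 0"
  proof (rule higher_deriv_transform_within_open)
    have "f \<circ> (\<lambda>e. w * e) holomorphic_on ball 0 d"
      using sub by (intro holomorphic_on_compose_gen[OF _ f] holomorphic_intros) auto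
    then show "(\<lambda>e. f (w * e)) holomorphic_on ball 0 d" by (simp add: o_def)
  qed (use f d inv in auto)
  also have "\<dots> = w ^ i * (deriv ^^ i) f (w * 0)"
    by (rule higher_deriv_compose_linear[OF f open_ball[of 0 d] open_ball]) (use sub d in auto)
  finally show ?thesis using w by (simp add: mult_cancel_right1)
qed

lemma higher_deriv_mult_rotation_invariant:
  assumes f: "f holomorphic_on ball 0 d" and K: "K holomorphic_on ball 0 d" and d: "d > 0"
    and inv: "\<And>e. e \<in> ball 0 d \<Longrightarrow> f (unity_root j * e) = f e"
  shows "(deriv ^^ j) (\<lambda>e. f e * K e) 0 = f 0 * (deriv ^^ j) K 0"
proof -
  have 0: "(deriv ^^ i) f 0 = 0" if "0 < i" "i \<le> j" for i
    by (rule higher_deriv_rotation_invariant[OF f d inv])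
      (use that unity_root_power_neq_1 in auto)
  have "(deriv ^^ j) (\<lambda>e. f e * K e) 0 =
     (\<Sum>i=0..j. of_nat (j choose i) * (deriv ^^ i) f 0 * (deriv ^^ (j - i)) K 0)"
    using d by (intro higher_deriv_mult[OF f K]) auto
  also have "\<dots> = (\<Sum>i=0..j. if i = 0 then f 0 * (deriv ^^ j) K 0 else 0)"
    by (intro sum.cong refl) (auto simp: 0)
  finally show ?thesis by simp
qed

text \<open>The first variable is kept separate from the others, so that it can be differentiated;
  on the diagonal \<open>z = e\<close> the first \<open>j + 1\<close> coordinates are \<open>1 + e \<omega>\<^sup>i\<close> with \<open>\<omega>\<close> a primitive root of unity
  of order \<open>j + 1\<close>. Functions of \<open>e\<close> that are symmetric in these coordinates agree with their value at
  \<open>0\<close> up to order \<open>j\<close>.\<close>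
definition root_point :: "nat \<Rightarrow> complex \<Rightarrow> complex \<Rightarrow> nat \<Rightarrow> complex" where
  "root_point j z e i = (if i = 0 then 1 + z else if i \<le> j then 1 + e * unity_root j ^ i else 1)"

lemma root_point_nz:
  assumes "cmod z < 1" "cmod e < 1"
  shows "root_point j z e i \<noteq> 0"
proof -
  have "1 + x \<noteq> 0" if "cmod x < 1" for x :: complex
    using that by (metis add_eq_0_iff norm_minus_cancel norm_one order_less_irrefl)
  moreover have "cmod (e * unity_root j ^ i) < 1" using assms by (simp add: norm_mult norm_power)
  ultimately show ?thesis using assms unfolding root_point_def by auto
qed

lemma prod_root_point:
  fixes \<gamma> :: "complex \<Rightarrow> complex"
  assumes "j < N"
  shows "(\<Prod>i<N. \<gamma> (root_point j z e i)) =
     \<gamma> (1 + z) * ((\<Prod>i<j. \<gamma> (1 + e * unity_root j ^ Suc i)) * \<gamma> 1 ^ (N - Suc j))"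
proof -
  have "(\<Prod>i<N. \<gamma> (root_point j z e i)) =
      (\<Prod>i<Suc j. \<gamma> (root_point j z e i)) * (\<Prod>i=Suc j..<N. \<gamma> (root_point j z e i))"
    using assms unfolding atLeast0LessThan[symmetric]
    by (intro prod.atLeastLessThan_concat[symmetric]) auto
  also have "(\<Prod>i=Suc j..<N. \<gamma> (root_point j z e i)) = (\<Prod>i=Suc j..<N. \<gamma> 1)"
    by (intro prod.cong refl) (auto simp: root_point_def)
  also have "(\<Prod>i<Suc j. \<gamma> (root_point j z e i)) = \<gamma> (1 + z) * (\<Prod>i<j. \<gamma> (1 + e * unity_root j ^ Suc i))"
    unfolding prod.lessThan_Suc_shift by (simp add: root_point_def)
  finally show ?thesis by simp
qed

lemma prod_root_point_rotate:
  fixes \<gamma> :: "complex \<Rightarrow> complex"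
  assumes "j < N"
  shows "(\<Prod>i<N. \<gamma> (root_point j (unity_root j * e) (unity_root j * e) i)) = (\<Prod>i<N. \<gamma> (root_point j e e i))"
proof -
  define f where "f = (\<lambda>i. \<gamma> (1 + e * unity_root j ^ i))"
  have "\<gamma> (1 + unity_root j * e) * (\<Prod>i<j. \<gamma> (1 + unity_root j * e * unity_root j ^ Suc i)) = (\<Prod>i<Suc j. f (Suc i))"
    unfolding prod.lessThan_Suc_shift by (simp add: f_def mult_ac)
  also have "\<dots> = (\<Prod>i<j. f (Suc i)) * f (Suc j)" by simp
  also have "f (Suc j) = f 0" by (simp only: f_def unity_root_power_Suc power_0)
  also have "(\<Prod>i<j. f (Suc i)) * f 0 = \<gamma> (1 + e) * (\<Prod>i<j. \<gamma> (1 + e * unity_root j ^ Suc i))"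
    by (simp add: f_def)
  finally show ?thesis unfolding prod_root_point[OF assms] mult.assoc[symmetric] by simp
qed

text \<open>Read off from the decomposition into products, where the rotation merely permutes
  factors cyclically.\<close>

lemma schur_root_point_rotate:
  assumes "l \<in> signatures N" "j < N" "cmod e < 1"
  shows "schur N l (root_point j (unity_root j * e) (unity_root j * e)) = schur N l (root_point j e e)"
proof -
  obtain I :: "(nat \<Rightarrow> complex) set" and C s g where
    I: "\<And>u. (\<forall>i<N. u i \<noteq> 0) \<Longrightarrow> schur N l u =
       (\<Sum>\<beta>\<in>I. C \<beta> * (\<Prod>i<N. u i powi (- int s) * poly (g \<beta>) (u i - 1)))"
    by (rule schur_decomposition[OF assms(1)]) blast
  have "cmod (unity_root j * e) < 1" using assms by (simp add: norm_mult)
  then show ?thesis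
    using assms prod_root_point_rotate[OF assms(2), of "\<lambda>u. u powi (- int s) * poly (g \<beta>) (u - 1)" e for \<beta>]
    by (simp add: I root_point_nz)
qed

text \<open>A substitute for joint holomorphy that keeps exactly what gets differentiated: the
  function in \<open>z\<close>, and its \<open>z\<close>-derivatives on the diagonal as functions of
  \<open>e\<close>. Both conditions survive uniform limits on a smaller disc.\<close>

definition diag_hol :: "real \<Rightarrow> (complex \<Rightarrow> complex \<Rightarrow> complex) \<Rightarrow> bool" where
  "diag_hol d P \<longleftrightarrow> (\<forall>e\<in>ball 0 d. (\<lambda>z. P z e) holomorphic_on ball 0 d) \<and>
     (\<forall>r. (\<lambda>e. (deriv ^^ r) (\<lambda>z. P z e) e) holomorphic_on ball 0 d)"

lemma diag_hol_subset: "diag_hol d P \<Longrightarrow> d' \<le> d \<Longrightarrow> diag_hol d' P"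
  unfolding diag_hol_def by (meson holomorphic_on_subset subset_ball subsetD)

lemma higher_deriv_diag_cong:
  assumes "\<And>z e. z \<in> ball 0 d \<Longrightarrow> e \<in> ball 0 d \<Longrightarrow> P z e = Q z e" "e \<in> ball 0 d"
  shows "(deriv ^^ r) (\<lambda>z. P z e) e = (deriv ^^ r) (\<lambda>z. Q z e) e"
proof (rule higher_deriv_cong_ev)
  show "\<forall>\<^sub>F z in nhds e. P z e = Q z e"
    using assms by (intro eventually_nhds_in_open[THEN eventually_mono, of "ball 0 d"]) auto
qed auto

lemma diag_hol_cong:
  assumes "diag_hol d P" "\<And>z e. z \<in> ball 0 d \<Longrightarrow> e \<in> ball 0 d \<Longrightarrow> P z e = Q z e"
  shows "diag_hol d Q"
  unfolding diag_hol_def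
proof safe
  fix e :: complex assume e: "e \<in> ball 0 d"
  have "(\<lambda>z. P z e) holomorphic_on ball 0 d" using assms(1) e by (auto simp: diag_hol_def)
  then show "(\<lambda>z. Q z e) holomorphic_on ball 0 d"
    by (rule holomorphic_transform) (use assms(2) e in auto)
next
  fix r
  have "(\<lambda>e. (deriv ^^ r) (\<lambda>z. P z e) e) holomorphic_on ball 0 d"
    using assms(1) by (auto simp: diag_hol_def)
  then show "(\<lambda>e. (deriv ^^ r) (\<lambda>z. Q z e) e) holomorphic_on ball 0 d"
    by (rule holomorphic_transform) (rule higher_deriv_diag_cong, use assms(2) in auto)
qed

text \<open>The \<open>z\<close>-derivative is taken before the diagonal is imposed, so it does not
  act on the other root-of-unity coordinates, which depend on \<open>e\<close> only.\<close>

definition diag_taylor :: "complex \<Rightarrow> nat \<Rightarrow> nat \<Rightarrow> (complex \<Rightarrow> complex \<Rightarrow> complex) \<Rightarrow> complex" where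
  "diag_taylor a r j P = (deriv ^^ j) (\<lambda>e. (1 + e) powr a * (deriv ^^ r) (\<lambda>z. P z e) e) 0 / fact j"

lemma diag_taylor_cong:
  assumes "d > 0" "\<And>z e. z \<in> ball 0 d \<Longrightarrow> e \<in> ball 0 d \<Longrightarrow> P z e = Q z e"
  shows "diag_taylor a r j P = diag_taylor a r j Q"
  unfolding diag_taylor_def
proof (rule arg_cong2[of _ _ _ _ "(/)"] , rule higher_deriv_cong_ev)
  have "\<forall>\<^sub>F e in nhds 0. e \<in> ball (0::complex) d"
    using assms(1) by (intro eventually_nhds_in_open) auto
  then show "\<forall>\<^sub>F e in nhds 0. (1 + e) powr a * (deriv ^^ r) (\<lambda>z. P z e) e =
      (1 + e) powr a * (deriv ^^ r) (\<lambda>z. Q z e) e"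
  proof eventually_elim
    case (elim e)
    have "(deriv ^^ r) (\<lambda>z. P z e) e = (deriv ^^ r) (\<lambda>z. Q z e) e"
      by (rule higher_deriv_diag_cong[OF assms(2) elim])
    then show ?case by simp
  qed
qed auto

lemma one_plus_not_nonpos_Reals:
  assumes "cmod e < 1" shows "1 + e \<notin> \<real>\<^sub>\<le>\<^sub>0"
proof -
  have "Re e > -1" using assms abs_Re_le_cmod[of e] by linarith
  then show ?thesis by (auto simp: complex_nonpos_Reals_iff)
qed

lemma holomorphic_on_one_plus_powr:
  assumes "d \<le> 1" shows "(\<lambda>e. (1 + e) powr a) holomorphic_on ball 0 d"
  using assms by (intro holomorphic_intros one_plus_not_nonpos_Reals) auto

lemma
  assumes P: "diag_hol d P" and Q: "diag_hol d Q" and d: "0 < d" "d \<le> 1"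
  shows diag_hol_cmult_add: "diag_hol d (\<lambda>z e. c * P z e + Q z e)"
    and diag_taylor_cmult_add: "diag_taylor a r j (\<lambda>z e. c * P z e + Q z e) =
      c * diag_taylor a r j P + diag_taylor a r j Q"
proof -
  have lin: "(deriv ^^ r) (\<lambda>z. c * f z + g z) x = c * (deriv ^^ r) f x + (deriv ^^ r) g x"
    if f: "f holomorphic_on ball 0 d" and g: "g holomorphic_on ball 0 d" and x: "x \<in> ball 0 d" for f g x r
    using higher_deriv_add[OF holomorphic_on_mult[OF holomorphic_on_const f] g open_ball x]
      higher_deriv_cmult[OF f x open_ball] by simp
  have 1: "(deriv ^^ r) (\<lambda>z. c * P z e + Q z e) e = c * (deriv ^^ r) (\<lambda>z. P z e) e + (deriv ^^ r) (\<lambda>z. Q z e) e"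
    if "e \<in> ball 0 d" for e r
    using P Q that unfolding diag_hol_def by (intro lin) auto
  show "diag_hol d (\<lambda>z e. c * P z e + Q z e)"
    unfolding diag_hol_def
  proof safe
    fix e :: complex assume "e \<in> ball 0 d"
    then show "(\<lambda>z. c * P z e + Q z e) holomorphic_on ball 0 d"
      using P Q unfolding diag_hol_def by (intro holomorphic_on_add holomorphic_on_mult) auto
  next
    fix r
    have "(\<lambda>e. c * (deriv ^^ r) (\<lambda>z. P z e) e + (deriv ^^ r) (\<lambda>z. Q z e) e) holomorphic_on ball 0 d"
      using P Q unfolding diag_hol_def by (intro holomorphic_on_add holomorphic_on_mult) auto
    then show "(\<lambda>e. (deriv ^^ r) (\<lambda>z. c * P z e + Q z e) e) holomorphic_on ball 0 d"
      by (rule holomorphic_transform) (simp add: 1)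
  qed
  let ?h = "\<lambda>P e. (1 + e) powr a * (deriv ^^ r) (\<lambda>z. P z e) e"
  have "(deriv ^^ j) (?h (\<lambda>z e. c * P z e + Q z e)) 0 = (deriv ^^ j) (\<lambda>e. c * ?h P e + ?h Q e) 0"
  proof (rule higher_deriv_cong_ev)
    have "\<forall>\<^sub>F e in nhds 0. e \<in> ball (0::complex) d"
      using d by (intro eventually_nhds_in_open) auto
    then show "\<forall>\<^sub>F e in nhds 0. ?h (\<lambda>z e. c * P z e + Q z e) e = c * ?h P e + ?h Q e"
      by eventually_elim (simp add: 1 distrib_left)
  qed auto
  also have "\<dots> = c * (deriv ^^ j) (?h P) 0 + (deriv ^^ j) (?h Q) 0"
    using P Q d unfolding diag_hol_def
    by (intro lin holomorphic_on_mult holomorphic_on_one_plus_powr) auto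
  finally show "diag_taylor a r j (\<lambda>z e. c * P z e + Q z e) = c * diag_taylor a r j P + diag_taylor a r j Q"
    unfolding diag_taylor_def by (simp add: add_divide_distrib)
qed

lemma
  assumes "finite I" "\<And>i. i \<in> I \<Longrightarrow> diag_hol d (P i)" "0 < d" "d \<le> 1"
  shows diag_hol_sum: "diag_hol d (\<lambda>z e. \<Sum>i\<in>I. c i * P i z e)"
    and diag_taylor_sum: "diag_taylor a r j (\<lambda>z e. \<Sum>i\<in>I. c i * P i z e) = (\<Sum>i\<in>I. c i * diag_taylor a r j (P i))"
proof -
  have "diag_hol d (\<lambda>z e. \<Sum>i\<in>I. c i * P i z e) \<and>
    diag_taylor a r j (\<lambda>z e. \<Sum>i\<in>I. c i * P i z e) = (\<Sum>i\<in>I. c i * diag_taylor a r j (P i))"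
    using assms(1,2)
  proof (induction I rule: finite_induct)
    case empty
    show ?case by (simp add: diag_hol_def diag_taylor_def)
  next
    case (insert i I)
    then show ?case using assms by (simp add: diag_hol_cmult_add diag_taylor_cmult_add[of d])
  qed
  then show "diag_hol d (\<lambda>z e. \<Sum>i\<in>I. c i * P i z e)"
    "diag_taylor a r j (\<lambda>z e. \<Sum>i\<in>I. c i * P i z e) = (\<Sum>i\<in>I. c i * diag_taylor a r j (P i))" by auto
qed

section \<open>Products and Schur functions at the root points\<close>

lemma has_fps_expansion_poly: "(\<lambda>x. poly g x) has_fps_expansion fps_of_poly (g :: complex poly)"
proof (induction g)
  case (pCons c p)
  then show ?case
    unfolding fps_of_poly_pCons poly_pCons
    by (subst mult.commute) (intro has_fps_expansion_add has_fps_expansion_mult has_fps_expansion_const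
          has_fps_expansion_fps_X)
qed auto

lemma has_fps_expansion_one_plus_powi:
  "(\<lambda>x::complex. (1 + x) powi (- int s)) has_fps_expansion fps_binomial (- of_nat s)"
proof -
  have "\<forall>\<^sub>F x::complex in nhds 0. x \<in> ball 0 1"
    by (intro eventually_nhds_in_open) auto
  then have "\<forall>\<^sub>F x::complex in nhds 0. (1 + x) powr (- of_nat s) = (1 + x) powi (- int s)"
  proof eventually_elim
    case (elim x)
    then have "1 + x \<noteq> 0" using one_plus_not_nonpos_Reals[of x] by auto
    then show ?case using complex_powr_of_int[of "1 + x" "- int s"] by simp
  qed
  then show ?thesis
    by (rule iffD1[OF has_fps_expansion_cong[OF _ refl] has_fps_expansion_binomial_complex])
qed

lemma has_fps_expansion_higher_deriv:
  "f has_fps_expansion F \<Longrightarrow> (deriv ^^ r) f has_fps_expansion (fps_deriv ^^ r) F"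
  for f :: "complex \<Rightarrow> complex"
  by (induction r) (auto intro: has_fps_expansion_deriv)

lemma
  fixes \<gamma> :: "complex \<Rightarrow> complex"
  assumes hol: "(\<lambda>x. \<gamma> (1 + x)) holomorphic_on ball 0 1" and j: "j < N"
  shows diag_hol_prod: "diag_hol 1 (\<lambda>z e. \<Prod>i<N. \<gamma> (root_point j z e i))"
    and diag_taylor_prod: "\<gamma> 1 \<noteq> 0 \<Longrightarrow> (\<lambda>x. \<gamma> (1 + x)) has_fps_expansion G \<Longrightarrow>
      diag_taylor a r j (\<lambda>z e. \<Prod>i<N. \<gamma> (root_point j z e i)) =
      \<gamma> 1 ^ N * fps_nth (fps_binomial a * (fps_deriv ^^ r) G * inverse G) j"
proof -
  define \<gamma>1 where "\<gamma>1 = (\<lambda>x. \<gamma> (1 + x))"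
  define A where "A = (\<lambda>e. (\<Prod>i<j. \<gamma>1 (e * unity_root j ^ Suc i)) * \<gamma> 1 ^ (N - Suc j))"
  have P: "(\<Prod>i<N. \<gamma> (root_point j z e i)) = A e * \<gamma>1 z" for z e
    unfolding prod_root_point[OF j] A_def \<gamma>1_def by simp
  have hol1: "\<gamma>1 holomorphic_on ball 0 1" using hol by (simp add: \<gamma>1_def)
  have "(\<lambda>e. \<gamma>1 (e * unity_root j ^ i)) holomorphic_on ball 0 1" for i
  proof -
    have "\<gamma>1 \<circ> (\<lambda>e. e * unity_root j ^ i) holomorphic_on ball 0 1"
      by (rule holomorphic_on_compose_gen[OF _ hol1]) (auto intro!: holomorphic_intros simp: norm_mult norm_power)
    then show ?thesis by (simp add: o_def)
  qed
  then have holA: "A holomorphic_on ball 0 1"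
    unfolding A_def by (intro holomorphic_on_mult holomorphic_on_prod holomorphic_on_const)
  have D: "(deriv ^^ r) (\<lambda>z. A e * \<gamma>1 z) e = A e * (deriv ^^ r) \<gamma>1 e" if "e \<in> ball 0 1" for e r
    by (rule higher_deriv_cmult[OF hol1 that]) auto
  have holD: "(deriv ^^ r) \<gamma>1 holomorphic_on ball 0 1" for r
    by (rule holomorphic_higher_deriv[OF hol1]) auto
  have "(\<lambda>e. (deriv ^^ r) (\<lambda>z. A e * \<gamma>1 z) e) holomorphic_on ball 0 1" for r
    by (rule holomorphic_transform[of "\<lambda>e. A e * (deriv ^^ r) \<gamma>1 e"])
      (auto intro: holomorphic_on_mult holA holD simp: D)
  then show "diag_hol 1 (\<lambda>z e. \<Prod>i<N. \<gamma> (root_point j z e i))"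
    unfolding P diag_hol_def by (auto intro!: holomorphic_on_mult hol1)

  assume \<gamma>: "\<gamma> 1 \<noteq> 0" and G: "(\<lambda>x. \<gamma> (1 + x)) has_fps_expansion G"
  have G1: "\<gamma>1 has_fps_expansion G" using G by (simp add: \<gamma>1_def)
  have G0: "fps_nth G 0 \<noteq> 0" using has_fps_expansion_imp_0_eq_fps_nth_0[OF G1] \<gamma> by (simp add: \<gamma>1_def)
  have "isCont \<gamma>1 0"
    using holomorphic_on_imp_continuous_on[OF hol1] by (simp add: continuous_on_eq_continuous_at)
  then have "\<forall>\<^sub>F x in nhds 0. \<gamma>1 x \<noteq> 0"
    using \<gamma> by (intro tendsto_imp_eventually_ne[of \<gamma>1 "\<gamma>1 0"]) (auto simp: isCont_def \<gamma>1_def tendsto_nhds_iff)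
  then obtain d0 where d0: "d0 > 0" "\<And>x. x \<in> ball 0 d0 \<Longrightarrow> \<gamma>1 x \<noteq> 0"
    unfolding eventually_nhds_metric by (auto simp: dist_commute)
  define d where "d = min d0 1"
  have d: "d > 0" "d \<le> 1" "\<And>x. x \<in> ball 0 d \<Longrightarrow> \<gamma>1 x \<noteq> 0"
    using d0 by (auto simp: d_def)
  have sub: "ball 0 d \<subseteq> ball (0::complex) 1" using d by auto
  define K where "K = (\<lambda>e. (1 + e) powr a * (deriv ^^ r) \<gamma>1 e * inverse (\<gamma>1 e))"
  \<comment> \<open>Multiplying and dividing by \<open>\<gamma> (1 + e)\<close> completes
    \<open>A e\<close> to the rotation-invariant product \<open>\<Theta>\<close>; the quotient
    \<open>K\<close> has the power series that occurs in \<open>pp_trace\<close>.\<close>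
  define \<Theta> where "\<Theta> = (\<lambda>e. A e * \<gamma>1 e)"
  have Kfps: "K has_fps_expansion fps_binomial a * (fps_deriv ^^ r) G * inverse G"
    unfolding K_def
    by (intro has_fps_expansion_mult has_fps_expansion_binomial_complex has_fps_expansion_higher_deriv
        has_fps_expansion_inverse G1 G0)
  have holK: "K holomorphic_on ball 0 d"
    unfolding K_def using d(3)
    by (intro holomorphic_on_mult holomorphic_on_one_plus_powr d holomorphic_on_inverse
        holomorphic_on_subset[OF holD sub] holomorphic_on_subset[OF hol1 sub]) auto
  have hol\<Theta>: "\<Theta> holomorphic_on ball 0 d"
    unfolding \<Theta>_def by (intro holomorphic_on_mult holomorphic_on_subset[OF holA sub] holomorphic_on_subset[OF hol1 sub])
  have "(deriv ^^ j) (\<lambda>e. (1 + e) powr a * (deriv ^^ r) (\<lambda>z. A e * \<gamma>1 z) e) 0 = (deriv ^^ j) (\<lambda>e. \<Theta> e * K e) 0"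
  proof (rule higher_deriv_cong_ev)
    have "\<forall>\<^sub>F e in nhds 0. e \<in> ball (0::complex) d"
      using d by (intro eventually_nhds_in_open) auto
    then show "\<forall>\<^sub>F e in nhds 0. (1 + e) powr a * (deriv ^^ r) (\<lambda>z. A e * \<gamma>1 z) e = \<Theta> e * K e"
    proof eventually_elim
      case (elim e)
      then show ?case using d(3)[OF elim] D[of e] sub
        by (auto simp: \<Theta>_def K_def field_simps)
    qed
  qed auto
  also have "\<dots> = \<Theta> 0 * (deriv ^^ j) K 0"
  proof (rule higher_deriv_mult_rotation_invariant[OF hol\<Theta> holK d(1)])
    fix e
    show "\<Theta> (unity_root j * e) = \<Theta> e"
      using prod_root_point_rotate[OF j, of \<gamma> e] unfolding P by (simp add: \<Theta>_def)
  qed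
  also have "\<Theta> 0 = \<gamma> 1 ^ N"
  proof -
    have "\<Theta> 0 = (\<Prod>i<N. \<gamma> (root_point j 0 0 i))" by (simp add: P \<Theta>_def)
    also have "\<dots> = (\<Prod>i<N. \<gamma> 1)" by (intro prod.cong) (auto simp: root_point_def)
    finally show ?thesis by simp
  qed
  finally show "diag_taylor a r j (\<lambda>z e. \<Prod>i<N. \<gamma> (root_point j z e i)) =
      \<gamma> 1 ^ N * fps_nth (fps_binomial a * (fps_deriv ^^ r) G * inverse G) j"
    unfolding diag_taylor_def P fps_nth_fps_expansion[OF Kfps] by simp
qed

lemma
  assumes l: "l \<in> signatures N"
  shows diag_hol_schur: "j < N \<Longrightarrow> diag_hol 1 (\<lambda>z e. schur N l (root_point j z e))"
    and diag_taylor_schur: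
      "(\<Sum>j\<le>m. of_nat ((m choose j) * fact j * (N choose Suc j)) *
          diag_taylor (of_nat m - q) (m - j) j (\<lambda>z e. schur N l (root_point j z e))) =
       schur N l ones * pp_factorial_moment q m N l"
    and schur_ones_nz: "schur N l ones \<noteq> 0"
proof -
  obtain I :: "(nat \<Rightarrow> complex) set" and C s g where
    I: "finite I" "\<And>v. v \<in> I \<Longrightarrow> poly (g v) 0 \<noteq> (0::complex)"
    "\<And>u. (\<forall>i<N. u i \<noteq> 0) \<Longrightarrow> schur N l u =
       (\<Sum>v\<in>I. C v * (\<Prod>i<N. u i powi (- int s) * poly (g v) (u i - 1)))"
    "\<And>q m. (\<Sum>v\<in>I. C v * (poly (g v) 0 ^ N * pp_trace q m N (fps_binomial (- of_nat s) * fps_of_poly (g v)))) =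
       schur N l ones * pp_factorial_moment q m N l"
    "schur N l ones \<noteq> 0"
    by (rule schur_decomposition[OF l]) blast
  show "schur N l ones \<noteq> 0" by (rule I)
  define \<gamma> where "\<gamma> = (\<lambda>v u. u powi (- int s) * poly (g v) (u - 1))"
  define Pr where "Pr = (\<lambda>j v z e. \<Prod>i<N. \<gamma> v (root_point j z e i))"
  have eq: "schur N l (root_point j z e) = (\<Sum>v\<in>I. C v * Pr j v z e)"
    if "z \<in> ball 0 1" "e \<in> ball 0 1" for j z e
    using that by (subst I(3)) (auto simp: Pr_def \<gamma>_def root_point_nz)
  have hol: "(\<lambda>x. \<gamma> v (1 + x)) holomorphic_on ball 0 1" for v
  proof -
    have "1 + x \<noteq> 0" if "cmod x < 1" for x using one_plus_not_nonpos_Reals[OF that] by auto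
    then show ?thesis unfolding \<gamma>_def by (intro holomorphic_intros) auto
  qed
  have fps: "(\<lambda>x. \<gamma> v (1 + x)) has_fps_expansion fps_binomial (- of_nat s) * fps_of_poly (g v)" for v
    unfolding \<gamma>_def using has_fps_expansion_poly[of "g v"]
    by (intro has_fps_expansion_mult has_fps_expansion_one_plus_powi) simp
  have \<gamma>1: "\<gamma> v 1 = poly (g v) 0" for v by (simp add: \<gamma>_def)
  have dh: "diag_hol 1 (Pr j v)" if "j < N" for j v
    unfolding Pr_def by (rule diag_hol_prod[OF hol that])
  show "diag_hol 1 (\<lambda>z e. schur N l (root_point j z e))" if "j < N"
  proof (rule diag_hol_cong)
    show "diag_hol 1 (\<lambda>z e. \<Sum>v\<in>I. C v * Pr j v z e)"
      by (rule diag_hol_sum[OF I(1) dh[OF that]]) auto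
  qed (use eq in auto)
  have T: "diag_taylor a r j (\<lambda>z e. schur N l (root_point j z e)) =
     (\<Sum>v\<in>I. C v * (poly (g v) 0 ^ N * fps_nth (fps_binomial a *
       (fps_deriv ^^ r) (fps_binomial (- of_nat s) * fps_of_poly (g v)) * inverse (fps_binomial (- of_nat s) *
             fps_of_poly (g v))) j))"
    if "j < N" for a r j
  proof -
    have "diag_taylor a r j (\<lambda>z e. schur N l (root_point j z e)) = diag_taylor a r j (\<lambda>z e. \<Sum>v\<in>I. C v * Pr j v z e)"
      by (rule diag_taylor_cong[of 1]) (use eq in auto)
    also have "\<dots> = (\<Sum>v\<in>I. C v * diag_taylor a r j (Pr j v))"
      by (rule diag_taylor_sum[OF I(1) dh[OF that]]) auto
    also have "\<dots> = (\<Sum>v\<in>I. C v * (\<gamma> v 1 ^ N * fps_nth (fps_binomial a *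
       (fps_deriv ^^ r) (fps_binomial (- of_nat s) * fps_of_poly (g v)) * inverse (fps_binomial (- of_nat s) *
             fps_of_poly (g v))) j))"
      unfolding Pr_def using I(2)
      by (intro sum.cong refl arg_cong2[of _ _ _ _ "(*)"] diag_taylor_prod[OF hol that _ fps]) (simp add: \<gamma>1)
    finally show ?thesis unfolding \<gamma>1 .
  qed
  show "(\<Sum>j\<le>m. of_nat ((m choose j) * fact j * (N choose Suc j)) *
          diag_taylor (of_nat m - q) (m - j) j (\<lambda>z e. schur N l (root_point j z e))) =
       schur N l ones * pp_factorial_moment q m N l"
  proof -
    let ?X = "\<lambda>j v. fps_nth (fps_binomial (of_nat m - q) *
       (fps_deriv ^^ (m - j)) (fps_binomial (- of_nat s) * fps_of_poly (g v)) * inverse (fps_binomial (- of_nat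
             s) * fps_of_poly (g v))) j"
    let ?b = "\<lambda>j. of_nat ((m choose j) * fact j * (N choose Suc j)) :: complex"
    \<comment> \<open>For \<open>j \<ge> N\<close> the coefficient \<open>N choose Suc j\<close> is
      0, so the expansion \<open>T\<close> is invoked only when the \<open>j + 1\<close> points fit
      into \<open>N\<close> coordinates.\<close>
    have "?b j * diag_taylor (of_nat m - q) (m - j) j (\<lambda>z e. schur N l (root_point j z e)) =
        (\<Sum>v\<in>I. ?b j * (C v * (poly (g v) 0 ^ N * ?X j v)))" for j
      by (cases "j < N") (simp_all add: T sum_distrib_left binomial_eq_0)
    then have "(\<Sum>j\<le>m. ?b j * diag_taylor (of_nat m - q) (m - j) j (\<lambda>z e. schur N l (root_point j z e))) =
      (\<Sum>j\<le>m. \<Sum>v\<in>I. ?b j * (C v * (poly (g v) 0 ^ N * ?X j v)))" by simp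
    also have "\<dots> = (\<Sum>v\<in>I. C v * (poly (g v) 0 ^ N * pp_trace q m N (fps_binomial (- of_nat s) * fps_of_poly (g v))))"
      by (subst sum.swap) (simp only: pp_trace_def sum_distrib_left mult_ac)
    finally show ?thesis unfolding I(4) .
  qed
qed

section \<open>Uniform limits\<close>

lemma holomorphic_on_uniform_limit_open:
  assumes ul: "uniform_limit A f g F" and hol: "\<forall>\<^sub>F n in F. f n holomorphic_on A"
    and F: "F \<noteq> bot" and A: "open A"
  shows "g holomorphic_on A"
  unfolding holomorphic_on_open[OF A]
proof
  fix z assume z: "z \<in> A"
  obtain r where r: "r > 0" "cball z r \<subseteq> A" using A z open_contains_cball by blast
  have hol': "\<forall>\<^sub>F n in F. continuous_on (cball z r) (f n) \<and> f n holomorphic_on ball z r"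
    using hol
  proof eventually_elim
    case (elim n)
    then have "f n holomorphic_on cball z r" using r holomorphic_on_subset by blast
    then show ?case
      using holomorphic_on_imp_continuous_on holomorphic_on_subset ball_subset_cball by blast
  qed
  have "uniform_limit (cball z r) f g F" by (rule uniform_limit_on_subset[OF ul r(2)])
  then have "g holomorphic_on ball z r"
    using holomorphic_uniform_limit[OF hol' _ F] by blast
  then show "\<exists>f'. (g has_field_derivative f') (at z)"
    using r(1) by (auto simp: holomorphic_on_open)
qed

lemma uniform_limit_section:
  assumes "uniform_limit (A \<times> X) (\<lambda>n (z, x). f n z x) (\<lambda>(z, x). g z x) F" "x \<in> X"
  shows "uniform_limit A (\<lambda>n z. f n z x) (\<lambda>z. g z x) F"
  using assms unfolding uniform_limit_iff by (fastforce elim: eventually_mono)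

text \<open>Cauchy estimates on discs of radius \<open>d / 4\<close> centred in the half disc; the
  bound is the same for every parameter \<open>x\<close>.\<close>

lemma uniform_limit_higher_deriv:
  fixes f :: "'n \<Rightarrow> complex \<Rightarrow> 'x \<Rightarrow> complex"
  assumes ul: "uniform_limit (ball 0 d \<times> X) (\<lambda>n (z, x). f n z x) (\<lambda>(z, x). g z x) F"
    and hol: "\<forall>\<^sub>F n in F. \<forall>x\<in>X. (\<lambda>z. f n z x) holomorphic_on ball 0 d"
    and F: "F \<noteq> bot" and d: "d > 0"
  shows "uniform_limit (ball 0 (d / 2) \<times> X) (\<lambda>n (z, x). (deriv ^^ r) (\<lambda>z. f n z x) z)
           (\<lambda>(z, x). (deriv ^^ r) (\<lambda>z. g z x) z) F"
proof (cases "r = 0")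
  case True
  have "ball 0 (d / 2) \<times> X \<subseteq> ball 0 d \<times> X" using d by auto
  then show ?thesis using True uniform_limit_on_subset[OF ul] by simp
next
  case False
  have holg: "(\<lambda>z. g z x) holomorphic_on ball 0 d" if "x \<in> X" for x
  proof (rule holomorphic_on_uniform_limit_open[OF uniform_limit_section[OF ul that] _ F])
    show "\<forall>\<^sub>F n in F. (\<lambda>z. f n z x) holomorphic_on ball 0 d"
      using hol by eventually_elim (use that in auto)
  qed auto
  show ?thesis
    unfolding uniform_limit_iff
  proof (intro allI impI)
    fix \<epsilon> :: real assume \<epsilon>: "\<epsilon> > 0"
    \<comment> \<open>Chosen so that the Cauchy bound equals \<open>\<epsilon> / 2\<close>, hence
      lies strictly below \<open>\<epsilon>\<close>.\<close>
    define \<epsilon>' where "\<epsilon>' = \<epsilon> * (d / 4) ^ r / (2 * fact r)"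
    have \<epsilon>': "\<epsilon>' > 0" using \<epsilon> d by (simp add: \<epsilon>'_def)
    have bound: "fact r * \<epsilon>' / (d / 4) ^ r < \<epsilon>"
      using \<epsilon> d by (simp add: \<epsilon>'_def)
    have "\<forall>\<^sub>F n in F. \<forall>zx\<in>ball 0 d \<times> X. dist (case zx of (z, x) \<Rightarrow> f n z x) (case zx of (z, x) \<Rightarrow> g z x) < \<epsilon>'"
      using ul \<epsilon>' unfolding uniform_limit_iff by blast
    then show "\<forall>\<^sub>F n in F. \<forall>zx\<in>ball 0 (d / 2) \<times> X.
        dist (case zx of (z, x) \<Rightarrow> (deriv ^^ r) (\<lambda>z. f n z x) z) (case zx of (z, x) \<Rightarrow> (deriv ^^ r) (\<lambda>z. g z x) z) < \<epsilon>"
      using hol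
    proof eventually_elim
      case (elim n)
      show ?case
      proof safe
        fix z :: complex and x assume z: "z \<in> ball 0 (d / 2)" and x: "x \<in> X"
        have sub: "cball z (d / 4) \<subseteq> ball 0 d"
        proof
          fix w assume "w \<in> cball z (d / 4)"
          then have "cmod w \<le> cmod z + d / 4"
            using norm_triangle_ineq2[of w z] by (simp add: dist_norm norm_minus_commute)
          then show "w \<in> ball 0 d" using z d by simp
        qed
        have holf: "(\<lambda>z. f n z x) holomorphic_on ball 0 d" using elim x by auto
        have "(\<lambda>w. f n w x - g w x) holomorphic_on ball 0 d"
          by (intro holomorphic_on_diff holf holg[OF x])
        then have hold: "(\<lambda>w. f n w x - g w x) holomorphic_on cball z (d / 4)"
          using sub holomorphic_on_subset by blast
        have "cmod ((deriv ^^ r) (\<lambda>w. f n w x - g w x) z) \<le> fact r * \<epsilon>' / (d / 4) ^ r"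
        proof (rule Cauchy_higher_deriv_bound)
          show "(\<lambda>w. f n w x - g w x) holomorphic_on ball z (d / 4)"
            using hold holomorphic_on_subset ball_subset_cball by blast
          show "continuous_on (cball z (d / 4)) (\<lambda>w. f n w x - g w x)"
            by (rule holomorphic_on_imp_continuous_on[OF hold])
          show "f n w x - g w x \<in> ball 0 \<epsilon>'" if "w \<in> ball z (d / 4)" for w
          proof -
            have "w \<in> ball 0 d" using that sub ball_subset_cball by blast
            then show ?thesis using elim(1) x by (auto simp: dist_norm norm_minus_commute)
          qed
        qed (use False d in auto)
        moreover have "z \<in> ball 0 d" using z d by simp
        then have "(deriv ^^ r) (\<lambda>w. f n w x - g w x) z = (deriv ^^ r) (\<lambda>w. f n w x) z - (deriv ^^ r) (\<lambda>w. g w x) z"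
          by (intro higher_deriv_diff[OF holf holg[OF x]]) auto
        ultimately show "dist ((deriv ^^ r) (\<lambda>z. f n z x) z) ((deriv ^^ r) (\<lambda>z. g z x) z) < \<epsilon>"
          using bound by (simp add: dist_norm)
      qed
    qed
  qed
qed

lemma tendsto_higher_deriv_mult:
  assumes f: "uniform_limit A f g F" "\<forall>\<^sub>F n in F. f n holomorphic_on A" "F \<noteq> bot"
    and A: "open A" "z \<in> A" and h: "h holomorphic_on A"
  shows "((\<lambda>n. (deriv ^^ j) (\<lambda>e. h e * f n e) z) \<longlongrightarrow> (deriv ^^ j) (\<lambda>e. h e * g e) z) F"
proof -
  have g: "g holomorphic_on A" by (rule holomorphic_on_uniform_limit_open[OF f A(1)])
  have L: "(deriv ^^ j) (\<lambda>e. h e * f' e) z =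
      (\<Sum>i=0..j. of_nat (j choose i) * (deriv ^^ i) h z * (deriv ^^ (j - i)) f' z)"
    if "f' holomorphic_on A" for f'
    by (rule higher_deriv_mult[OF h that A])
  have "((\<lambda>n. \<Sum>i=0..j. of_nat (j choose i) * (deriv ^^ i) h z * (deriv ^^ (j - i)) (f n) z) \<longlongrightarrow>
      (deriv ^^ j) (\<lambda>e. h e * g e) z) F"
    unfolding L[OF g]
    by (intro tendsto_sum tendsto_mult tendsto_const higher_deriv_complex_uniform_limit[OF f A])
  moreover have "\<forall>\<^sub>F n in F. (\<Sum>i=0..j. of_nat (j choose i) * (deriv ^^ i) h z * (deriv ^^ (j - i)) (f n) z) =
      (deriv ^^ j) (\<lambda>e. h e * f n e) z"
    using f(2) by eventually_elim (simp add: L)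
  ultimately show ?thesis by (rule Lim_transform_eventually)
qed

lemma
  assumes ul: "uniform_limit (ball 0 d \<times> ball 0 d) (\<lambda>n (z, e). P n z e) (\<lambda>(z, e). Q z e) F"
    and hol: "\<forall>\<^sub>F n in F. diag_hol d (P n)" and F: "F \<noteq> bot" and d: "0 < d" "d \<le> 1"
  shows diag_hol_uniform_limit: "diag_hol (d / 2) Q"
    and diag_taylor_uniform_limit: "((\<lambda>n. diag_taylor a r j (P n)) \<longlongrightarrow> diag_taylor a r j Q) F"
proof -
  have hol1: "\<forall>\<^sub>F n in F. \<forall>e\<in>ball 0 d. (\<lambda>z. P n z e) holomorphic_on ball 0 d"
    using hol by eventually_elim (auto simp: diag_hol_def)
  have sub: "ball 0 (d / 2) \<subseteq> ball (0::complex) d" using d by auto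
  have D: "uniform_limit (ball 0 (d / 2)) (\<lambda>n e. (deriv ^^ r) (\<lambda>z. P n z e) e) (\<lambda>e. (deriv ^^ r) (\<lambda>z. Q z e) e) F" for r
    using uniform_limit_higher_deriv[OF ul hol1 F d(1), of r] d
    unfolding uniform_limit_iff by (fastforce elim: eventually_mono)
  have holD: "\<forall>\<^sub>F n in F. (\<lambda>e. (deriv ^^ r) (\<lambda>z. P n z e) e) holomorphic_on ball 0 (d / 2)" for r
    using hol by eventually_elim (use sub holomorphic_on_subset in \<open>auto simp: diag_hol_def\<close>)
  have holQ: "(\<lambda>e. (deriv ^^ r) (\<lambda>z. Q z e) e) holomorphic_on ball 0 (d / 2)" for r
    by (rule holomorphic_on_uniform_limit_open[OF D holD F]) auto
  show "diag_hol (d / 2) Q"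
    unfolding diag_hol_def
  proof (intro conjI ballI allI holQ)
    fix e :: complex assume "e \<in> ball 0 (d / 2)"
    then have e: "e \<in> ball 0 d" using sub by blast
    have "(\<lambda>z. Q z e) holomorphic_on ball 0 d"
    proof (rule holomorphic_on_uniform_limit_open[OF uniform_limit_section[OF ul e] _ F])
      show "\<forall>\<^sub>F n in F. (\<lambda>z. P n z e) holomorphic_on ball 0 d"
        using hol1 by eventually_elim (use e in auto)
    qed auto
    then show "(\<lambda>z. Q z e) holomorphic_on ball 0 (d / 2)" using sub holomorphic_on_subset by blast
  qed
  show "((\<lambda>n. diag_taylor a r j (P n)) \<longlongrightarrow> diag_taylor a r j Q) F"
    unfolding diag_taylor_def using d
    by (intro tendsto_divide tendsto_const tendsto_higher_deriv_mult[OF D holD F] holomorphic_on_one_plus_powr) auto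
qed

section \<open>The Schur generating function\<close>

lemma has_sum_finite_sum:
  fixes f :: "'i \<Rightarrow> 'a \<Rightarrow> 'b :: topological_comm_monoid_add"
  assumes "\<And>i. i \<in> I \<Longrightarrow> (f i has_sum S i) A"
  shows "((\<lambda>x. \<Sum>i\<in>I. f i x) has_sum (\<Sum>i\<in>I. S i)) A"
proof -
  have "((\<lambda>F. \<Sum>i\<in>I. \<Sum>x\<in>F. f i x) \<longlongrightarrow> (\<Sum>i\<in>I. S i)) (finite_subsets_at_top A)"
    using assms unfolding has_sum_def by (intro tendsto_sum) auto
  moreover have "(\<Sum>i\<in>I. \<Sum>x\<in>F. f i x) = (\<Sum>x\<in>F. \<Sum>i\<in>I. f i x)" for F
    by (rule sum.swap)
  ultimately show ?thesis unfolding has_sum_def by simp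
qed

lemma sgf_term_le_corners:
  assumes "l \<in> signatures N" "0 < d" "d < 1" "k \<le> N"
    and u: "\<And>i. i < k \<Longrightarrow> cmod (u i - 1) \<le> d" "\<And>i. k \<le> i \<Longrightarrow> u i = 1"
  shows "cmod (sgf_term \<rho> N l u) \<le> (\<Sum>X\<in>Pow {..<k}. cmod (sgf_term \<rho> N l (corner d k X)))"
proof -
  define c where "c = cmod (complex_of_real (pmf \<rho> l) / schur N l ones)"
  have *: "cmod (sgf_term \<rho> N l u) = c * cmod (schur N l u)" for u
    by (simp add: sgf_term_def c_def norm_mult norm_divide)
  have "cmod (schur N l u) \<le> (\<Sum>X\<in>Pow {..<k}. cmod (schur N l (corner d k X)))"
    using assms by (intro norm_pos_laurent_le_corners[OF schur_pos_laurent]) auto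
  then show ?thesis
    unfolding * sum_distrib_left[symmetric] by (rule mult_left_mono) (simp add: c_def)
qed

definition pad_disc :: "nat \<Rightarrow> real \<Rightarrow> (nat \<Rightarrow> complex) set" where
  "pad_disc k d = {u. (\<forall>i<k. cmod (u i - 1) \<le> d) \<and> (\<forall>i\<ge>k. u i = 1)}"

lemma sgf_uniform_limit:
  assumes d: "0 < d" "d < 1" and k: "k \<le> N"
    and nz: "\<And>X. X \<subseteq> {..<k} \<Longrightarrow> sgf \<rho> N (corner d k X) \<noteq> 0"
  shows "uniform_limit (pad_disc k d) (\<lambda>F u. \<Sum>l\<in>F. sgf_term \<rho> N l u) (sgf \<rho> N)
    (finite_subsets_at_top (signatures N))"
  unfolding sgf_def
proof (rule Weierstrass_m_test_general)
  show "norm (sgf_term \<rho> N l u) \<le> (\<Sum>X\<in>Pow {..<k}. cmod (sgf_term \<rho> N l (corner d k X)))"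
    if "l \<in> signatures N" "u \<in> pad_disc k d" for l u
    using that d k by (intro sgf_term_le_corners) (auto simp: pad_disc_def)
  have "(\<lambda>l. cmod (sgf_term \<rho> N l (corner d k X))) summable_on signatures N" if "X \<subseteq> {..<k}" for X
  proof -
    \<comment> \<open>\<open>infsum\<close> is 0 for families that are not summable, so a nonzero
      value certifies summability; for complex families this is absolute summability, as the
      majorant requires.\<close>
    have "(\<lambda>l. sgf_term \<rho> N l (corner d k X)) summable_on signatures N"
      using nz[OF that] infsum_not_exists unfolding sgf_def by blast
    then show ?thesis by (simp only: summable_on_iff_abs_summable_on_complex)
  qed
  then show "(\<lambda>l. \<Sum>X\<in>Pow {..<k}. cmod (sgf_term \<rho> N l (corner d k X))) summable_on signatures N"
    by (intro has_sum_imp_summable[OF has_sum_finite_sum[where S =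
          "\<lambda>X. \<Sum>\<^sub>\<infinity>l\<in>signatures N. cmod (sgf_term \<rho> N l (corner d k X))"]] has_sum_infsum) auto
qed

lemma root_point_in_pad_disc:
  assumes "j \<le> k" "cmod z \<le> d" "cmod e \<le> d"
  shows "root_point j z e \<in> pad_disc (Suc k) d"
proof -
  have "cmod (e * unity_root j ^ i) \<le> d" for i using assms by (simp add: norm_mult norm_power)
  moreover have "0 \<le> d" using assms norm_ge_zero order_trans by blast
  ultimately show ?thesis using assms by (auto simp: pad_disc_def root_point_def)
qed

text \<open>\<open>diag_taylor\<close> is linear on finite partial sums and continuous under the
  uniform limit, so it may be applied to the series term by term. Rotation invariance holds for each
  summand.\<close>

lemma
  assumes d: "0 < d" "d < 1" and k: "k < N" and j: "j \<le> k"
    and nz: "\<And>X. X \<subseteq> {..<Suc k} \<Longrightarrow> sgf \<rho> N (corner d (Suc k) X) \<noteq> 0"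
  shows diag_hol_sgf: "diag_hol (d / 2) (\<lambda>z e. sgf \<rho> N (root_point j z e))"
    and sgf_root_point_rotate: "cmod e < d \<Longrightarrow>
      sgf \<rho> N (root_point j (unity_root j * e) (unity_root j * e)) = sgf \<rho> N (root_point j e e)"
    and has_sum_diag_taylor_sgf:
      "((\<lambda>l. complex_of_real (pmf \<rho> l) / schur N l ones * diag_taylor a r j (\<lambda>z e. schur N l (root_point j z e)))
         has_sum diag_taylor a r j (\<lambda>z e. sgf \<rho> N (root_point j z e))) (signatures N)"
proof -
  let ?F = "finite_subsets_at_top (signatures N)"
  let ?c = "\<lambda>l. complex_of_real (pmf \<rho> l) / schur N l ones"
  have jN: "j < N" using j k by simp
  have ul: "uniform_limit (ball 0 d \<times> ball 0 d)
     (\<lambda>F (z, e). \<Sum>l\<in>F. ?c l * schur N l (root_point j z e)) (\<lambda>(z, e). sgf \<rho> N (root_point j z e)) ?F"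
  proof -
    have "uniform_limit (pad_disc (Suc k) d) (\<lambda>F u. \<Sum>l\<in>F. sgf_term \<rho> N l u) (sgf \<rho> N) ?F"
      using d k nz by (intro sgf_uniform_limit) auto
    then have "uniform_limit (ball 0 d \<times> ball 0 d)
       (\<lambda>F ze. \<Sum>l\<in>F. sgf_term \<rho> N l (case ze of (z, e) \<Rightarrow> root_point j z e))
       (\<lambda>ze. sgf \<rho> N (case ze of (z, e) \<Rightarrow> root_point j z e)) ?F"
      by (rule uniform_limit_compose') (use j in \<open>auto intro!: root_point_in_pad_disc\<close>)
    moreover have "(\<Sum>l\<in>F. sgf_term \<rho> N l (case ze of (z, e) \<Rightarrow> root_point j z e)) =
        (case ze of (z, e) \<Rightarrow> \<Sum>l\<in>F. ?c l * schur N l (root_point j z e))" for F ze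
      by (cases ze) (simp add: sgf_term_def)
    moreover have "sgf \<rho> N (case ze of (z, e) \<Rightarrow> root_point j z e) = (case ze of (z, e) \<Rightarrow> sgf \<rho> N (root_point j z
          e))" for ze
      by (cases ze) simp
    ultimately show ?thesis by simp
  qed
  have ds: "diag_hol d (\<lambda>z e. schur N l (root_point j z e))" if "l \<in> signatures N" for l
    by (rule diag_hol_subset[OF diag_hol_schur[OF that jN]]) (use d in simp)
  have fin: "\<forall>\<^sub>F F in ?F. finite F \<and> F \<subseteq> signatures N"
    by (intro eventually_finite_subsets_at_top_weakI) auto
  then have hol: "\<forall>\<^sub>F F in ?F. diag_hol d (\<lambda>z e. \<Sum>l\<in>F. ?c l * schur N l (root_point j z e))"
  proof eventually_elim
    case (elim F)
    show ?case by (rule diag_hol_sum) (use elim ds d in auto)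
  qed
  show "diag_hol (d / 2) (\<lambda>z e. sgf \<rho> N (root_point j z e))"
    by (rule diag_hol_uniform_limit[OF ul hol]) (use d in auto)
  have "((\<lambda>F. diag_taylor a r j (\<lambda>z e. \<Sum>l\<in>F. ?c l * schur N l (root_point j z e))) \<longlongrightarrow>
      diag_taylor a r j (\<lambda>z e. sgf \<rho> N (root_point j z e))) ?F"
    by (rule diag_taylor_uniform_limit[OF ul hol]) (use d in auto)
  moreover have "\<forall>\<^sub>F F in ?F. diag_taylor a r j (\<lambda>z e. \<Sum>l\<in>F. ?c l * schur N l (root_point j z e)) =
      (\<Sum>l\<in>F. ?c l * diag_taylor a r j (\<lambda>z e. schur N l (root_point j z e)))"
    using fin
  proof eventually_elim
    case (elim F)
    show ?case by (rule diag_taylor_sum[of F d]) (use elim ds d in auto)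
  qed
  ultimately show "((\<lambda>l. ?c l * diag_taylor a r j (\<lambda>z e. schur N l (root_point j z e)))
         has_sum diag_taylor a r j (\<lambda>z e. sgf \<rho> N (root_point j z e))) (signatures N)"
    unfolding has_sum_def by (rule Lim_transform_eventually)
  assume e: "cmod e < d"
  show "sgf \<rho> N (root_point j (unity_root j * e) (unity_root j * e)) = sgf \<rho> N (root_point j e e)"
    unfolding sgf_def
    by (rule infsum_cong) (use e d in \<open>simp add: sgf_term_def schur_root_point_rotate[OF _ jN]\<close>)
qed

section \<open>From factorial moments to moments and expectations\<close>

lemma power_eq_sum_Stirling:
  "a ^ k = (\<Sum>m\<le>k. of_nat (Stirling k m) * (fact m * (a gchoose m)))" for a :: complex
proof (induction k)
  case (Suc k)
  define f where "f = (\<lambda>m. fact m * (a gchoose m))"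
  have f: "a * f m = f (Suc m) + of_nat m * f m" for m
    unfolding f_def gbinomial_mult_fact by (simp add: algebra_simps)
  have "(\<Sum>m\<le>Suc k. of_nat (Stirling (Suc k) m) * f m) =
      (\<Sum>m\<le>k. of_nat (Stirling (Suc k) (Suc m)) * f (Suc m))"
    by (subst sum.atMost_Suc_shift) simp
  also have "\<dots> = (\<Sum>m\<le>k. of_nat (Suc m) * of_nat (Stirling k (Suc m)) * f (Suc m)) +
      (\<Sum>m\<le>k. of_nat (Stirling k m) * f (Suc m))"
    by (simp add: sum.distrib[symmetric] algebra_simps)
  also have "(\<Sum>m\<le>k. of_nat (Suc m) * of_nat (Stirling k (Suc m)) * f (Suc m)) =
      (\<Sum>m\<le>Suc k. of_nat m * of_nat (Stirling k m) * f m)"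
    by (subst sum.atMost_Suc_shift) simp
  also have "\<dots> = (\<Sum>m\<le>k. of_nat m * of_nat (Stirling k m) * f m)" by simp
  also have "\<dots> + (\<Sum>m\<le>k. of_nat (Stirling k m) * f (Suc m)) = (\<Sum>m\<le>k. of_nat (Stirling k m) * (a * f m))"
    unfolding f by (simp add: sum.distrib[symmetric] algebra_simps)
  also have "\<dots> = a * (\<Sum>m\<le>k. of_nat (Stirling k m) * f m)"
    by (simp add: sum_distrib_left mult_ac)
  finally show ?case using Suc by (simp add: f_def)
qed simp

text \<open>Besides \<open>Stirling k k = 1\<close>, only this Stirling number contributes at order
  \<open>1 / N\<close>.\<close>

lemma Stirling_Suc_n_n: "Stirling (Suc n) n = Suc n choose 2"
proof (induction n)
  case (Suc n)
  have "Stirling (Suc (Suc n)) (Suc n) = Suc n * Stirling (Suc n) (Suc n) + Stirling (Suc n) n"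
    by (simp only: Stirling.simps)
  then show ?case using Suc by (simp add: numeral_2_eq_2)
qed simp

lemma pp_moment_eq:
  "complex_of_real (pp_moment q N l k) =
     (\<Sum>m\<le>k. of_nat (Stirling k m) * pp_factorial_moment (of_real q) m N l) / of_nat N ^ Suc k"
proof -
  define x :: "nat \<Rightarrow> complex" where "x = (\<lambda>c. of_int (sig_exp N l c))"
  define w where "w = (\<lambda>c. \<Prod>j\<in>{..<N} - {c}. (x c - x j - of_real q) / (x c - x j))"
  have "complex_of_real (pp_weight q N l c) = w c" for c
    unfolding pp_weight_def w_def of_real_prod
    by (intro prod.cong refl) (simp add: x_def sig_exp_def algebra_simps)
  moreover have "complex_of_real (pp_atom N l c) = x c / of_nat N" if "c < N" for c
    by (simp add: pp_atom_def x_def sig_exp_def algebra_simps)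
  ultimately have "complex_of_real (pp_moment q N l k) = 1 / of_nat N * (\<Sum>c<N. w c * (x c / of_nat N) ^ k)"
    unfolding pp_moment_def by simp
  also have "\<dots> = (\<Sum>c<N. w c * x c ^ k) / of_nat N ^ Suc k"
    by (simp add: power_divide sum_divide_distrib[symmetric] sum_distrib_left divide_simps)
  also have "(\<Sum>c<N. w c * x c ^ k) = (\<Sum>c<N. \<Sum>m\<le>k. of_nat (Stirling k m) * (fact m * (x c gchoose m) * w c))"
    unfolding power_eq_sum_Stirling[of _ k] sum_distrib_left by (intro sum.cong refl) (simp only: mult_ac)
  also have "\<dots> = (\<Sum>m\<le>k. of_nat (Stirling k m) * pp_factorial_moment (of_real q) m N l)"
    unfolding pp_factorial_moment_def sum_distrib_left w_def x_def by (rule sum.swap)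
  finally show ?thesis .
qed

definition sgf_taylor :: "int list pmf \<Rightarrow> complex \<Rightarrow> nat \<Rightarrow> nat \<Rightarrow> nat \<Rightarrow> complex" where
  "sgf_taylor \<rho> q N m j = diag_taylor (of_nat m - q) (m - j) j (\<lambda>z e. sgf \<rho> N (root_point j z e))"

lemma has_sum_pp_moment:
  assumes d: "0 < d" "d < 1" and k: "k < N"
    and nz: "\<And>X. X \<subseteq> {..<Suc k} \<Longrightarrow> sgf \<rho> N (corner d (Suc k) X) \<noteq> 0"
  shows "((\<lambda>l. complex_of_real (pmf \<rho> l * pp_moment q N l k)) has_sum
    (\<Sum>m\<le>k. of_nat (Stirling k m) *
       (\<Sum>j\<le>m. of_nat ((m choose j) * fact j * (N choose Suc j)) * sgf_taylor \<rho> (of_real q) N m j)) / of_nat N ^ Suc k)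
    (signatures N)"
proof -
  have fm: "((\<lambda>l. complex_of_real (pmf \<rho> l) * pp_factorial_moment (of_real q) m N l) has_sum
     (\<Sum>j\<le>m. of_nat ((m choose j) * fact j * (N choose Suc j)) * sgf_taylor \<rho> (of_real q) N m j)) (signatures N)"
    if m: "m \<le> k" for m
  proof -
    let ?b = "\<lambda>j. of_nat ((m choose j) * fact j * (N choose Suc j)) :: complex"
    let ?T = "\<lambda>l j. diag_taylor (of_nat m - of_real q) (m - j) j (\<lambda>z e. schur N l (root_point j z e))"
    have "((\<lambda>l. \<Sum>j\<le>m. ?b j * (complex_of_real (pmf \<rho> l) / schur N l ones * ?T l j)) has_sum
       (\<Sum>j\<le>m. ?b j * sgf_taylor \<rho> (of_real q) N m j)) (signatures N)"
      unfolding sgf_taylor_def using m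
      by (intro has_sum_finite_sum has_sum_cmult_right has_sum_diag_taylor_sgf[OF d k _ nz]) auto
    moreover have "(\<Sum>j\<le>m. ?b j * (complex_of_real (pmf \<rho> l) / schur N l ones * ?T l j)) =
       complex_of_real (pmf \<rho> l) * pp_factorial_moment (of_real q) m N l" if "l \<in> signatures N" for l
    proof -
      have "(\<Sum>j\<le>m. ?b j * (complex_of_real (pmf \<rho> l) / schur N l ones * ?T l j)) =
         complex_of_real (pmf \<rho> l) / schur N l ones * (\<Sum>j\<le>m. ?b j * ?T l j)"
        unfolding sum_distrib_left by (simp only: mult_ac)
      also have "\<dots> = complex_of_real (pmf \<rho> l) * pp_factorial_moment (of_real q) m N l"
        unfolding diag_taylor_schur[OF that] using schur_ones_nz[OF that] by simp
      finally show ?thesis .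
    qed
    ultimately show ?thesis by (simp cong: has_sum_cong)
  qed
  have "((\<lambda>l. (\<Sum>m\<le>k. of_nat (Stirling k m) * (complex_of_real (pmf \<rho> l) * pp_factorial_moment (of_real q) m N l)) *
     inverse (of_nat N ^ Suc k)) has_sum
    (\<Sum>m\<le>k. of_nat (Stirling k m) *
       (\<Sum>j\<le>m. of_nat ((m choose j) * fact j * (N choose Suc j)) * sgf_taylor \<rho> (of_real q) N m j)) *
     inverse (of_nat N ^ Suc k)) (signatures N)"
    by (intro has_sum_cmult_left has_sum_finite_sum has_sum_cmult_right fm) auto
  moreover have "(\<Sum>m\<le>k. of_nat (Stirling k m) * (complex_of_real (pmf \<rho> l) * pp_factorial_moment (of_real q) m N l)) *
     inverse (of_nat N ^ Suc k) = complex_of_real (pmf \<rho> l * pp_moment q N l k)" for l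
    unfolding of_real_mult pp_moment_eq divide_inverse sum_distrib_right sum_distrib_left by (simp only: mult_ac)
  ultimately show ?thesis by (simp only: divide_inverse)
qed

text \<open>Summability of a complex family is absolute, which gives integrability together with the
  value. Outside \<open>A\<close> the probability mass is 0, so the sum extends to all
  lists.\<close>

lemma
  fixes f :: "'a \<Rightarrow> real"
  assumes hs: "((\<lambda>x. complex_of_real (pmf p x * f x)) has_sum S) A" and A: "set_pmf p \<subseteq> A"
  shows integrable_pmf_has_sum: "integrable (measure_pmf p) f"
    and expectation_pmf_has_sum: "complex_of_real (measure_pmf.expectation p f) = S"
proof -
  have hs': "((\<lambda>x. complex_of_real (pmf p x * f x)) has_sum S) UNIV"
    by (rule iffD1[OF has_sum_cong_neutral hs]) (use A in \<open>auto simp: set_pmf_iff\<close>)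
  then have "(\<lambda>x. complex_of_real (pmf p x * f x)) summable_on UNIV"
    by (rule has_sum_imp_summable)
  then have abs': "Infinite_Sum.abs_summable_on (\<lambda>x. pmf p x * f x) UNIV"
    unfolding summable_on_iff_abs_summable_on_complex norm_of_real real_norm_def .
  then have abs: "Infinite_Set_Sum.abs_summable_on (\<lambda>x. pmf p x * f x) UNIV"
    by (simp only: abs_summable_equivalent)
  then show "integrable (measure_pmf p) f"
    unfolding measure_pmf_eq_density by (subst integrable_density) (auto simp: Infinite_Set_Sum.abs_summable_on_def)
  have "measure_pmf.expectation p f = infsetsum (\<lambda>x. pmf p x * f x) UNIV"
    unfolding infsetsum_def measure_pmf_eq_density by (subst integral_density) simp_all
  also have "\<dots> = infsum (\<lambda>x. pmf p x * f x) UNIV"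
    by (rule infsetsum_infsum[OF abs])
  finally have "complex_of_real (measure_pmf.expectation p f) = complex_of_real (infsum (\<lambda>x. pmf p x * f x) UNIV)"
    by simp
  also have "\<dots> = S"
  proof -
    have "((\<lambda>x. pmf p x * f x) has_sum infsum (\<lambda>x. pmf p x * f x) UNIV) UNIV"
      by (rule has_sum_infsum[OF abs_summable_summable[OF abs']])
    from has_sum_bounded_linear[OF bounded_linear_of_real this] show ?thesis
      by (rule has_sum_unique[OF _ hs'])
  qed
  finally show "complex_of_real (measure_pmf.expectation p f) = S" .
qed

section \<open>Asymptotics of the logarithmic derivative\<close>

lemma bounded_image_mult:
  fixes f g :: "'a \<Rightarrow> complex"
  assumes "bounded (f ` A)" "bounded (g ` A)"
  shows "bounded ((\<lambda>z. f z * g z) ` A)"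
proof -
  obtain b c where bc: "\<And>z. z \<in> A \<Longrightarrow> cmod (f z) \<le> b" "\<And>z. z \<in> A \<Longrightarrow> cmod (g z) \<le> c"
    using assms unfolding bounded_iff by auto
  have "cmod (f z * g z) \<le> b * c" if "z \<in> A" for z
    unfolding norm_mult using bc[OF that] by (intro mult_mono) (auto intro: order_trans[OF norm_ge_zero])
  then show ?thesis unfolding bounded_iff by auto
qed

text \<open>Put \<open>E r = P^(r) / P\<close>, so that
  \<open>E (r + 1) = (E r)' + E r * P' / P\<close>. For \<open>U r = n (E r / n^r - D^r)\<close> the
  terms of order \<open>n\<close> cancel, leaving
  \<open>U (r + 1) = (E r / n^r)' + (E r / n^r) (F + V) + D * U r\<close>. In the limit the
  derivative adds \<open>r\<close> to \<open>r choose 2\<close>, and the middle term adds one more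
  \<open>F * D^r\<close>. The disc shrinks at each step because the derivative is controlled only
  further inside.\<close>

lemma log_deriv_asymptotics:
  fixes P V :: "nat \<Rightarrow> complex \<Rightarrow> 'x \<Rightarrow> complex" and D F :: "complex \<Rightarrow> complex"
  assumes d: "d > 0"
    and hol: "\<forall>\<^sub>F n in sequentially. \<forall>x\<in>X. (\<lambda>z. P n z x) holomorphic_on ball 0 d \<and> (\<forall>z\<in>ball 0 d. P n z x \<noteq> 0)"
    and logd: "\<forall>\<^sub>F n in sequentially. \<forall>x\<in>X. \<forall>z\<in>ball 0 d.
       deriv (\<lambda>z. P n z x) z / P n z x = of_nat n * D z + F z + V n z x"
    and V: "uniform_limit (ball 0 d \<times> X) (\<lambda>n (z, x). V n z x) (\<lambda>_. 0) sequentially"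
    and D: "D holomorphic_on ball 0 d"
    and bdd: "bounded (D ` ball 0 d)" "bounded (F ` ball 0 d)" "bounded (deriv D ` ball 0 d)"
  shows "\<exists>d'>0. d' \<le> d \<and> uniform_limit (ball 0 d' \<times> X)
     (\<lambda>n (z, x). of_nat n * ((deriv ^^ r) (\<lambda>z. P n z x) z / P n z x / of_nat n ^ r - D z ^ r))
     (\<lambda>(z, x). of_nat r * F z * D z ^ (r - 1) + of_nat (r choose 2) * deriv D z * D z ^ (r - 2)) sequentially"
proof (induction r)
  case 0
  have "uniform_limit (ball 0 d \<times> X) (\<lambda>n (z, x). of_nat n * (P n z x / P n z x - 1)) (\<lambda>_. 0) sequentially"
    unfolding uniform_limit_iff
  proof (intro allI impI)
    fix \<epsilon> :: real assume "\<epsilon> > 0"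
    then show "\<forall>\<^sub>F n in sequentially. \<forall>zx\<in>ball 0 d \<times> X. dist (case zx of (z, x) \<Rightarrow> of_nat n * (P n z x / P n z x
          - 1)) 0 < \<epsilon>"
      using hol by (auto elim!: eventually_mono)
  qed
  then show ?case using d by (intro exI[of _ d]) (auto simp: case_prod_unfold binomial_eq_0)
next
  case (Suc r)
  define E where "E = (\<lambda>n r z x. (deriv ^^ r) (\<lambda>z. P n z x) z / P n z x)"
  define u where "u = (\<lambda>r z. of_nat r * F z * D z ^ (r - 1) + of_nat (r choose 2) * deriv D z * D z ^ (r - 2))"
  define U where "U = (\<lambda>n r z x. of_nat n * (E n r z x / of_nat n ^ r - D z ^ r))"
  obtain d1 where d1: "d1 > 0" "d1 \<le> d"
    and IH: "uniform_limit (ball 0 d1 \<times> X) (\<lambda>n zx. U n r (fst zx) (snd zx)) (\<lambda>zx. u r (fst zx)) sequentially"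
    using Suc unfolding U_def E_def u_def case_prod_unfold by blast
  have sub1: "ball 0 d1 \<subseteq> ball (0::complex) d" using d1 by auto
  have bpow: "bounded ((\<lambda>z. D z ^ m) ` ball 0 d)" for m
  proof (induction m)
    case 0
    have "(\<lambda>z. D z ^ 0) ` ball 0 d \<subseteq> {1}" by auto
    then show ?case by (rule bounded_subset[rotated]) auto
  qed (use bounded_image_mult bdd in auto)
  have bc: "bounded ((\<lambda>z. c) ` A)" for c :: complex and A :: "complex set"
    by (rule bounded_subset[of "{c}"]) auto
  have bu: "bounded (u r ` ball 0 d)"
    unfolding u_def by (intro bounded_plus_comp bounded_image_mult bpow bc bdd)
  have prodb: "bounded ((\<lambda>zx. f (fst zx)) ` (ball 0 d' \<times> X))" if "bounded (f ` ball 0 d)" "d' \<le> d" for f ::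
        "complex \<Rightarrow> complex" and d'
    by (rule bounded_subset[OF that(1)]) (use that(2) in auto)

  \<comment> \<open>\<open>E n r / n\<^sup>r = D\<^sup>r + U n r / n\<close>\<close>
  define e where "e = (\<lambda>n z x. E n r z x / of_nat n ^ r)"
  have e_lim: "uniform_limit (ball 0 d1 \<times> X) (\<lambda>n zx. e n (fst zx) (snd zx)) (\<lambda>zx. D (fst zx) ^ r) sequentially"
  proof -
    have "uniform_limit (ball 0 d1 \<times> X) (\<lambda>n zx. inverse (of_nat n) * U n r (fst zx) (snd zx)) (\<lambda>zx. 0 * u r (fst
          zx)) sequentially"
    proof (rule uniform_lim_mult)
      have "(\<lambda>n. inverse (of_nat n) :: complex) \<longlonglongrightarrow> 0" by (rule lim_inverse_n)
      then show "uniform_limit (ball 0 d1 \<times> X) (\<lambda>n zx. inverse (of_nat n) :: complex) (\<lambda>zx. 0) sequentially"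
        by (auto simp: uniform_limit_iff tendsto_iff elim: eventually_mono)
      show "bounded ((\<lambda>zx. 0::complex) ` (ball 0 d1 \<times> X))" by (rule bounded_subset[of "{0}"]) auto
      show "bounded ((\<lambda>zx. u r (fst zx)) ` (ball 0 d1 \<times> X))" by (rule prodb[OF bu d1(2)])
    qed (rule IH)
    then have "uniform_limit (ball 0 d1 \<times> X) (\<lambda>n zx. D (fst zx) ^ r + inverse (of_nat n) * U n r (fst zx) (snd zx))
        (\<lambda>zx. D (fst zx) ^ r + 0 * u r (fst zx)) sequentially"
      by (intro uniform_limit_add uniform_limit_const)
    moreover have "\<forall>\<^sub>F n in sequentially. \<forall>zx\<in>ball 0 d1 \<times> X.
        D (fst zx) ^ r + inverse (of_nat n) * U n r (fst zx) (snd zx) = e n (fst zx) (snd zx)"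
      using eventually_gt_at_top[of "0::nat"]
      by eventually_elim (auto simp: U_def e_def mult.assoc[symmetric])
    ultimately show ?thesis by (subst (asm) uniform_limit_cong) auto
  qed
  have e_hol: "\<forall>\<^sub>F n in sequentially. \<forall>x\<in>X. (\<lambda>z. e n z x) holomorphic_on ball 0 d"
    using hol eventually_gt_at_top[of "0::nat"]
  proof eventually_elim
    case (elim n)
    show ?case
    proof
      fix x assume "x \<in> X"
      with elim show "(\<lambda>z. e n z x) holomorphic_on ball 0 d"
        unfolding e_def E_def
        by (intro holomorphic_on_divide holomorphic_on_const holomorphic_higher_deriv[OF _ open_ball]) auto
    qed
  qed
  then have e_hol1: "\<forall>\<^sub>F n in sequentially. \<forall>x\<in>X. (\<lambda>z. e n z x) holomorphic_on ball 0 d1"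
    by eventually_elim (use sub1 holomorphic_on_subset in blast)
  define d2 where "d2 = d1 / 2"
  have d2: "d2 > 0" "d2 \<le> d1" "d2 \<le> d" using d1 by (auto simp: d2_def)
  have sub2: "ball 0 d2 \<times> X \<subseteq> ball (0::complex) d1 \<times> X" using d2 by auto
  have sub3: "ball 0 d2 \<times> X \<subseteq> ball (0::complex) d \<times> X" using d2 by auto
  have de_lim: "uniform_limit (ball 0 d2 \<times> X) (\<lambda>n zx. deriv (\<lambda>z. e n z (snd zx)) (fst zx))
      (\<lambda>zx. of_nat r * deriv D (fst zx) * D (fst zx) ^ (r - 1)) sequentially"
  proof -
    have "uniform_limit (ball 0 d2 \<times> X) (\<lambda>n (z, x). (deriv ^^ 1) (\<lambda>z. e n z x) z)
      (\<lambda>(z, x). (deriv ^^ 1) (\<lambda>z. D z ^ r) z) sequentially"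
      unfolding d2_def
      by (rule uniform_limit_higher_deriv[OF _ e_hol1 _ d1(1)]) (use e_lim in \<open>auto simp: case_prod_unfold\<close>)
    moreover have "deriv (\<lambda>z. D z ^ r) z = of_nat r * deriv D z * D z ^ (r - 1)" if "z \<in> ball 0 d2" for z
    proof -
      have "(D has_field_derivative deriv D z) (at z)"
        using D that d2 by (intro holomorphic_derivI[OF D open_ball]) auto
      then show ?thesis by (intro DERIV_imp_deriv) (auto intro!: derivative_eq_intros)
    qed
    ultimately show ?thesis
      by (subst (asm) uniform_limit_cong[where g = "\<lambda>n zx. deriv (\<lambda>z. e n z (snd zx)) (fst zx)"
          and i = "\<lambda>zx. of_nat r * deriv D (fst zx) * D (fst zx) ^ (r - 1)"]) (auto simp: case_prod_unfold)
  qed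
  have Vl: "uniform_limit (ball 0 d2 \<times> X) (\<lambda>n zx. V n (fst zx) (snd zx)) (\<lambda>_. 0) sequentially"
    using uniform_limit_on_subset[OF V sub3] by (simp add: case_prod_unfold)
  have "uniform_limit (ball 0 d2 \<times> X)
     (\<lambda>n zx. deriv (\<lambda>z. e n z (snd zx)) (fst zx) + e n (fst zx) (snd zx) * (F (fst zx) + V n (fst zx) (snd zx)) +
        D (fst zx) * U n r (fst zx) (snd zx))
     (\<lambda>zx. of_nat r * deriv D (fst zx) * D (fst zx) ^ (r - 1) + D (fst zx) ^ r * (F (fst zx) + 0) + D (fst zx) *
           u r (fst zx))
     sequentially"
    by (intro uniform_limit_add de_lim uniform_lim_mult uniform_limit_const Vl
        uniform_limit_on_subset[OF e_lim sub2] uniform_limit_on_subset[OF IH sub2] prodb[OF _ d2(3)] bpow bdd bu)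
       (simp_all add: prodb[OF _ d2(3)] bdd)
  moreover have "\<forall>\<^sub>F n in sequentially. \<forall>zx\<in>ball 0 d2 \<times> X.
      deriv (\<lambda>z. e n z (snd zx)) (fst zx) + e n (fst zx) (snd zx) * (F (fst zx) + V n (fst zx) (snd zx)) +
        D (fst zx) * U n r (fst zx) (snd zx) = U n (Suc r) (fst zx) (snd zx)"
    using hol logd eventually_gt_at_top[of "0::nat"]
  proof eventually_elim
    case (elim n)
    show ?case
    proof
      fix zx assume "zx \<in> ball (0::complex) d2 \<times> X"
      then obtain z x where zx: "zx = (z, x)" and z: "z \<in> ball 0 d2" and x: "x \<in> X" by auto
      then have z': "z \<in> ball 0 d" using d2 by auto
      define p where "p = (\<lambda>z. P n z x)"
      have p: "p holomorphic_on ball 0 d" and p0: "p z \<noteq> 0" using elim(1) x z' by (auto simp: p_def)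
      have n: "of_nat n \<noteq> (0::complex)" using elim(3) by simp
      have "deriv p z / p z = of_nat n * D z + F z + V n z x" using elim(2) x z' by (simp add: p_def)
      then have dp: "deriv p z = (of_nat n * D z + F z + V n z x) * p z" using p0 by (simp add: field_simps)
      have "((deriv ^^ r) p has_field_derivative (deriv ^^ Suc r) p z) (at z)"
        using holomorphic_derivI[OF holomorphic_higher_deriv[OF p open_ball] open_ball z', of r] by simp
      moreover have "(p has_field_derivative deriv p z) (at z)"
        by (rule holomorphic_derivI[OF p open_ball z'])
      ultimately have "((\<lambda>z. (deriv ^^ r) p z / p z / of_nat n ^ r) has_field_derivative
          ((deriv ^^ Suc r) p z * p z - (deriv ^^ r) p z * deriv p z) / (p z * p z) / of_nat n ^ r) (at z)"
        using p0 by (intro DERIV_cdivide DERIV_divide) auto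
      then have "deriv (\<lambda>z. e n z x) z = ((deriv ^^ Suc r) p z * p z - (deriv ^^ r) p z * deriv p z) / (p z * p
            z) / of_nat n ^ r"
        unfolding e_def E_def p_def by (rule DERIV_imp_deriv)
      also have "\<dots> = ((deriv ^^ Suc r) p z / p z - (deriv ^^ r) p z / p z * (of_nat n * D z + F z + V n z x)) /
            of_nat n ^ r"
      proof -
        have "(a * c - b * (g * c)) / (c * c) = a / c - b / c * g" if "c \<noteq> 0" for a b c g :: complex
          using that by (simp add: diff_divide_distrib)
        then show ?thesis unfolding dp by (simp only: p0 not_False_eq_True)
      qed
      finally have de: "deriv (\<lambda>z. e n z x) z =
         (E n (Suc r) z x - E n r z x * (of_nat n * D z + F z + V n z x)) / of_nat n ^ r"
        unfolding E_def p_def .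
      have alg: "(E' - E'' * (N * d + f + v)) / M + E'' / M * (f + v) + d * (N * (E'' / M - t)) = N * (E' / (N *
            M) - d * t)"
        if "N \<noteq> 0" "M \<noteq> 0" for E' E'' N d f v M t :: complex
        using that by (simp add: divide_simps) (simp add: algebra_simps)
      show "deriv (\<lambda>z. e n z (snd zx)) (fst zx) + e n (fst zx) (snd zx) * (F (fst zx) + V n (fst zx) (snd zx)) +
        D (fst zx) * U n r (fst zx) (snd zx) = U n (Suc r) (fst zx) (snd zx)"
        unfolding zx fst_conv snd_conv de unfolding U_def e_def power_Suc using n by (intro alg) auto
    qed
  qed
  moreover have "of_nat r * deriv D z * D z ^ (r - 1) + D z ^ r * (F z + 0) + D z * u r z = u (Suc r) z" for z
  proof -
    have a1: "D z * (of_nat r * F z * D z ^ (r - 1)) = of_nat r * F z * D z ^ r"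
      by (cases r) auto
    have a2: "D z * (of_nat (r choose 2) * deriv D z * D z ^ (r - 2)) = of_nat (r choose 2) * deriv D z * D z ^ (r - 1)"
    proof (cases "r < 2")
      case True
      then show ?thesis by (simp add: binomial_eq_0)
    next
      case False
      then have "r - 1 = Suc (r - 2)" by simp
      then show ?thesis by simp
    qed
    have a3: "Suc r choose 2 = r + (r choose 2)" by (simp add: numeral_2_eq_2)
    have a4: "Suc r - 1 = r" "Suc r - 2 = r - 1" by auto
    show ?thesis unfolding u_def distrib_left a1 a2 a3 a4 by (simp add: algebra_simps)
  qed
  ultimately have "uniform_limit (ball 0 d2 \<times> X) (\<lambda>n zx. U n (Suc r) (fst zx) (snd zx)) (\<lambda>zx. u (Suc r) (fst
        zx)) sequentially"
    by (subst (asm) uniform_limit_cong) auto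
  then show ?case
    using d2 unfolding U_def u_def E_def by (intro exI[of _ d2]) (auto simp: case_prod_unfold)
qed

lemma uniform_limit_exp_0:
  fixes R :: "'n \<Rightarrow> 'x \<Rightarrow> complex"
  assumes "uniform_limit X R (\<lambda>_. 0) F"
  shows "uniform_limit X (\<lambda>n x. exp (R n x)) (\<lambda>_. 1) F"
  unfolding uniform_limit_iff
proof (intro allI impI)
  fix \<epsilon> :: real assume \<epsilon>: "\<epsilon> > 0"
  have "isCont (exp :: complex \<Rightarrow> complex) 0" by simp
  then obtain \<eta> where \<eta>: "\<eta> > 0" "\<And>w :: complex. dist w 0 < \<eta> \<Longrightarrow> dist (exp w) (exp 0) < \<epsilon>"
    using \<epsilon> unfolding continuous_at_eps_delta by blast
  have "\<forall>\<^sub>F n in F. \<forall>x\<in>X. dist (R n x) 0 < \<eta>"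
    using assms \<eta>(1) unfolding uniform_limit_iff by blast
  then show "\<forall>\<^sub>F n in F. \<forall>x\<in>X. dist (exp (R n x)) 1 < \<epsilon>"
    by eventually_elim (use \<eta>(2) in simp)
qed

lemma bounded_image_ball:
  fixes f :: "complex \<Rightarrow> complex"
  assumes "f holomorphic_on ball 0 d'" "d < d'"
  shows "bounded (f ` ball 0 d)"
proof -
  have "cball 0 d \<subseteq> ball (0::complex) d'" using assms by auto
  then have "continuous_on (cball 0 d) f"
    using assms(1) holomorphic_on_imp_continuous_on continuous_on_subset by blast
  then have "bounded (f ` cball 0 d)" by (intro compact_imp_bounded compact_continuous_image) auto
  then show ?thesis by (rule bounded_subset) auto
qed

text \<open>\<open>B n e\<close> is the contribution of the other coordinates and may be of order
  \<open>n\<close>; being free of \<open>z\<close>, it drops out of the logarithmic derivative. The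
  diagonal \<open>P n e e\<close> is rotation invariant with value 1 at 0, so dividing by it leaves
  the coefficient of order \<open>j\<close> unchanged.\<close>

lemma diag_taylor_asymptotics:
  fixes P R :: "nat \<Rightarrow> complex \<Rightarrow> complex \<Rightarrow> complex"
  assumes d: "0 < d" "d \<le> 1" "d < d'"
    and dh: "\<forall>\<^sub>F n in sequentially. diag_hol d (P n)"
    and rot: "\<forall>\<^sub>F n in sequentially. \<forall>e\<in>ball 0 d. P n (unity_root j * e) (unity_root j * e) = P n e e"
    and one: "\<forall>\<^sub>F n in sequentially. P n 0 0 = 1"
    and fac: "\<forall>\<^sub>F n in sequentially. \<forall>z\<in>ball 0 d. \<forall>e\<in>ball 0 d.
       P n z e = exp (of_nat n * \<psi> z + \<phi> z + B n e + R n z e)"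
    and R: "uniform_limit (ball 0 d \<times> ball 0 d) (\<lambda>n (z, e). R n z e) (\<lambda>_. 0) sequentially"
    and hol: "\<psi> holomorphic_on ball 0 d'" "\<phi> holomorphic_on ball 0 d'"
  shows "(\<lambda>n. of_nat n * (diag_taylor a r j (P n) / of_nat n ^ r -
            (deriv ^^ j) (\<lambda>e. (1 + e) powr a * deriv \<psi> e ^ r) 0 / fact j)) \<longlonglongrightarrow>
     (deriv ^^ j) (\<lambda>e. (1 + e) powr a * (of_nat r * deriv \<phi> e * deriv \<psi> e ^ (r - 1) +
         of_nat (r choose 2) * deriv (deriv \<psi>) e * deriv \<psi> e ^ (r - 2))) 0 / fact j"
proof -
  \<comment> \<open>The error factor: it tends to 1 uniformly, hence by Cauchy estimates its
    logarithmic derivative \<open>V\<close> tends to 0.\<close>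
  define Q where "Q = (\<lambda>n z e. exp (R n z e))"
  have sub: "ball 0 d \<subseteq> ball (0::complex) d'" using d by auto
  have hold: "deriv \<psi> holomorphic_on ball 0 d'" "deriv \<phi> holomorphic_on ball 0 d'"
    "deriv (deriv \<psi>) holomorphic_on ball 0 d'"
    by (intro holomorphic_deriv hol open_ball)+
  have Qlim: "uniform_limit (ball 0 d \<times> ball 0 d) (\<lambda>n (z, e). Q n z e) (\<lambda>_. 1) sequentially"
    using uniform_limit_exp_0[OF R] by (simp add: Q_def case_prod_unfold)
  have Qhol: "\<forall>\<^sub>F n in sequentially. \<forall>e\<in>ball 0 d. (\<lambda>z. Q n z e) holomorphic_on ball 0 d"
    using dh fac
  proof eventually_elim
    case (elim n)
    show ?case
    proof
      fix e :: complex assume e: "e \<in> ball 0 d"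
      have "(\<lambda>z. P n z e * exp (- (of_nat n * \<psi> z + \<phi> z + B n e))) holomorphic_on ball 0 d"
        using elim(1) e hol[THEN holomorphic_on_subset, OF sub] unfolding diag_hol_def
        by (intro holomorphic_intros) auto
      then show "(\<lambda>z. Q n z e) holomorphic_on ball 0 d"
        by (rule holomorphic_transform) (use elim(2) e in \<open>auto simp: Q_def exp_add[symmetric]\<close>)
    qed
  qed
  define V where "V = (\<lambda>n z e. deriv (\<lambda>z. Q n z e) z / Q n z e)"
  define d2 where "d2 = d / 2"
  have d2: "d2 > 0" "d2 \<le> d" "d2 < d'" "d2 \<le> 1" using d by (auto simp: d2_def)
  have sub2: "ball 0 d2 \<subseteq> ball (0::complex) d" using d2 by auto
  have subp: "ball 0 d2 \<times> ball 0 d2 \<subseteq> ball (0::complex) d \<times> ball (0::complex) d" using d2 by auto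
  have Vlim: "uniform_limit (ball 0 d2 \<times> ball 0 d2) (\<lambda>n (z, e). V n z e) (\<lambda>_. 0) sequentially"
  proof -
    have Q1: "uniform_limit (ball 0 d \<times> ball 0 d) (\<lambda>n (z, e). Q n z e) (\<lambda>(z, e). 1) sequentially"
      using Qlim by (simp add: case_prod_unfold)
    have "uniform_limit (ball 0 d2 \<times> ball 0 d) (\<lambda>n (z, e). (deriv ^^ 1) (\<lambda>z. Q n z e) z)
       (\<lambda>(z, e). (deriv ^^ 1) (\<lambda>z. 1) z) sequentially"
      unfolding d2_def by (rule uniform_limit_higher_deriv[OF Q1 Qhol _ d(1)]) simp
    then have "uniform_limit (ball 0 d2 \<times> ball 0 d) (\<lambda>n (z, e). deriv (\<lambda>z. Q n z e) z) (\<lambda>_. 0) sequentially"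
      by (simp add: case_prod_unfold)
    then have 1: "uniform_limit (ball 0 d2 \<times> ball 0 d2) (\<lambda>n (z, e). deriv (\<lambda>z. Q n z e) z) (\<lambda>_. 0) sequentially"
      by (rule uniform_limit_on_subset) (use sub2 in blast)
    have 2: "uniform_limit (ball 0 d2 \<times> ball 0 d2) (\<lambda>n (z, e). Q n z e) (\<lambda>_. 1) sequentially"
      by (rule uniform_limit_on_subset[OF Qlim subp])
    have "uniform_limit (ball 0 d2 \<times> ball 0 d2) (\<lambda>n ze. (case ze of (z, e) \<Rightarrow> deriv (\<lambda>z. Q n z e) z) / (case ze
          of (z, e) \<Rightarrow> Q n z e))
        (\<lambda>_. 0 / 1) sequentially"
    proof (rule uniform_lim_divide[OF 1 2])
      show "bounded ((\<lambda>_. 0::complex) ` (ball (0::complex) d2 \<times> ball (0::complex) d2))"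
        by (rule bounded_subset[of "{0}"]) auto
    qed (rule order_refl, simp)
    then show ?thesis by (simp add: V_def case_prod_unfold)
  qed
  have logd: "\<forall>\<^sub>F n in sequentially. \<forall>e\<in>ball 0 d2. \<forall>z\<in>ball 0 d2.
      deriv (\<lambda>z. P n z e) z / P n z e = of_nat n * deriv \<psi> z + deriv \<phi> z + V n z e"
    using fac Qhol
  proof eventually_elim
    case (elim n)
    show ?case
    proof (intro ballI)
      fix e z :: complex assume "e \<in> ball 0 d2" "z \<in> ball 0 d2"
      then have e: "e \<in> ball 0 d" and z: "z \<in> ball 0 d" using sub2 by auto
      define g where "g = (\<lambda>z. exp (of_nat n * \<psi> z + \<phi> z + B n e))"
      have PQ: "P n z e = g z * Q n z e" if "z \<in> ball 0 d" for z
        using elim(1) e that by (simp add: g_def Q_def exp_add)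
      have d\<psi>: "(\<psi> has_field_derivative deriv \<psi> z) (at z)" "(\<phi> has_field_derivative deriv \<phi> z) (at z)"
        using z sub by (auto intro!: holomorphic_derivI[OF hol(1) open_ball] holomorphic_derivI[OF hol(2) open_ball])
      have dQ: "((\<lambda>z. Q n z e) has_field_derivative deriv (\<lambda>z. Q n z e) z) (at z)"
        using elim(2) e z by (intro holomorphic_derivI[OF _ open_ball]) auto
      have dg: "(g has_field_derivative (of_nat n * deriv \<psi> z + deriv \<phi> z) * g z) (at z)"
        unfolding g_def using d\<psi> by (auto intro!: derivative_eq_intros)
      have "((\<lambda>z. g z * Q n z e) has_field_derivative
         (of_nat n * deriv \<psi> z + deriv \<phi> z) * g z * Q n z e + deriv (\<lambda>z. Q n z e) z * g z) (at z)"
        by (rule DERIV_mult[OF dg dQ])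
      then have "((\<lambda>z. P n z e) has_field_derivative
         (of_nat n * deriv \<psi> z + deriv \<phi> z) * g z * Q n z e + deriv (\<lambda>z. Q n z e) z * g z) (at z)"
        by (rule has_field_derivative_transform_within_open[OF _ open_ball z]) (simp add: PQ)
      then have "deriv (\<lambda>z. P n z e) z = (of_nat n * deriv \<psi> z + deriv \<phi> z) * g z * Q n z e + deriv (\<lambda>z. Q n z e) z * g z"
        by (rule DERIV_imp_deriv)
      moreover have "g z \<noteq> 0" "Q n z e \<noteq> 0" by (auto simp: g_def Q_def)
      ultimately show "deriv (\<lambda>z. P n z e) z / P n z e = of_nat n * deriv \<psi> z + deriv \<phi> z + V n z e"
        unfolding PQ[OF z] V_def by (simp add: add_divide_distrib)
    qed
  qed
  have Pnz: "\<forall>\<^sub>F n in sequentially. \<forall>e\<in>ball 0 d2. (\<lambda>z. P n z e) holomorphic_on ball 0 d2 \<and> (\<forall>z\<in>ball 0 d2. P n z e \<noteq> 0)"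
    using dh fac
  proof eventually_elim
    case (elim n)
    show ?case
    proof
      fix e :: complex assume "e \<in> ball 0 d2"
      then have e: "e \<in> ball 0 d" using sub2 by auto
      then have "(\<lambda>z. P n z e) holomorphic_on ball 0 d2"
        using elim(1) sub2 holomorphic_on_subset unfolding diag_hol_def by blast
      moreover have "P n z e \<noteq> 0" if "z \<in> ball 0 d2" for z
      proof -
        have "z \<in> ball 0 d" using that sub2 by auto
        then show ?thesis using elim(2) e by simp
      qed
      ultimately show "(\<lambda>z. P n z e) holomorphic_on ball 0 d2 \<and> (\<forall>z\<in>ball 0 d2. P n z e \<noteq> 0)" by blast
    qed
  qed
  let ?u = "\<lambda>e. of_nat r * deriv \<phi> e * deriv \<psi> e ^ (r - 1) + of_nat (r choose 2) * deriv (deriv \<psi>) e * deriv \<psi> e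
        ^ (r - 2)"
  define E where "E = (\<lambda>n e. (deriv ^^ r) (\<lambda>z. P n z e) e / P n e e)"
  have sub2': "ball 0 d2 \<subseteq> ball (0::complex) d'" using sub sub2 by blast
  obtain \<delta> where \<delta>: "\<delta> > 0" "\<delta> \<le> d2" and ul:
    "uniform_limit (ball 0 \<delta> \<times> ball 0 d2)
     (\<lambda>n (z, e). of_nat n * ((deriv ^^ r) (\<lambda>z. P n z e) z / P n z e / of_nat n ^ r - deriv \<psi> z ^ r))
     (\<lambda>(z, e). ?u z) sequentially"
    using log_deriv_asymptotics[OF d2(1) Pnz logd Vlim holomorphic_on_subset[OF hold(1) sub2']
        bounded_image_ball[OF hold(1) d2(3)] bounded_image_ball[OF hold(2) d2(3)] bounded_image_ball[OF hold(3)
              d2(3)], of r]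
    by blast
  have sub\<delta>: "ball 0 \<delta> \<subseteq> ball (0::complex) d" "ball 0 \<delta> \<subseteq> ball (0::complex) d'" using \<delta> d2 d by auto
  have ulE: "uniform_limit (ball 0 \<delta>) (\<lambda>n e. of_nat n * (E n e / of_nat n ^ r - deriv \<psi> e ^ r)) ?u sequentially"
    using ul \<delta>(2) unfolding uniform_limit_iff E_def by (fastforce elim: eventually_mono)
  have holE: "\<forall>\<^sub>F n in sequentially. E n holomorphic_on ball 0 \<delta> \<and> (\<lambda>e. P n e e) holomorphic_on ball 0 \<delta>"
    using dh fac
  proof eventually_elim
    case (elim n)
    have 1: "(\<lambda>e. (deriv ^^ r) (\<lambda>z. P n z e) e) holomorphic_on ball 0 d" for r
      using elim(1) by (auto simp: diag_hol_def)
    have 2: "(\<lambda>e. P n e e) holomorphic_on ball 0 d" using 1[of 0] by simp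
    have "E n holomorphic_on ball 0 d"
      unfolding E_def by (rule holomorphic_on_divide[OF 1 2]) (use elim(2) in auto)
    then show ?case using 2 sub\<delta> holomorphic_on_subset by blast
  qed
  have hp: "(\<lambda>e. (1 + e) powr a) holomorphic_on ball 0 \<delta>"
    using \<delta> d2 by (intro holomorphic_on_one_plus_powr) auto
  have hD: "(\<lambda>e. deriv \<psi> e ^ r) holomorphic_on ball 0 \<delta>"
    by (intro holomorphic_intros holomorphic_on_subset[OF hold(1) sub\<delta>(2)])
  have "(\<lambda>n. (deriv ^^ j) (\<lambda>e. (1 + e) powr a * (of_nat n * (E n e / of_nat n ^ r - deriv \<psi> e ^ r))) 0) \<longlonglongrightarrow>
      (deriv ^^ j) (\<lambda>e. (1 + e) powr a * ?u e) 0"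
  proof (rule tendsto_higher_deriv_mult[OF ulE _ _ _ _ hp])
    show "\<forall>\<^sub>F n in sequentially. (\<lambda>e. of_nat n * (E n e / of_nat n ^ r - deriv \<psi> e ^ r)) holomorphic_on ball 0 \<delta>"
      using holE eventually_gt_at_top[of "0::nat"]
      by eventually_elim (auto intro!: holomorphic_intros holomorphic_on_subset[OF hold(1) sub\<delta>(2)])
  qed (use \<delta> in auto)
  then have "(\<lambda>n. (deriv ^^ j) (\<lambda>e. (1 + e) powr a * (of_nat n * (E n e / of_nat n ^ r - deriv \<psi> e ^ r))) 0 / fact j) \<longlonglongrightarrow>
      (deriv ^^ j) (\<lambda>e. (1 + e) powr a * ?u e) 0 / fact j"
    by (intro tendsto_divide tendsto_const) auto
  moreover have "\<forall>\<^sub>F n in sequentially. (deriv ^^ j) (\<lambda>e. (1 + e) powr a * (of_nat n * (E n e / of_nat n ^ r -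
        deriv \<psi> e ^ r))) 0 / fact j =
     of_nat n * (diag_taylor a r j (P n) / of_nat n ^ r - (deriv ^^ j) (\<lambda>e. (1 + e) powr a * deriv \<psi> e ^ r) 0 / fact j)"
    using holE fac rot one eventually_gt_at_top[of "0::nat"]
  proof eventually_elim
    case (elim n)
    let ?h = "\<lambda>e. (1 + e) powr a"
    have hE: "(\<lambda>e. ?h e * E n e) holomorphic_on ball 0 \<delta>"
      using elim(1) by (intro holomorphic_on_mult hp) auto
    have hDh: "(\<lambda>e. ?h e * deriv \<psi> e ^ r) holomorphic_on ball 0 \<delta>" by (intro holomorphic_on_mult hp hD)
    have 0: "(0::complex) \<in> ball 0 \<delta>" using \<delta> by simp
    have "(deriv ^^ j) (\<lambda>e. ?h e * (deriv ^^ r) (\<lambda>z. P n z e) e) 0 = (deriv ^^ j) (\<lambda>e. P n e e * (?h e * E n e)) 0"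
    proof (rule higher_deriv_cong_ev)
      have "\<forall>\<^sub>F e in nhds 0. e \<in> ball (0::complex) \<delta>"
        using \<delta> by (intro eventually_nhds_in_open) auto
      then show "\<forall>\<^sub>F e in nhds 0. ?h e * (deriv ^^ r) (\<lambda>z. P n z e) e = P n e e * (?h e * E n e)"
      proof eventually_elim
        case e: (elim e)
        then have "P n e e \<noteq> 0" using elim(2) sub\<delta>(1) by auto
        then show ?case by (simp add: E_def)
      qed
    qed auto
    also have "\<dots> = P n 0 0 * (deriv ^^ j) (\<lambda>e. ?h e * E n e) 0"
      by (rule higher_deriv_mult_rotation_invariant[OF _ hE \<delta>(1)]) (use elim(1,3) sub\<delta>(1) in auto)
    finally have T: "diag_taylor a r j (P n) = (deriv ^^ j) (\<lambda>e. ?h e * E n e) 0 / fact j"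
      unfolding diag_taylor_def using elim(4) by simp
    have "(deriv ^^ j) (\<lambda>e. ?h e * (of_nat n * (E n e / of_nat n ^ r - deriv \<psi> e ^ r))) 0 =
       (deriv ^^ j) (\<lambda>e. (of_nat n / of_nat n ^ r) * (?h e * E n e) - of_nat n * (?h e * deriv \<psi> e ^ r)) 0"
      by (intro arg_cong[of _ _ "\<lambda>f. (deriv ^^ j) f 0"] ext) (simp add: algebra_simps)
    also have "\<dots> = (deriv ^^ j) (\<lambda>e. (of_nat n / of_nat n ^ r) * (?h e * E n e)) 0 - (deriv ^^ j) (\<lambda>e. of_nat n
          * (?h e * deriv \<psi> e ^ r)) 0"
      by (intro higher_deriv_diff[OF _ _ open_ball 0] holomorphic_on_mult[OF holomorphic_on_const] hE hDh)
    also have "\<dots> = (of_nat n / of_nat n ^ r) * (deriv ^^ j) (\<lambda>e. ?h e * E n e) 0 - of_nat n * (deriv ^^ j) (\<lambda>e.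
          ?h e * deriv \<psi> e ^ r) 0"
      by (simp only: higher_deriv_cmult[OF hE 0 open_ball] higher_deriv_cmult[OF hDh 0 open_ball])
    finally show ?case unfolding T by (simp add: diff_divide_distrib right_diff_distrib)
  qed
  ultimately show ?thesis by (rule Lim_transform_eventually)
qed

lemma higher_deriv_shift: "(deriv ^^ j) (\<lambda>z. f (1 + z)) z = (deriv ^^ j) f (1 + z)" for f :: "complex \<Rightarrow> complex"
proof (induction j arbitrary: z)
  case (Suc j)
  have "(deriv ^^ j) (\<lambda>z. f (1 + z)) = (\<lambda>z. (deriv ^^ j) f (1 + z))" using Suc by auto
  moreover have "deriv (\<lambda>z. g (1 + z)) z = deriv g (1 + z)" for g :: "complex \<Rightarrow> complex"
    unfolding deriv_def using DERIV_shift[of g _ z 1] by (simp add: add.commute)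
  ultimately show ?case by simp
qed simp

text \<open>With \<open>f\<close> and \<open>g\<close> the derivatives of \<open>\<Psi>\<close> and
  \<open>\<Phi>\<close>, this and \<open>pp_correction\<close> are \<open>j!\<close> times the
  constant term and the \<open>1 / N\<close> coefficient of \<open>sgf_taylor\<close> divided by
  \<open>N^(m - j)\<close>.\<close>

definition pp_leading :: "complex \<Rightarrow> (complex \<Rightarrow> complex) \<Rightarrow> nat \<Rightarrow> nat \<Rightarrow> complex" where
  "pp_leading q f m j = (deriv ^^ j) (\<lambda>u. u powr (of_nat m - q) * f u ^ (m - j)) 1"

definition pp_correction :: "complex \<Rightarrow> (complex \<Rightarrow> complex) \<Rightarrow> (complex \<Rightarrow> complex) \<Rightarrow> nat \<Rightarrow> nat \<Rightarrow> complex" where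
  "pp_correction q f g m j = (deriv ^^ j) (\<lambda>u. u powr (of_nat m - q) * (of_nat (m - j) * g u * f u ^ (m - j - 1) +
         of_nat ((m - j) choose 2) * deriv f u * f u ^ (m - j - 2))) 1"

lemma sgf_taylor_asymptotics:
  fixes \<rho> :: "nat \<Rightarrow> int list pmf" and \<Psi> \<Phi> :: "complex \<Rightarrow> complex"
  assumes an: "\<Psi> analytic_on {1}" "\<Phi> analytic_on {1}" and \<epsilon>: "\<epsilon> > 0"
    and L: "\<forall>\<^sub>F N in sequentially. L N ones = 0 \<and>
        (\<forall>u\<in>polydisc (Suc k) \<epsilon>. exp (L N u) = sgf (\<rho> N) N (pad_ones (Suc k) u))"
    and ul: "uniform_limit (polydisc (Suc k) \<epsilon>)
       (\<lambda>N u. of_nat N * (L N u / of_nat N - (\<Sum>i<Suc k. \<Psi> (u i)))) (\<lambda>u. \<Sum>i<Suc k. \<Phi> (u i)) sequentially"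
  obtains \<delta> where "0 < \<delta>" "\<delta> < 1"
    "\<forall>\<^sub>F N in sequentially. \<forall>X\<subseteq>{..<Suc k}. sgf (\<rho> N) N (corner \<delta> (Suc k) X) \<noteq> 0"
    "\<And>j m q. j \<le> m \<Longrightarrow> m \<le> k \<Longrightarrow>
      (\<lambda>N. of_nat N * (sgf_taylor (\<rho> N) q N m j / of_nat N ^ (m - j) -
         pp_leading q (deriv \<Psi>) m j / fact j)) \<longlonglongrightarrow>
      pp_correction q (deriv \<Psi>) (deriv \<Phi>) m j / fact j"
proof -
  obtain \<eta>1 \<eta>2 where \<eta>12: "\<eta>1 > 0" "\<Psi> holomorphic_on ball 1 \<eta>1" "\<eta>2 > 0" "\<Phi> holomorphic_on ball 1 \<eta>2"
    using an unfolding analytic_at_ball by blast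
  define \<eta> where "\<eta> = min \<eta>1 \<eta>2"
  have \<eta>: "\<eta> > 0" "\<Psi> holomorphic_on ball 1 \<eta>" "\<Phi> holomorphic_on ball 1 \<eta>"
    using \<eta>12 by (auto simp: \<eta>_def intro: holomorphic_on_subset)
  define \<delta> where "\<delta> = min (min \<epsilon> 1) \<eta> / 2"
  have \<delta>: "0 < \<delta>" "\<delta> < 1" "\<delta> < \<epsilon>" "\<delta> < \<eta>" using \<epsilon> \<eta> by (auto simp: \<delta>_def)
  \<comment> \<open>The generating function is an exponential on the whole polydisc, so it vanishes
    at no corner; this nonvanishing is the source of convergence of the series on a fixed
    disc.\<close>
  have nz: "\<forall>\<^sub>F N in sequentially. \<forall>X\<subseteq>{..<Suc k}. sgf (\<rho> N) N (corner \<delta> (Suc k) X) \<noteq> 0"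
    using L
  proof eventually_elim
    case (elim N)
    show ?case
    proof safe
      fix X assume "sgf (\<rho> N) N (corner \<delta> (Suc k) X) = 0"
      moreover have "corner \<delta> (Suc k) X \<in> polydisc (Suc k) \<epsilon>"
        using \<delta> by (auto simp: polydisc_def corner_def)
      moreover have "pad_ones (Suc k) (corner \<delta> (Suc k) X) = corner \<delta> (Suc k) X"
        by (auto simp: pad_ones_def corner_def)
      ultimately show False using elim by (metis exp_not_eq_zero)
    qed
  qed
  \<comment> \<open>\<open>diag_hol_sgf\<close> yields holomorphy on half the corner radius.\<close>
  define d where "d = \<delta> / 2"
  have d: "0 < d" "d \<le> 1" "d < \<eta>" "d < \<delta>" "d < \<epsilon>" using \<delta> by (auto simp: d_def)
  have sh: "(\<lambda>z. f (1 + z)) holomorphic_on ball 0 \<eta>" if "f holomorphic_on ball 1 \<eta>" for f :: "complex \<Rightarrow> complex"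
  proof -
    have "f \<circ> (\<lambda>z. 1 + z) holomorphic_on ball 0 \<eta>"
      by (rule holomorphic_on_compose_gen[OF _ that]) (auto intro!: holomorphic_intros simp: dist_norm)
    then show ?thesis by (simp add: o_def)
  qed
  show ?thesis
  proof (rule that[OF \<delta>(1,2) nz])
    fix j m :: nat and q :: complex assume jm: "j \<le> m" "m \<le> k"
    define r where "r = m - j"
    define a where "a = of_nat m - q"
    define P where "P = (\<lambda>N z e. sgf (\<rho> N) N (root_point j z e))"
    define R where "R = (\<lambda>N z e. L N (root_point j z e) -
       of_nat N * (\<Sum>i<Suc k. \<Psi> (root_point j z e i)) - (\<Sum>i<Suc k. \<Phi> (root_point j z e i)))"
    define B where "B = (\<lambda>N e. of_nat N * (\<Sum>i<k. \<Psi> (root_point j 0 e (Suc i))) + (\<Sum>i<k. \<Phi> (root_point j 0 e (Suc i))))"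
    have ptd: "root_point j z e \<in> polydisc (Suc k) \<epsilon>" "pad_ones (Suc k) (root_point j z e) = root_point j z e"
      if "z \<in> ball 0 d" "e \<in> ball 0 d" for z e
    proof -
      have "root_point j z e \<in> pad_disc (Suc k) d"
        using that jm by (intro root_point_in_pad_disc) auto
      then show "root_point j z e \<in> polydisc (Suc k) \<epsilon>" "pad_ones (Suc k) (root_point j z e) = root_point j z e"
        using d by (fastforce simp: pad_disc_def polydisc_def pad_ones_def)+
    qed
    have split: "(\<Sum>i<Suc k. f (root_point j z e i)) = f (1 + z) + (\<Sum>i<k. f (root_point j 0 e (Suc i)))"
      for f :: "complex \<Rightarrow> complex" and z e
      unfolding sum.lessThan_Suc_shift by (simp add: root_point_def)
    have "(\<lambda>N. of_nat N * (diag_taylor a r j (P N) / of_nat N ^ r -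
            (deriv ^^ j) (\<lambda>e. (1 + e) powr a * deriv (\<lambda>z. \<Psi> (1 + z)) e ^ r) 0 / fact j)) \<longlonglongrightarrow>
     (deriv ^^ j) (\<lambda>e. (1 + e) powr a * (of_nat r * deriv (\<lambda>z. \<Phi> (1 + z)) e * deriv (\<lambda>z. \<Psi> (1 + z)) e ^ (r - 1) +
         of_nat (r choose 2) * deriv (deriv (\<lambda>z. \<Psi> (1 + z))) e * deriv (\<lambda>z. \<Psi> (1 + z)) e ^ (r - 2))) 0 / fact j"
    proof (rule diag_taylor_asymptotics[OF d(1-3), where B = B and R = R])
      show "(\<lambda>z. \<Psi> (1 + z)) holomorphic_on ball 0 \<eta>" "(\<lambda>z. \<Phi> (1 + z)) holomorphic_on ball 0 \<eta>"
        by (intro sh \<eta>)+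
      show "\<forall>\<^sub>F N in sequentially. diag_hol d (P N)"
        using nz eventually_gt_at_top[of k]
      proof eventually_elim
        case (elim N)
        show ?case unfolding P_def d_def
          by (rule diag_hol_sgf[OF \<delta>(1,2) elim(2)]) (use elim jm in auto)
      qed
      show "\<forall>\<^sub>F N in sequentially. \<forall>e\<in>ball 0 d. P N (unity_root j * e) (unity_root j * e) = P N e e"
        using nz eventually_gt_at_top[of k]
      proof eventually_elim
        case (elim N)
        show ?case unfolding P_def
          by (intro ballI sgf_root_point_rotate[OF \<delta>(1,2) elim(2)]) (use elim jm d in auto)
      qed
      show "\<forall>\<^sub>F N in sequentially. P N 0 0 = 1"
        using L
      proof eventually_elim
        case (elim N)
        have "root_point j 0 0 = ones" by (auto simp: root_point_def ones_def)
        then show ?case using elim ptd[of 0 0] d unfolding P_def by (metis centre_in_ball exp_zero)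
      qed
      show "\<forall>\<^sub>F N in sequentially. \<forall>z\<in>ball 0 d. \<forall>e\<in>ball 0 d.
         P N z e = exp (of_nat N * \<Psi> (1 + z) + \<Phi> (1 + z) + B N e + R N z e)"
        using L
      proof eventually_elim
        case (elim N)
        show ?case
        proof (intro ballI)
          fix z e :: complex assume ze: "z \<in> ball 0 d" "e \<in> ball 0 d"
          have "of_nat N * \<Psi> (1 + z) + \<Phi> (1 + z) + B N e + R N z e = L N (root_point j z e)"
            unfolding R_def B_def split by (simp add: algebra_simps)
          then show "P N z e = exp (of_nat N * \<Psi> (1 + z) + \<Phi> (1 + z) + B N e + R N z e)"
            using elim ptd[OF ze] unfolding P_def by simp
        qed
      qed
      show "uniform_limit (ball 0 d \<times> ball 0 d) (\<lambda>N (z, e). R N z e) (\<lambda>_. 0) sequentially"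
        unfolding uniform_limit_iff
      proof (intro allI impI)
        fix \<epsilon>' :: real assume "\<epsilon>' > 0"
        then have "\<forall>\<^sub>F N in sequentially. \<forall>u\<in>polydisc (Suc k) \<epsilon>.
          dist (of_nat N * (L N u / of_nat N - (\<Sum>i<Suc k. \<Psi> (u i)))) (\<Sum>i<Suc k. \<Phi> (u i)) < \<epsilon>'"
          using ul unfolding uniform_limit_iff by blast
        then show "\<forall>\<^sub>F N in sequentially. \<forall>ze\<in>ball 0 d \<times> ball 0 d. dist (case ze of (z, e) \<Rightarrow> R N z e) 0 < \<epsilon>'"
          using eventually_gt_at_top[of "0::nat"]
        proof eventually_elim
          case (elim N)
          show ?case
          proof safe
            fix z e :: complex assume ze: "z \<in> ball 0 d" "e \<in> ball 0 d"
            have "R N z e = of_nat N * (L N (root_point j z e) / of_nat N - (\<Sum>i<Suc k. \<Psi> (root_point j z e i))) -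
               (\<Sum>i<Suc k. \<Phi> (root_point j z e i))"
              unfolding R_def using elim(2) by (simp add: right_diff_distrib del: sum.lessThan_Suc)
            then show "dist (R N z e) 0 < \<epsilon>'"
              using elim(1) ptd(1)[OF ze] by (simp add: dist_norm del: sum.lessThan_Suc)
          qed
        qed
      qed
    qed
    moreover have "deriv (\<lambda>z. f (1 + z)) = (\<lambda>z. deriv f (1 + z))" for f :: "complex \<Rightarrow> complex"
      using higher_deriv_shift[of 1 f] by auto
    moreover have "diag_taylor a r j (P N) = sgf_taylor (\<rho> N) q N m j" for N
      by (simp add: sgf_taylor_def P_def a_def r_def)
    ultimately show "(\<lambda>N. of_nat N * (sgf_taylor (\<rho> N) q N m j / of_nat N ^ (m - j) -
         pp_leading q (deriv \<Psi>) m j / fact j)) \<longlonglongrightarrow>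
      pp_correction q (deriv \<Psi>) (deriv \<Phi>) m j / fact j"
      using higher_deriv_shift[of j "\<lambda>u. u powr a * deriv \<Psi> u ^ r" 0]
        higher_deriv_shift[of j "\<lambda>u. u powr a * (of_nat r * deriv \<Phi> u * deriv \<Psi> u ^ (r - 1) +
         of_nat (r choose 2) * deriv (deriv \<Psi>) u * deriv \<Psi> u ^ (r - 2))" 0]
      by (simp add: a_def r_def pp_leading_def pp_correction_def)
  qed
qed

section \<open>First-order expansions in \<open>1 / N\<close>\<close>

lemma tendsto_of_scaled:
  fixes x :: "nat \<Rightarrow> complex"
  assumes "(\<lambda>N. of_nat N * (x N - x0)) \<longlonglongrightarrow> x1"
  shows "x \<longlonglongrightarrow> x0"
proof -
  have "(\<lambda>N. inverse (of_nat N) * (of_nat N * (x N - x0)) + x0) \<longlonglongrightarrow> 0 * x1 + x0"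
    by (intro tendsto_add tendsto_mult tendsto_const assms lim_inverse_n)
  moreover have "\<forall>\<^sub>F N in sequentially. inverse (of_nat N) * (of_nat N * (x N - x0)) + x0 = x N"
    using eventually_gt_at_top[of "0::nat"]
    by eventually_elim (simp add: mult.assoc[symmetric])
  ultimately show ?thesis using Lim_transform_eventually by fastforce
qed

lemma tendsto_scaled_mult:
  fixes x y :: "nat \<Rightarrow> complex"
  assumes X: "(\<lambda>N. of_nat N * (x N - x0)) \<longlonglongrightarrow> x1" and Y: "(\<lambda>N. of_nat N * (y N - y0)) \<longlonglongrightarrow> y1"
  shows "(\<lambda>N. of_nat N * (x N * y N - x0 * y0)) \<longlonglongrightarrow> x1 * y0 + x0 * y1"
proof -
  have "(\<lambda>N. of_nat N * (x N - x0) * y N + x0 * (of_nat N * (y N - y0))) \<longlonglongrightarrow> x1 * y0 + x0 * y1"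
    by (intro tendsto_add tendsto_mult tendsto_const X Y tendsto_of_scaled[OF Y])
  then show ?thesis by (simp add: algebra_simps)
qed

section \<open>The second-order term\<close>

lemma of_nat_choose_two: "of_nat (n choose 2) = (of_nat n * (of_nat n - 1) / 2 :: complex)"
proof (induction n)
  case (Suc n)
  have "Suc n choose 2 = n + (n choose 2)" by (simp add: numeral_2_eq_2)
  then show ?case using Suc by (simp add: field_simps)
qed simp

text \<open>The falling factorial divided by \<open>N^(j + 1)\<close> is
  \<open>1 - (1 + ... + j) / N\<close> up to lower order. The induction attaches the factor
  \<open>(N - j - 1) / (N (j + 2))\<close>.\<close>

lemma choose_ratio_asymptotics:
  "(\<lambda>N. of_nat N * (of_nat (N choose Suc j) / of_nat N ^ Suc j - 1 / fact (Suc j))) \<longlonglongrightarrow>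
     (- (of_nat (Suc j choose 2) / fact (Suc j)) :: complex)"
proof (induction j)
  case 0
  have "\<forall>\<^sub>F N in sequentially. of_nat N * (of_nat (N choose Suc 0) / of_nat N ^ Suc 0 - 1 / fact (Suc 0)) = (0::complex)"
    using eventually_gt_at_top[of "0::nat"] by eventually_elim simp
  then show ?case by (simp add: tendsto_eventually binomial_eq_0)
next
  case (Suc j)
  define c :: "nat \<Rightarrow> complex" where "c = (\<lambda>N. of_nat (N choose Suc j) / of_nat N ^ Suc j)"
  let ?J = "of_nat (Suc j) :: complex"
  have IH: "(\<lambda>N. of_nat N * (c N - 1 / fact (Suc j))) \<longlonglongrightarrow> - (of_nat (Suc j choose 2) / fact (Suc j))"
    using Suc unfolding c_def .
  have "(\<lambda>N. (of_nat N * (c N - 1 / fact (Suc j)) - ?J * c N) / (?J + 1)) \<longlonglongrightarrow>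
      (- (of_nat (Suc j choose 2) / fact (Suc j)) - ?J * (1 / fact (Suc j))) / (?J + 1)"
    using of_nat_neq_0[of "Suc j", where 'a = complex]
    by (intro tendsto_divide tendsto_diff tendsto_mult tendsto_const IH tendsto_of_scaled[OF IH])
       (simp add: add.commute)
  moreover have "\<forall>\<^sub>F N in sequentially. (of_nat N * (c N - 1 / fact (Suc j)) - ?J * c N) / (?J + 1) =
     of_nat N * (of_nat (N choose Suc (Suc j)) / of_nat N ^ Suc (Suc j) - 1 / fact (Suc (Suc j)))"
    using eventually_gt_at_top[of "Suc j"]
  proof eventually_elim
    case (elim N)
    have N: "of_nat N \<noteq> (0::complex)" using elim by simp
    have J: "?J + 1 \<noteq> 0" using of_nat_neq_0[of "Suc j", where 'a = complex] by (simp add: add.commute)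
    have "Suc (Suc j) * (N choose Suc (Suc j)) = (N - Suc j) * (N choose Suc j)"
      using binomial_absorb_comp[of N "Suc j"] binomial_absorption[of "Suc j" N] by simp
    then have "of_nat (Suc (Suc j)) * of_nat (N choose Suc (Suc j)) = (of_nat (N - Suc j) * of_nat (N choose Suc
          j) :: complex)"
      by (simp only: of_nat_mult[symmetric])
    also have "of_nat (N - Suc j) = (of_nat N - ?J :: complex)" using elim by (intro of_nat_diff) auto
    finally have rec: "of_nat (N choose Suc (Suc j)) = (of_nat N - ?J) * of_nat (N choose Suc j) / (?J + 1)"
      using J by (simp add: field_simps)
    have f: "fact (Suc (Suc j)) = (?J + 1) * fact (Suc j)" by (simp add: algebra_simps)
    have g: "(n * (x / M - 1 / F) - t * (x / M)) / (t + 1) = n * ((n - t) * x / (t + 1) / (n * M) - 1 / ((t + 1) * F))"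
      if "n \<noteq> 0" "M \<noteq> 0" "F \<noteq> 0" "t + 1 \<noteq> 0" for n x M F t :: complex
      using that by (simp add: divide_simps) (simp add: algebra_simps)
    show ?case unfolding c_def rec f power_Suc[of _ "Suc j"] 
      by (rule g[OF N power_not_zero[OF N] fact_nonzero J])
  qed
  ultimately have "(\<lambda>N. of_nat N * (of_nat (N choose Suc (Suc j)) / of_nat N ^ Suc (Suc j) - 1 / fact (Suc (Suc j)))) \<longlonglongrightarrow>
     (- (of_nat (Suc j choose 2) / fact (Suc j)) - ?J * (1 / fact (Suc j))) / (?J + 1)"
    by (rule Lim_transform_eventually)
  also have "(- (of_nat (Suc j choose 2) / fact (Suc j)) - ?J * (1 / fact (Suc j))) / (?J + 1) =
      - (of_nat (Suc (Suc j) choose 2) / fact (Suc (Suc j)))"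
  proof -
    have J: "?J + 1 \<noteq> 0" using of_nat_neq_0[of "Suc j", where 'a = complex] by (simp add: add.commute)
    have f: "fact (Suc (Suc j)) = (?J + 1) * fact (Suc j)" by (simp add: algebra_simps)
    have "Suc (Suc j) choose 2 = Suc j + (Suc j choose 2)" by (simp add: numeral_2_eq_2)
    then have c: "of_nat (Suc (Suc j) choose 2) = ?J + of_nat (Suc j choose 2)" by simp
    have g: "(- (x / F) - t * (1 / F)) / (t + 1) = - ((t + x) / ((t + 1) * F))" if "F \<noteq> 0" "t + 1 \<noteq> 0" for x F t
          :: complex
      using that by (simp add: divide_simps)
    show ?thesis unfolding f c by (rule g[OF fact_nonzero J])
  qed
  finally show ?case .
qed

text \<open>Three first-order effects are added: that of \<open>N choose Suc j\<close>, that of the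
  generating function, and that of \<open>Stirling k (k - 1)\<close>. After an index shift and one
  explicit differentiation in the first, its terms with \<open>deriv f\<close> cancel those of the
  second; the coefficients \<open>-(k - q) / 2\<close> and \<open>(k - 1) / 2\<close> of the
  remaining terms without \<open>g\<close> add up to \<open>-(1 - q) / 2\<close>.\<close>

lemma correction_identity:
  fixes f g :: "complex \<Rightarrow> complex"
  assumes hol: "f holomorphic_on ball 1 \<eta>" "g holomorphic_on ball 1 \<eta>" and \<eta>: "0 < \<eta>" "\<eta> \<le> 1"
  shows "(\<Sum>j\<le>k. of_nat ((k choose j) * fact j) *
        (- (of_nat (Suc j choose 2) / fact (Suc j)) * (pp_leading q f k j / fact j) +
          1 / fact (Suc j) * (pp_correction q f g k j / fact j))) +
      of_nat (k choose 2) * (\<Sum>j\<le>k - 1. of_nat ((k - 1 choose j) * fact j) * (1 / fact (Suc j) * (pp_leading q f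
            (k - 1) j / fact j))) =
      (\<Sum>m<k. of_nat (k choose (m + 1)) * (1 / fact m) *
        (deriv ^^ m) (\<lambda>u. u powr (of_nat k - q) * (g u - (1 - q) / (2 * u)) * f u ^ (k - m - 1)) 1)"
proof (cases k)
  case 0
  then show ?thesis by (simp add: binomial_eq_0 pp_correction_def)
next
  case (Suc n)
  let ?S = "ball (1::complex) \<eta>"
  let ?p = "\<lambda>a u. u powr a :: complex"
  have nz: "u \<notin> \<real>\<^sub>\<le>\<^sub>0" if "u \<in> ?S" for u
  proof -
    have "cmod (u - 1) < 1" using that \<eta> by (simp add: dist_norm norm_minus_commute)
    then show ?thesis using one_plus_not_nonpos_Reals[of "u - 1"] by simp
  qed
  have hp: "?p a holomorphic_on ?S" for a
    using nz by (intro holomorphic_intros) auto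
  have hf': "deriv f holomorphic_on ?S" by (intro holomorphic_deriv hol open_ball)
  have 1: "(1::complex) \<in> ?S" using \<eta> by simp
  \<comment> \<open>The three types of terms: with \<open>g\<close>, with neither, and with
    \<open>deriv f\<close>. In \<open>\<beta>\<close> the exponent is
    \<open>n - q = k - 1 - q\<close>, the result of differentiating the power or of dividing it by
    \<open>u\<close>.\<close>
  define \<alpha> where "\<alpha> = (\<lambda>i. (deriv ^^ i) (\<lambda>u. ?p (of_nat k - q) u * g u * f u ^ (n - i)) 1)"
  define \<beta> where "\<beta> = (\<lambda>i. (deriv ^^ i) (\<lambda>u. ?p (of_nat n - q) u * f u ^ (n - i)) 1)"
  define \<gamma> where "\<gamma> = (\<lambda>i. (deriv ^^ i) (\<lambda>u. ?p (of_nat k - q) u * deriv f u * f u ^ (n - i - 1)) 1)"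
  have h\<alpha>: "(\<lambda>u. ?p (of_nat k - q) u * g u * f u ^ (n - i)) holomorphic_on ?S" for i
    by (intro holomorphic_intros hp hol)
  have h\<beta>: "(\<lambda>u. ?p (of_nat n - q) u * f u ^ (n - i)) holomorphic_on ?S" for i
    by (intro holomorphic_intros hp hol)
  have h\<gamma>: "(\<lambda>u. ?p (of_nat k - q) u * deriv f u * f u ^ (n - i - 1)) holomorphic_on ?S" for i
    by (intro holomorphic_intros hp hol hf')
  have lin: "(deriv ^^ i) h 1 = a * (deriv ^^ i) F 1 + b * (deriv ^^ i) G 1"
    if "F holomorphic_on ?S" "G holomorphic_on ?S" "\<And>u. u \<in> ?S \<Longrightarrow> h u = a * F u + b * G u"
    for i h F G a b
  proof -
    have hF: "(\<lambda>u. a * F u) holomorphic_on ?S" and hG: "(\<lambda>u. b * G u) holomorphic_on ?S"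
      using that by (auto intro!: holomorphic_intros)
    have "(deriv ^^ i) h 1 = (deriv ^^ i) (\<lambda>u. a * F u + b * G u) 1"
      by (rule higher_deriv_cong_ev)
         (use that(3) 1 in \<open>auto intro!: eventually_mono[OF eventually_nhds_in_open[OF open_ball 1]]\<close>)
    also have "\<dots> = (deriv ^^ i) (\<lambda>u. a * F u) 1 + (deriv ^^ i) (\<lambda>u. b * G u) 1"
      by (rule higher_deriv_add[OF hF hG open_ball 1])
    also have "\<dots> = a * (deriv ^^ i) F 1 + b * (deriv ^^ i) G 1"
      by (simp only: higher_deriv_cmult[OF that(1) 1 open_ball] higher_deriv_cmult[OF that(2) 1 open_ball])
    finally show ?thesis .
  qed
  have powr_div: "?p (of_nat k - q) u / u = ?p (of_nat n - q) u" if "u \<in> ?S" for u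
  proof -
    have "u \<noteq> 0" using nz[OF that] by auto
    moreover have "of_nat k - q = (of_nat n - q) + 1" by (simp add: Suc)
    ultimately show ?thesis by (simp only: powr_add powr_to_1) simp
  qed
  have F1: "pp_leading q f k (Suc i) = (of_nat k - q) * \<beta> i + of_nat (n - i) * \<gamma> i" for i
  proof -
    have "pp_leading q f k (Suc i) = (deriv ^^ i) (deriv (\<lambda>u. ?p (of_nat k - q) u * f u ^ (n - i))) 1"
      unfolding pp_leading_def funpow_Suc_right by (simp add: Suc)
    also have "\<dots> = (of_nat k - q) * \<beta> i + of_nat (n - i) * \<gamma> i"
      unfolding \<beta>_def \<gamma>_def
    proof (rule lin[OF h\<beta> h\<gamma>])
      fix u assume u: "u \<in> ?S"
      have df: "(f has_field_derivative deriv f u) (at u)" by (rule holomorphic_derivI[OF hol(1) open_ball u])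
      have "((\<lambda>u. ?p (of_nat k - q) u * f u ^ (n - i)) has_field_derivative
         (of_nat k - q) * ?p (of_nat k - q - 1) u * f u ^ (n - i) +
         of_nat (n - i) * (deriv f u * f u ^ (n - i - 1)) * ?p (of_nat k - q) u) (at u)"
        by (intro DERIV_mult has_field_derivative_powr nz u) (auto intro!: derivative_eq_intros df)
      then show "deriv (\<lambda>u. ?p (of_nat k - q) u * f u ^ (n - i)) u =
          (of_nat k - q) * (?p (of_nat n - q) u * f u ^ (n - i)) + of_nat (n - i) * (?p (of_nat k - q) u * deriv
                f u * f u ^ (n - i - 1))"
        by (subst DERIV_imp_deriv) (auto simp: Suc mult_ac)
    qed
    finally show ?thesis .
  qed
  have F2: "pp_correction q f g k i = of_nat (k - i) * \<alpha> i + of_nat ((k - i) choose 2) * \<gamma> i" if "i \<le> n" for i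
    unfolding pp_correction_def \<alpha>_def \<gamma>_def
    by (rule lin[OF h\<alpha> h\<gamma>]) (use that in \<open>simp add: Suc Suc_diff_le algebra_simps numeral_2_eq_2\<close>)
  have F2': "pp_correction q f g k k = 0"
    by (simp add: pp_correction_def binomial_eq_0)
  have F3: "(deriv ^^ i) (\<lambda>u. ?p (of_nat k - q) u * (g u - (1 - q) / (2 * u)) * f u ^ (k - i - 1)) 1 =
     1 * \<alpha> i + (- (1 - q) / 2) * \<beta> i" for i
    unfolding \<alpha>_def \<beta>_def
  proof (rule lin[OF h\<alpha> h\<beta>])
    fix u assume u: "u \<in> ?S"
    show "?p (of_nat k - q) u * (g u - (1 - q) / (2 * u)) * f u ^ (k - i - 1) =
      1 * (?p (of_nat k - q) u * g u * f u ^ (n - i)) + - (1 - q) / 2 * (?p (of_nat n - q) u * f u ^ (n - i))"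
      unfolding powr_div[OF u, symmetric] by (simp add: Suc algebra_simps add_divide_distrib diff_divide_distrib)
  qed
  define K where "K = (\<lambda>i. of_nat (k choose Suc i) :: complex)"
  have F0: "of_nat (k choose i) * (of_nat k - of_nat i) = K i * (of_nat i + 1)" if "i \<le> n" for i
  proof -
    have "Suc i * (k choose Suc i) = (k - i) * (k choose i)"
      using binomial_absorb_comp[of k i] binomial_absorption[of i k] by simp
    then have "(of_nat (Suc i) * of_nat (k choose Suc i) :: complex) = of_nat (k - i) * of_nat (k choose i)"
      by (simp only: of_nat_mult[symmetric])
    moreover have "of_nat (k - i) = (of_nat k - of_nat i :: complex)" using that Suc by (intro of_nat_diff) auto
    ultimately show ?thesis by (simp add: K_def mult.commute add.commute)
  qed
  have F0': "of_nat k * of_nat (n choose i) = K i * (of_nat i + 1)" for i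
  proof -
    have "Suc i * (k choose Suc i) = k * (n choose i)" using binomial_absorption[of i k] by (simp add: Suc)
    then have "(of_nat (Suc i) * of_nat (k choose Suc i) :: complex) = of_nat k * of_nat (n choose i)"
      by (simp only: of_nat_mult[symmetric])
    then show ?thesis by (simp add: K_def mult.commute add.commute)
  qed
  let ?s1 = "\<Sum>j\<le>k. of_nat ((k choose j) * fact j) *
        (- (of_nat (Suc j choose 2) / fact (Suc j)) * (pp_leading q f k j / fact j) +
          1 / fact (Suc j) * (pp_correction q f g k j / fact j))"
  define A where "A = (\<lambda>i. - (K i / (2 * fact i)) * pp_leading q f k (Suc i))"
  define B where "B = (\<lambda>i. of_nat (k choose i) / fact (Suc i) * pp_correction q f g k i)"
  define C where "C = (\<lambda>i. of_nat (k choose 2) * (of_nat (n choose i) / fact (Suc i) * \<beta> i))"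
  have "?s1 =
     (\<Sum>j\<le>k. of_nat (k choose j) * - (of_nat (Suc j choose 2) / fact (Suc j)) * pp_leading q f k j) + (\<Sum>j\<le>k. B j)"
  proof -
    have "c * y * (- (x / F) * (d / y) + 1 / F * (w / y)) = c * - (x / F) * d + c / F * w"
      if "y \<noteq> 0" for c d w x y F :: complex
      using that by (cases "F = 0") (auto simp: field_simps)
    then show ?thesis
      unfolding sum.distrib[symmetric] B_def by (intro sum.cong refl) (simp only: of_nat_mult of_nat_fact
            fact_nonzero not_False_eq_True)
  qed
  \<comment> \<open>The term \<open>j = 0\<close> vanishes because \<open>1 choose 2 = 0\<close>;
    every other \<open>j\<close> is \<open>Suc i\<close>, so one derivative can be carried
    out.\<close>
  also have "(\<Sum>j\<le>k. of_nat (k choose j) * - (of_nat (Suc j choose 2) / fact (Suc j)) * pp_leading q f k j) = (\<Sum>i\<le>n. A i)"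
  proof -
    have "(\<Sum>j\<le>k. of_nat (k choose j) * - (of_nat (Suc j choose 2) / fact (Suc j)) * pp_leading q f k j) =
      (\<Sum>i\<le>n. of_nat (k choose Suc i) * - (of_nat (Suc (Suc i) choose 2) / fact (Suc (Suc i))) * pp_leading q f k (Suc i))"
      unfolding Suc by (subst sum.atMost_Suc_shift) (simp add: binomial_eq_0)
    also have "\<dots> = (\<Sum>i\<le>n. A i)"
    proof (intro sum.cong refl)
      fix i
      have z: "of_nat (Suc i) \<noteq> (0::complex)" "of_nat (Suc (Suc i)) \<noteq> (0::complex)" using of_nat_neq_0 by blast+
      have "of_nat (Suc (Suc i) choose 2) / fact (Suc (Suc i)) = (1 / (2 * fact i) :: complex)"
      proof -
        have e: "of_nat (Suc (Suc i)) - 1 = (of_nat (Suc i) :: complex)" by simp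
        have "x * y / 2 / (x * (y * F)) = 1 / (2 * F)" if "x \<noteq> 0" "y \<noteq> 0" for x y F :: complex
          using that by simp
        then show ?thesis unfolding of_nat_choose_two e fact_Suc using z by simp
      qed
      then show "of_nat (k choose Suc i) * - (of_nat (Suc (Suc i) choose 2) / fact (Suc (Suc i))) * pp_leading q
            f k (Suc i) = A i"
        by (simp only: A_def K_def) simp
    qed
    finally show ?thesis .
  qed
  also have "(\<Sum>j\<le>k. B j) = (\<Sum>i\<le>n. B i)"
    unfolding Suc using F2' by (simp add: B_def Suc)
  finally have S1: "?s1 = (\<Sum>i\<le>n. A i) + (\<Sum>i\<le>n. B i)" .
  have S2: "of_nat (k choose 2) * (\<Sum>j\<le>k - 1. of_nat ((k - 1 choose j) * fact j) * (1 / fact (Suc j) *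
        (pp_leading q f (k - 1) j / fact j))) =
      (\<Sum>i\<le>n. C i)"
    unfolding sum_distrib_left
    by (intro sum.cong) (auto simp: Suc C_def pp_leading_def \<beta>_def)
  have main: "A i + B i + C i = K i / fact i * (\<alpha> i - (1 - q) / 2 * \<beta> i)" if i: "i \<le> n" for i
  proof -
    define t :: complex where "t = of_nat i + 1"
    have t: "t \<noteq> 0" using of_nat_neq_0[of i, where 'a = complex] by (simp add: t_def add.commute)
    define c where "c = K i / fact i"
    have ni: "of_nat (n - i) = (of_nat k - of_nat i - 1 :: complex)" using i by (simp add: Suc of_nat_diff)
    have ki: "of_nat (k - i) = (of_nat k - of_nat i :: complex)" using i Suc by (intro of_nat_diff) auto
    have fact: "fact (Suc i) = t * fact i" by (simp add: t_def algebra_simps)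
    have r1: "of_nat (k choose i) / fact (Suc i) * (of_nat k - of_nat i) = c"
      using F0[OF i] t unfolding fact c_def t_def[symmetric] by (simp add: field_simps)
    have r2: "of_nat k * (of_nat (n choose i) / fact (Suc i)) = c"
      using F0'[of i] t unfolding fact c_def t_def[symmetric] by (simp add: field_simps)
    have "B i = of_nat (k choose i) / fact (Suc i) * (of_nat k - of_nat i) * (\<alpha> i + (of_nat k - of_nat i - 1) / 2 * \<gamma> i)"
    proof -
      have "x * (y * a + y * (y - 1) / 2 * g) = x * y * (a + (y - 1) / 2 * g)" for a g x y :: complex
        by (simp add: field_simps)
      then show ?thesis unfolding B_def F2[OF i] of_nat_choose_two ki .
    qed
    then have B': "B i = c * (\<alpha> i + (of_nat k - of_nat i - 1) / 2 * \<gamma> i)" unfolding r1 .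
    have "C i = of_nat k * (of_nat (n choose i) / fact (Suc i)) * ((of_nat k - 1) / 2 * \<beta> i)"
      unfolding C_def of_nat_choose_two by (simp add: mult_ac)
    then have C': "C i = c * ((of_nat k - 1) / 2 * \<beta> i)" unfolding r2 .
    have A': "A i = - (c / 2) * ((of_nat k - q) * \<beta> i + (of_nat k - of_nat i - 1) * \<gamma> i)"
      unfolding A_def F1 ni c_def by simp
    have "- (c / 2) * ((x - q) * b + y * g) + c * (a + y / 2 * g) + c * ((x - 1) / 2 * b) = c * (a - (1 - q) / 2 * b)"
      for a b g x y :: complex
      by (simp add: field_simps)
    then show ?thesis unfolding A' B' C' c_def[symmetric] .
  qed
  have "(\<Sum>i\<le>n. A i) + (\<Sum>i\<le>n. B i) + (\<Sum>i\<le>n. C i) = (\<Sum>i\<le>n. K i / fact i * (\<alpha> i - (1 - q) / 2 * \<beta> i))"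
    unfolding sum.distrib[symmetric] by (intro sum.cong refl main) auto
  also have "\<dots> = (\<Sum>m<k. of_nat (k choose (m + 1)) * (1 / fact m) *
        (deriv ^^ m) (\<lambda>u. u powr (of_nat k - q) * (g u - (1 - q) / (2 * u)) * f u ^ (k - m - 1)) 1)"
  proof -
    have "1 * a + - (1 - q) / 2 * b = a - (1 - q) / 2 * b" for a b :: complex by (simp add: field_simps)
    then show ?thesis unfolding F3 by (simp only: Suc K_def lessThan_Suc_atMost) simp
  qed
  finally show ?thesis unfolding S1 S2 .
qed

theorem theorem19:
  fixes q :: real and \<rho> :: "nat \<Rightarrow> int list pmf" and \<Psi> \<Phi> :: "complex \<Rightarrow> complex"
  assumes q: "-1 \<le> q" "q \<le> 1"
    and supp: "\<And>N. set_pmf (\<rho> N) \<subseteq> signatures N"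
    and conv: "\<And>N. \<exists>\<epsilon>>0. uniform_limit (polydisc N \<epsilon>)
                 (\<lambda>F u. \<Sum>l\<in>F. sgf_term (\<rho> N) N l u) (sgf (\<rho> N) N)
                 (finite_subsets_at_top (signatures N))"
    and an: "\<Psi> analytic_on {1}" "\<Phi> analytic_on {1}"
    and lim: "\<And>k. \<exists>\<epsilon>>0. \<exists>L :: nat \<Rightarrow> (nat \<Rightarrow> complex) \<Rightarrow> complex.
               (\<forall>\<^sub>F N in sequentially. continuous_on (polydisc k \<epsilon>) (L N) \<and> L N ones = 0 \<and>
                  (\<forall>u\<in>polydisc k \<epsilon>. exp (L N u) = sgf (\<rho> N) N (pad_ones k u))) \<and>
               uniform_limit (polydisc k \<epsilon>)
                 (\<lambda>N u. of_nat N * (L N u / of_nat N - (\<Sum>i<k. \<Psi> (u i))))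
                 (\<lambda>u. \<Sum>i<k. \<Phi> (u i)) sequentially"
  shows "(\<forall>\<^sub>F N in sequentially.
            integrable (measure_pmf (\<rho> N)) (\<lambda>l. pp_moment q N l k)) \<and>
         (\<lambda>N. of_nat N *
            (complex_of_real (measure_pmf.expectation (\<rho> N) (\<lambda>l. pp_moment q N l k))
             - (\<Sum>m\<le>k. of_nat (k choose m) * (1 / fact (m + 1)) *
                 (deriv ^^ m) (\<lambda>u. u powr complex_of_real (real k - q) * (deriv \<Psi> u) ^ (k - m)) 1)))
         \<longlonglongrightarrow> (\<Sum>m<k. of_nat (k choose (m + 1)) * (1 / fact m) *
                 (deriv ^^ m) (\<lambda>u. u powr complex_of_real (real k - q) *
                     (deriv \<Phi> u - complex_of_real (1 - q) / (2 * u)) * (deriv \<Psi> u) ^ (k - m - 1)) 1)"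
proof -
  define \<kappa> where "\<kappa> = complex_of_real q"
  define f where "f = deriv \<Psi>"
  define g where "g = deriv \<Phi>"
  \<comment> \<open>The hypothesis is used for \<open>k + 1\<close> variables, since the root points
    for \<open>j \<le> k\<close> move up to \<open>k + 1\<close> coordinates.\<close>
  obtain \<epsilon> L where \<epsilon>: "\<epsilon> > 0"
    and L: "\<forall>\<^sub>F N in sequentially. continuous_on (polydisc (Suc k) \<epsilon>) (L N) \<and> L N ones = 0 \<and>
        (\<forall>u\<in>polydisc (Suc k) \<epsilon>. exp (L N u) = sgf (\<rho> N) N (pad_ones (Suc k) u))"
    and ul: "uniform_limit (polydisc (Suc k) \<epsilon>)
       (\<lambda>N u. of_nat N * (L N u / of_nat N - (\<Sum>i<Suc k. \<Psi> (u i)))) (\<lambda>u. \<Sum>i<Suc k. \<Phi> (u i)) sequentially"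
    using lim[of "Suc k"] by blast
  have L': "\<forall>\<^sub>F N in sequentially. L N ones = 0 \<and>
        (\<forall>u\<in>polydisc (Suc k) \<epsilon>. exp (L N u) = sgf (\<rho> N) N (pad_ones (Suc k) u))"
    using L by eventually_elim auto
  obtain \<delta> where \<delta>: "0 < \<delta>" "\<delta> < 1"
    "\<forall>\<^sub>F N in sequentially. \<forall>X\<subseteq>{..<Suc k}. sgf (\<rho> N) N (corner \<delta> (Suc k) X) \<noteq> 0"
    and asym: "\<And>j m q. j \<le> m \<Longrightarrow> m \<le> k \<Longrightarrow>
      (\<lambda>N. of_nat N * (sgf_taylor (\<rho> N) q N m j / of_nat N ^ (m - j) -
         pp_leading q (deriv \<Psi>) m j / fact j)) \<longlonglongrightarrow>
      pp_correction q (deriv \<Psi>) (deriv \<Phi>) m j / fact j"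
    by (rule sgf_taylor_asymptotics[OF an \<epsilon> L' ul]) blast
  define T where "T = (\<lambda>N m j. sgf_taylor (\<rho> N) \<kappa> N m j / of_nat N ^ (m - j))"
  define c :: "nat \<Rightarrow> nat \<Rightarrow> complex" where "c = (\<lambda>N j. of_nat (N choose Suc j) / of_nat N ^ Suc j)"
  \<comment> \<open>For large \<open>N\<close> this is the expected \<open>m\<close>-th factorial
    moment divided by \<open>N^(m + 1)\<close>; \<open>b m\<close> is its limit and
    \<open>b' m\<close> its \<open>1 / N\<close> coefficient.\<close>
  define Bm where "Bm = (\<lambda>N m. \<Sum>j\<le>m. of_nat ((m choose j) * fact j) * (c N j * T N m j))"
  define b where "b = (\<lambda>m. \<Sum>j\<le>m. of_nat ((m choose j) * fact j) * (1 / fact (Suc j) * (pp_leading \<kappa> f m j / fact j)))"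
  define b' where "b' = (\<lambda>m. \<Sum>j\<le>m. of_nat ((m choose j) * fact j) *
        (- (of_nat (Suc j choose 2) / fact (Suc j)) * (pp_leading \<kappa> f m j / fact j) +
          1 / fact (Suc j) * (pp_correction \<kappa> f g m j / fact j)))"
  define M where "M = (\<lambda>N. (\<Sum>m\<le>k. of_nat (Stirling k m) *
       (\<Sum>j\<le>m. of_nat ((m choose j) * fact j * (N choose Suc j)) * sgf_taylor (\<rho> N) \<kappa> N m j)) / of_nat N ^ Suc k)"

  let ?rhs = "\<Sum>m<k. of_nat (k choose (m + 1)) * (1 / fact m) *
        (deriv ^^ m) (\<lambda>u. u powr (of_nat k - \<kappa>) * (g u - (1 - \<kappa>) / (2 * u)) * f u ^ (k - m - 1)) 1"

  have moments: "\<forall>\<^sub>F N in sequentially. integrable (measure_pmf (\<rho> N)) (\<lambda>l. pp_moment q N l k) \<and>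
      complex_of_real (measure_pmf.expectation (\<rho> N) (\<lambda>l. pp_moment q N l k)) = M N"
    using \<delta>(3) eventually_gt_at_top[of k]
  proof eventually_elim
    case (elim N)
    have "((\<lambda>l. complex_of_real (pmf (\<rho> N) l * pp_moment q N l k)) has_sum M N) (signatures N)"
      unfolding M_def \<kappa>_def by (rule has_sum_pp_moment[OF \<delta>(1,2) elim(2)]) (use elim(1) in auto)
    from integrable_pmf_has_sum[OF this supp] expectation_pmf_has_sum[OF this supp] show ?case
      by blast
  qed

  have Blim: "(\<lambda>N. of_nat N * (Bm N m - b m)) \<longlonglongrightarrow> b' m" if m: "m \<le> k" for m
  proof -
    have "(\<lambda>N. \<Sum>j\<le>m. of_nat ((m choose j) * fact j) *
        (of_nat N * (c N j * T N m j - 1 / fact (Suc j) * (pp_leading \<kappa> f m j / fact j)))) \<longlonglongrightarrow> b' m"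
      unfolding b'_def
    proof (intro tendsto_sum tendsto_mult[OF tendsto_const] tendsto_scaled_mult)
      fix j assume "j \<in> {..m}"
      then show "(\<lambda>N. of_nat N * (T N m j - pp_leading \<kappa> f m j / fact j)) \<longlonglongrightarrow> pp_correction \<kappa> f g m j / fact j"
        using asym[of j m \<kappa>] m unfolding T_def f_def g_def by simp
      show "(\<lambda>N. of_nat N * (c N j - 1 / fact (Suc j))) \<longlonglongrightarrow> - (of_nat (Suc j choose 2) / fact (Suc j))"
        unfolding c_def by (rule choose_ratio_asymptotics)
    qed
    moreover have "(\<Sum>j\<le>m. of_nat ((m choose j) * fact j) *
        (of_nat N * (c N j * T N m j - 1 / fact (Suc j) * (pp_leading \<kappa> f m j / fact j)))) = of_nat N * (Bm N m
              - b m)" for N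
      unfolding Bm_def b_def sum_subtractf[symmetric] sum_distrib_left right_diff_distrib
      by (intro sum.cong refl) (simp only: mult_ac)
    ultimately show ?thesis by simp
  qed

  \<comment> \<open>In \<open>M N\<close> the \<open>m\<close>-th factorial moment carries
    \<open>N^(m - k)\<close>. After multiplication by \<open>N\<close>, the term
    \<open>m = k\<close> gives the scaled difference, \<open>m = k - 1\<close> stays bounded, and
    the others vanish in the limit.\<close>
  have M: "\<forall>\<^sub>F N in sequentially. of_nat N * (Bm N k - b k) +
      (\<Sum>m<k. of_nat (Stirling k m) * (Bm N m * inverse (of_nat N) ^ (k - m - 1))) = of_nat N * (M N - b k)"
    using eventually_gt_at_top[of "0::nat"]
  proof eventually_elim
    case (elim N)
    define n where "n = (of_nat N :: complex)"
    have n: "n \<noteq> 0" using elim by (simp add: n_def)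
    have inner: "(\<Sum>j\<le>m. of_nat ((m choose j) * fact j * (N choose Suc j)) * sgf_taylor (\<rho> N) \<kappa> N m j) = n ^ Suc
          m * Bm N m" for m
      unfolding Bm_def sum_distrib_left
    proof (intro sum.cong refl)
      fix j assume "j \<in> {..m}"
      then have e: "n ^ Suc m = n ^ Suc j * n ^ (m - j)" by (simp flip: power_add)
      show "of_nat ((m choose j) * fact j * (N choose Suc j)) * sgf_taylor (\<rho> N) \<kappa> N m j =
         n ^ Suc m * (of_nat ((m choose j) * fact j) * (c N j * T N m j))"
        unfolding e c_def T_def n_def[symmetric] using n by simp
    qed
    have "M N = (\<Sum>m\<le>k. of_nat (Stirling k m) * (n ^ Suc m * Bm N m)) / n ^ Suc k"
      unfolding M_def inner n_def[symmetric] ..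
    then have "n * M N = (\<Sum>m\<le>k. of_nat (Stirling k m) * (Bm N m * (n * (n ^ Suc m / n ^ Suc k))))"
      by (simp only: sum_divide_distrib sum_distrib_left divide_inverse mult_ac)
    also have "\<dots> = (\<Sum>m<k. of_nat (Stirling k m) * (Bm N m * (n * (n ^ Suc m / n ^ Suc k)))) + Bm N k * n"
      using n by (simp add: lessThan_Suc_atMost[symmetric])
    also have "(\<Sum>m<k. of_nat (Stirling k m) * (Bm N m * (n * (n ^ Suc m / n ^ Suc k)))) =
       (\<Sum>m<k. of_nat (Stirling k m) * (Bm N m * inverse n ^ (k - m - 1)))"
    proof (intro sum.cong refl)
      fix m assume "m \<in> {..<k}"
      then have "n ^ Suc k = n ^ Suc m * (n * n ^ (k - m - 1))" by (simp flip: power_add power_Suc)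
      then have "n * (n ^ Suc m / n ^ Suc k) = inverse n ^ (k - m - 1)"
      proof -
        have "n * (y / (y * (n * z))) = inverse z" if "y \<noteq> 0" for y z
          using n that by (simp add: divide_simps)
        from this[OF power_not_zero[OF n]] show ?thesis
          unfolding \<open>n ^ Suc k = _\<close> power_inverse .
      qed
      then show "of_nat (Stirling k m) * (Bm N m * (n * (n ^ Suc m / n ^ Suc k))) =
          of_nat (Stirling k m) * (Bm N m * inverse n ^ (k - m - 1))" by simp
    qed
    finally show ?case unfolding n_def by (simp add: algebra_simps)
  qed
  have "(\<lambda>N. of_nat N * (Bm N k - b k) +
      (\<Sum>m<k. of_nat (Stirling k m) * (Bm N m * inverse (of_nat N) ^ (k - m - 1)))) \<longlonglongrightarrow>
      b' k + (\<Sum>m<k. of_nat (Stirling k m) * (b m * 0 ^ (k - m - 1)))"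
    by (intro tendsto_add Blim tendsto_sum tendsto_mult tendsto_const tendsto_power lim_inverse_n
        tendsto_of_scaled[OF Blim]) auto
  \<comment> \<open>For \<open>m < k\<close> the power \<open>0 ^ (k - m - 1)\<close> is 1 exactly
    when \<open>m = k - 1\<close>.\<close>
  also have "(\<Sum>m<k. of_nat (Stirling k m) * (b m * 0 ^ (k - m - 1))) = of_nat (k choose 2) * b (k - 1)"
  proof (cases k)
    case (Suc n)
    have "(\<Sum>m<n. of_nat (Stirling k m) * (b m * 0 ^ (k - m - 1))) = 0"
      by (intro sum.neutral) (auto simp: Suc)
    then show ?thesis by (simp add: Suc Stirling_Suc_n_n del: Stirling.simps)
  qed (simp add: binomial_eq_0)
  also have "b' k + of_nat (k choose 2) * b (k - 1) = ?rhs"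
  proof -
    obtain \<eta>1 \<eta>2 where \<eta>: "\<eta>1 > 0" "\<Psi> holomorphic_on ball 1 \<eta>1" "\<eta>2 > 0" "\<Phi> holomorphic_on ball 1 \<eta>2"
      using an unfolding analytic_at_ball by blast
    define \<eta> where "\<eta> = min 1 (min \<eta>1 \<eta>2)"
    have "f holomorphic_on ball 1 \<eta>" "g holomorphic_on ball 1 \<eta>"
      unfolding f_def g_def using \<eta> by (auto simp: \<eta>_def intro!: holomorphic_deriv intro: holomorphic_on_subset)
    then show ?thesis
      unfolding b'_def b_def using \<eta> by (intro correction_identity[of f \<eta> g]) (auto simp: \<eta>_def)
  qed
  finally have "(\<lambda>N. of_nat N * (M N - b k)) \<longlonglongrightarrow> ?rhs"
    using M by (rule Lim_transform_eventually)
  moreover have "\<forall>\<^sub>F N in sequentially. of_nat N * (M N - b k) =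
      of_nat N * (complex_of_real (measure_pmf.expectation (\<rho> N) (\<lambda>l. pp_moment q N l k)) - b k)"
    using moments by eventually_elim simp
  ultimately have "(\<lambda>N. of_nat N * (complex_of_real (measure_pmf.expectation (\<rho> N) (\<lambda>l. pp_moment q N l k)) - b k)) \<longlonglongrightarrow>
      ?rhs"
    by (rule Lim_transform_eventually)
  moreover have "b k = (\<Sum>m\<le>k. of_nat (k choose m) * (1 / fact (m + 1)) *
                 (deriv ^^ m) (\<lambda>u. u powr complex_of_real (real k - q) * (deriv \<Psi> u) ^ (k - m)) 1)"
    unfolding b_def pp_leading_def f_def \<kappa>_def by (intro sum.cong refl) simp
  moreover have "\<forall>\<^sub>F N in sequentially. integrable (measure_pmf (\<rho> N)) (\<lambda>l. pp_moment q N l k)"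
    using moments by eventually_elim simp
  ultimately show ?thesis by (simp add: f_def g_def \<kappa>_def)
qed

end
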